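(* For any $\alpha\in\mathbb{R}$, any smooth vector fields $\mathbf{U},\mathbf{V}\in\Gamma TN$ and at every $P\in N$, $$\nabla_{\mathbf{U}}^\alpha\mathbf{V}\phi_e=\mathbf{U}\mathbf{V}\phi_e+\tfrac{1-\alpha}{2}\Big[(\mathbf{U}\phi_e-\mathbf{E}_P\mathbf{U}\phi_e)\cdot(\mathbf{V}\phi_e-\mathbf{E}_P\mathbf{V}\phi_e)-\mathbf{E}_\mu\big[(\mathbf{U}\phi_e-\mathbf{E}_P\mathbf{U}\phi_e)\cdot(\mathbf{V}\phi_e-\mathbf{E}_P\mathbf{V}\phi_e)\big]\Big].$$
   Context: Let $B$ be an open subset of a (real) Banach space $\mathbb{X}$, let $\mathcal{X}_B$ be the Borel $\sigma$-algebra of $B$, and let $\mu$ be a probability measure on $(B,\mathcal{X}_B)$ such that $\mu(A)>0$ for every non-empty open $A\in\mathcal{X}_B$. Fix $k\in\mathbb{N}_0$. $\mathbb{G}:=C_b^k(B;\mathbb{R})$ is the Banach space of bounded continuous functions $a:B\to\mathbb{R}$ with bounded continuous Fréchet derivatives $a^{(i)}$ of all orders $1\le i\le k$, with norm $\|a\|_{\mathbb{G}}=\sup_{x\in B}|a(x)|+\sum_{i=1}^k\sup_{x\in B}\|a_x^{(i)}\|_{L(\mathbb{X}^i;\mathbb{R})}$. Products $a\cdot b$ in $\mathbb{G}$ are pointwise, $\exp_{\mathbb{G}}(a)(x)=\exp(a(x))$; $\mathbf{E}_\mu a=\int_B a\,d\mu$ and $\mathbf{E}_P a=\int_B a\,dP$.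 $\mathbb{G}_0:=\{a\in\mathbb{G}:\mathbf{E}_\mu a=0\}$. The manifold $M$: the set of finite measures $P$ on $(B,\mathcal{X}_B)$, mutually absolutely continuous with respect to $\mu$, with density $dP/d\mu=\exp_{\mathbb{G}}(a)$ for some $a\in\mathbb{G}$. Its charts (each global, with smooth transition maps) are $\phi_1(P)=\log(dP/d\mu)$ and, for $\alpha\ne1$, $\phi_\alpha(P)=\frac{2}{1-\alpha}\left(\exp_{\mathbb{G}}\left(\frac{1-\alpha}{2}\phi_1(P)\right)-1\right)$. The tangent space $T_PM$ consists of the signed measures $U$ with density $dU/dP=u\in\mathbb{G}$; for a differentiable Banach-space-valued map $f$ on $M$, $Uf:=(f\circ\phi_1^{-1})^{(1)}_{\phi_1(P)}u$ is the derivative of $f$ at $P$ in direction $U$ (so $U\phi_1=dU/dP$). For each $\alpha$, $U\mapsto U\phi_\alpha$ is a linear bijection $T_PM\to\mathbb{G}$. The manifold $N:=\{P\in M:P(B)=1\}$ is a $C^\infty$-embedded submanifold of $M$, modelled on $\mathbb{G}_0$, with global charts $\phi_m,\phi_e:N\to\mathbb{G}_0$, $\phi_m(P)=dP/d\mu-1$ and $\phi_e(P)=\phi_1(P)-\mathbf{E}_\mu\phi_1(P)$. $T_PN$ is the set of $U\in T_PM$ with total mass zero, and $U\phi_e=dU/dP-\mathbf{E}_\mu(dU/dP)$. $\imath:N\to M$ is inclusion; $\nu:M\to N$, $\nu(P)=P/P(B)$, is normalisation, whose tangent map $T\nu:T_PM\to T_{\nu(P)}N$ satisfies $(T\nu X)\phi_e=X\phi_1-\mathbf{E}_\mu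 X\phi_1$. $\Gamma TN$ is the space of smooth vector fields on $N$. For $\mathbf{V}\in\Gamma TN$ and a smooth Banach-space-valued $f$ on $N$, $\mathbf{V}f$ is the map $P\mapsto\mathbf{V}_Pf$, and $\mathbf{U}\mathbf{V}f:=\mathbf{U}(\mathbf{V}f)$. The $\alpha$-covariant derivative $\nabla^\alpha$ on $N$ is defined, for $\mathbf{U},\mathbf{V}\in\Gamma TN$ and $P\in N$, by $(\nabla_{\mathbf{U}}^\alpha\mathbf{V})_P:=T\nu\,\mathbf{W}_P$, where $\mathbf{W}_P\in T_PM$ is the unique tangent vector with $\mathbf{W}_P\phi_\alpha=\mathbf{U}_P\mathbf{V}(\phi_\alpha\circ\imath)$. *)

theory Defs
  imports "HOL-Probability.Probability" "HOL-Library.Function_Algebras"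
begin

text \<open>
  Pointwise real vector space structure on function types; the pointwise
  \<open>+\<close>, \<open>-\<close>, \<open>*\<close> are those of \<^theory>\<open>HOL-Library.Function_Algebras\<close>.
\<close>

instantiation "fun" :: (type, real_vector) real_vector
begin

definition scaleR_fun :: "real \<Rightarrow> ('a \<Rightarrow> 'b) \<Rightarrow> 'a \<Rightarrow> 'b" where
  "scaleR_fun c f = (\<lambda>x. c *\<^sub>R f x)"

instance
  by standard (auto simp: scaleR_fun_def fun_eq_iff scaleR_add_right scaleR_add_left)

end


section \<open>Calculus between normed spaces with explicit carrier and norm\<close>

text \<open>
  The space \<open>C\<^sub>b\<^sup>k(B)\<close> depends on the terms \<open>B\<close> and \<open>k\<close>, so it cannot be a type of class
  \<open>real_normed_vector\<close>. A normed space is therefore given by a linear subspace of a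
  \<open>real_vector\<close> type together with a norm on it.
\<close>

record 'v nspace =
  carr :: "'v set"
  nrm :: "'v \<Rightarrow> real"

definition type_space :: "'a::real_normed_vector nspace" where
  "type_space = \<lparr>carr = UNIV, nrm = norm\<rparr>"

definition bounded_linear_map ::
    "'v::real_vector nspace \<Rightarrow> 'w::real_vector nspace \<Rightarrow> ('v \<Rightarrow> 'w) \<Rightarrow> bool" where
  "bounded_linear_map E F L \<longleftrightarrow>
     L ` carr E \<subseteq> carr F \<and>
     (\<forall>u\<in>carr E. \<forall>w\<in>carr E. L (u + w) = L u + L w) \<and>
     (\<forall>c. \<forall>u\<in>carr E. L (c *\<^sub>R u) = c *\<^sub>R L u) \<and>
     (\<exists>C. \<forall>u\<in>carr E. nrm F (L u) \<le> C * nrm E u)"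

definition has_fderiv ::
    "'v::real_vector nspace \<Rightarrow> 'w::real_vector nspace \<Rightarrow> 'v set \<Rightarrow> ('v \<Rightarrow> 'w) \<Rightarrow> ('v \<Rightarrow> 'w) \<Rightarrow> 'v \<Rightarrow> bool"
  where
  "has_fderiv E F U f L x \<longleftrightarrow>
     x \<in> U \<and> f ` U \<subseteq> carr F \<and> bounded_linear_map E F L \<and>
     (\<forall>e>0. \<exists>d>0. \<forall>y\<in>U. nrm E (y - x) < d \<longrightarrow>
        nrm F (f y - f x - L (y - x)) \<le> e * nrm E (y - x))"

definition fdifferentiable ::
    "'v::real_vector nspace \<Rightarrow> 'w::real_vector nspace \<Rightarrow> 'v set \<Rightarrow> ('v \<Rightarrow> 'w) \<Rightarrow> 'v \<Rightarrow> bool" where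
  "fdifferentiable E F U f x \<longleftrightarrow> (\<exists>L. has_fderiv E F U f L x)"

text \<open>
  \<open>fderiv E F U f x u\<close> is \<open>f\<^sup>(\<^sup>1\<^sup>)\<^sub>x u\<close>. The derivative is determined on \<open>carr E\<close> only, whence the
  description of its value at \<open>u\<close> rather than of the map itself. The set \<open>U\<close> is always open
  relative to \<open>E\<close>.
\<close>

definition fderiv ::
    "'v::real_vector nspace \<Rightarrow> 'w::real_vector nspace \<Rightarrow> 'v set \<Rightarrow> ('v \<Rightarrow> 'w) \<Rightarrow> 'v \<Rightarrow> 'v \<Rightarrow> 'w" where
  "fderiv E F U f x u = (THE y. \<exists>L. has_fderiv E F U f L x \<and> y = L u)"

definition cont_map ::
    "'v::real_vector nspace \<Rightarrow> 'w::real_vector nspace \<Rightarrow> 'v set \<Rightarrow> ('v \<Rightarrow> 'w) \<Rightarrow> bool" where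
  "cont_map E F U f \<longleftrightarrow>
     f ` U \<subseteq> carr F \<and>
     (\<forall>x\<in>U. \<forall>e>0. \<exists>d>0. \<forall>y\<in>U. nrm E (y - x) < d \<longrightarrow> nrm F (f y - f x) < e)"

text \<open>
  \<open>multilin E F i\<close> is \<open>L(E\<^sup>i; F)\<close> with its operator norm. An \<open>i\<close>-linear map takes the list of its
  \<open>i\<close> arguments and is made unique by being \<open>0\<close> on all other lists.
\<close>

definition args :: "'v nspace \<Rightarrow> nat \<Rightarrow> 'v list set" where
  "args E i = {vs. length vs = i \<and> set vs \<subseteq> carr E}"

definition multilin ::
    "'v::real_vector nspace \<Rightarrow> 'w::real_vector nspace \<Rightarrow> nat \<Rightarrow> ('v list \<Rightarrow> 'w) nspace" where
  "multilin E F i =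
     \<lparr>carr = {A. (\<forall>vs. vs \<notin> args E i \<longrightarrow> A vs = 0) \<and>
                 A ` args E i \<subseteq> carr F \<and>
                 (\<forall>vs\<in>args E i. \<forall>j<i. \<forall>u\<in>carr E. \<forall>w\<in>carr E. \<forall>c.
                    A (vs[j := c *\<^sub>R u + w]) = c *\<^sub>R A (vs[j := u]) + A (vs[j := w])) \<and>
                 (\<exists>C. \<forall>vs\<in>args E i. nrm F (A vs) \<le> C * prod_list (map (nrm E) vs))},
      nrm = (\<lambda>A. SUP vs\<in>{vs \<in> args E i. \<forall>v\<in>set vs. nrm E v \<le> 1}. nrm F (A vs))\<rparr>"

text \<open>
  The derivative \<open>f\<^sup>(\<^sup>i\<^sup>+\<^sup>1\<^sup>)\<close> is the derivative of \<open>f\<^sup>(\<^sup>i\<^sup>) : U \<rightarrow> L(E\<^sup>i; F)\<close>, read through the isometry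
  \<open>L(E; L(E\<^sup>i; F)) = L(E\<^sup>i\<^sup>+\<^sup>1; F)\<close>.
\<close>

primrec nth_fderiv ::
    "'v::real_vector nspace \<Rightarrow> 'w::real_vector nspace \<Rightarrow> 'v set \<Rightarrow> ('v \<Rightarrow> 'w) \<Rightarrow> nat \<Rightarrow> 'v \<Rightarrow> 'v list \<Rightarrow> 'w"
  where
  "nth_fderiv E F U f 0 = (\<lambda>x vs. if vs = [] then f x else 0)"
| "nth_fderiv E F U f (Suc i) =
     (\<lambda>x vs. case vs of
        [] \<Rightarrow> 0
      | h # ws \<Rightarrow> if h \<in> carr E then fderiv E (multilin E F i) U (nth_fderiv E F U f i) x h ws else 0)"

definition C_map ::
    "'v::real_vector nspace \<Rightarrow> 'w::real_vector nspace \<Rightarrow> 'v set \<Rightarrow> nat \<Rightarrow> ('v \<Rightarrow> 'w) \<Rightarrow> bool" where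
  "C_map E F U n f \<longleftrightarrow>
     (\<forall>i<n. \<forall>x\<in>U. fdifferentiable E (multilin E F i) U (nth_fderiv E F U f i) x) \<and>
     (\<forall>i\<le>n. cont_map E (multilin E F i) U (nth_fderiv E F U f i))"

definition smooth_map ::
    "'v::real_vector nspace \<Rightarrow> 'w::real_vector nspace \<Rightarrow> 'v set \<Rightarrow> ('v \<Rightarrow> 'w) \<Rightarrow> bool" where
  "smooth_map E F U f \<longleftrightarrow> (\<forall>n. C_map E F U n f)"

lemma has_fderiv_type_space_iff:
  assumes "open U" "x \<in> U"
  shows "has_fderiv type_space type_space U f L x \<longleftrightarrow> (f has_derivative L) (at x)"
proof -
  have bl: "bounded_linear_map type_space type_space L \<longleftrightarrow> bounded_linear L"
    by (auto simp: bounded_linear_map_def type_space_def bounded_linear_def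
        bounded_linear_axioms_def linear_iff mult.commute)
  show ?thesis
    using assms unfolding has_fderiv_def bl at_within_open[OF assms(2,1), symmetric]
      has_derivative_within_alt
    by (auto simp: type_space_def)
qed


section \<open>The space of bounded functions with bounded continuous derivatives\<close>

text \<open>
  A function \<open>a : B \<rightarrow> \<real>\<close> is represented by its extension by \<open>0\<close> to the whole type.
\<close>

abbreviation deriv_on :: "'a::real_normed_vector set \<Rightarrow> ('a \<Rightarrow> real) \<Rightarrow> nat \<Rightarrow> 'a \<Rightarrow> 'a list \<Rightarrow> real" where
  "deriv_on B \<equiv> nth_fderiv type_space type_space B"

abbreviation op_norm :: "nat \<Rightarrow> ('a::real_normed_vector list \<Rightarrow> real) \<Rightarrow> real" where
  "op_norm i \<equiv> nrm (multilin type_space type_space i)"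

definition Cb :: "nat \<Rightarrow> 'a::real_normed_vector set \<Rightarrow> ('a \<Rightarrow> real) nspace" where
  "Cb k B =
     \<lparr>carr = {a. (\<forall>x. x \<notin> B \<longrightarrow> a x = 0) \<and>
                 C_map type_space type_space B k a \<and>
                 bdd_above ((\<lambda>x. \<bar>a x\<bar>) ` B) \<and>
                 (\<forall>i\<in>{1..k}. bdd_above ((\<lambda>x. op_norm i (deriv_on B a i x)) ` B))},
      nrm = (\<lambda>a. (SUP x\<in>B. \<bar>a x\<bar>) + (\<Sum>i=1..k. SUP x\<in>B. op_norm i (deriv_on B a i x)))\<rparr>"

definition Cb0 :: "nat \<Rightarrow> 'a::real_normed_vector set \<Rightarrow> 'a measure \<Rightarrow> ('a \<Rightarrow> real) nspace" where
  "Cb0 k B \<mu> = \<lparr>carr = {a \<in> carr (Cb k B). integral\<^sup>L \<mu> a = 0}, nrm = nrm (Cb k B)\<rparr>"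

definition exp_G :: "'a set \<Rightarrow> ('a \<Rightarrow> real) \<Rightarrow> 'a \<Rightarrow> real" where
  "exp_G B a = (\<lambda>x. if x \<in> B then exp (a x) else 0)"

definition const_G :: "'a set \<Rightarrow> real \<Rightarrow> 'a \<Rightarrow> real" where
  "const_G B c = (\<lambda>x. if x \<in> B then c else 0)"


section \<open>The manifold of finite measures\<close>

definition manM :: "'a::real_normed_vector set \<Rightarrow> nat \<Rightarrow> 'a measure \<Rightarrow> 'a measure set" where
  "manM B k \<mu> = {P. sets P = sets \<mu> \<and> finite_measure P \<and>
     absolutely_continuous \<mu> P \<and> absolutely_continuous P \<mu> \<and>
     (\<exists>a\<in>carr (Cb k B). P = density \<mu> (\<lambda>x. ennreal (exp_G B a x)))}"

text \<open>
  \<open>phi1 B k \<mu> P\<close> is \<open>log (dP/d\<mu>)\<close>, taking for \<open>dP/d\<mu>\<close> its continuous version, which is unique because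
  \<open>\<mu>\<close> charges all non-empty open sets; \<^const>\<open>RN_deriv\<close> is an arbitrary version. The same
  applies to \<open>sdens\<close> below.
\<close>

definition phi1 :: "'a::real_normed_vector set \<Rightarrow> nat \<Rightarrow> 'a measure \<Rightarrow> 'a measure \<Rightarrow> 'a \<Rightarrow> real" where
  "phi1 B k \<mu> P = (THE a. a \<in> carr (Cb k B) \<and> P = density \<mu> (\<lambda>x. ennreal (exp_G B a x)))"

definition phi :: "'a::real_normed_vector set \<Rightarrow> nat \<Rightarrow> 'a measure \<Rightarrow> real \<Rightarrow> 'a measure \<Rightarrow> 'a \<Rightarrow> real" where
  "phi B k \<mu> \<alpha> P =
     (if \<alpha> = 1 then phi1 B k \<mu> P
      else (2 / (1 - \<alpha>)) *\<^sub>R (exp_G B (((1 - \<alpha>) / 2) *\<^sub>R phi1 B k \<mu> P) - const_G B 1))"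

text \<open>Signed measures are set functions, with the value \<open>0\<close> on non-measurable sets.\<close>

type_synonym 'a smeasure = "'a set \<Rightarrow> real"

definition sdensity :: "'a measure \<Rightarrow> ('a \<Rightarrow> real) \<Rightarrow> 'a smeasure" where
  "sdensity P u = (\<lambda>A. if A \<in> sets P then set_lebesgue_integral P A u else 0)"

definition sdens :: "'a::real_normed_vector set \<Rightarrow> nat \<Rightarrow> 'a measure \<Rightarrow> 'a smeasure \<Rightarrow> 'a \<Rightarrow> real" where
  "sdens B k P U = (THE u. u \<in> carr (Cb k B) \<and> U = sdensity P u)"

definition TM :: "'a::real_normed_vector set \<Rightarrow> nat \<Rightarrow> 'a measure \<Rightarrow> 'a smeasure set" where
  "TM B k P = sdensity P ` carr (Cb k B)"

text \<open>
  \<open>applyM B k \<mu> F P U f\<close> is \<open>U f\<close> for \<open>U \<in> T\<^sub>P M\<close> and \<open>f : M \<rightarrow> F\<close>.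
\<close>

definition applyM :: "'a::real_normed_vector set \<Rightarrow> nat \<Rightarrow> 'a measure \<Rightarrow> 'w::real_vector nspace \<Rightarrow>
    'a measure \<Rightarrow> 'a smeasure \<Rightarrow> ('a measure \<Rightarrow> 'w) \<Rightarrow> 'w" where
  "applyM B k \<mu> F P U f =
     fderiv (Cb k B) F (carr (Cb k B)) (f \<circ> the_inv_into (manM B k \<mu>) (phi1 B k \<mu>))
       (phi1 B k \<mu> P) (sdens B k P U)"


section \<open>The submanifold of probability measures\<close>

definition manN :: "'a::real_normed_vector set \<Rightarrow> nat \<Rightarrow> 'a measure \<Rightarrow> 'a measure set" where
  "manN B k \<mu> = {P \<in> manM B k \<mu>. measure P B = 1}"

definition phie :: "'a::real_normed_vector set \<Rightarrow> nat \<Rightarrow> 'a measure \<Rightarrow> 'a measure \<Rightarrow> 'a \<Rightarrow> real" where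
  "phie B k \<mu> P = phi1 B k \<mu> P - const_G B (integral\<^sup>L \<mu> (phi1 B k \<mu> P))"

abbreviation phie_inv :: "'a::real_normed_vector set \<Rightarrow> nat \<Rightarrow> 'a measure \<Rightarrow> ('a \<Rightarrow> real) \<Rightarrow> 'a measure" where
  "phie_inv B k \<mu> \<equiv> the_inv_into (manN B k \<mu>) (phie B k \<mu>)"

definition TN :: "'a::real_normed_vector set \<Rightarrow> nat \<Rightarrow> 'a measure \<Rightarrow> 'a smeasure set" where
  "TN B k P = {U \<in> TM B k P. U B = 0}"

text \<open>The coordinate in \<open>Cb0 k B \<mu>\<close> of \<open>U \<in> T\<^sub>P N\<close> in the chart \<open>\<phi>\<^sub>e\<close>.\<close>

definition coordN :: "'a::real_normed_vector set \<Rightarrow> nat \<Rightarrow> 'a measure \<Rightarrow> 'a measure \<Rightarrow> 'a smeasure \<Rightarrow> 'a \<Rightarrow> real" where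
  "coordN B k \<mu> P U = sdens B k P U - const_G B (integral\<^sup>L \<mu> (sdens B k P U))"

text \<open>
  \<open>applyN B k \<mu> F P U f\<close> is \<open>U f\<close> for \<open>U \<in> T\<^sub>P N\<close> and \<open>f : N \<rightarrow> F\<close>, and \<open>vf_apply B k \<mu> F V f\<close> is the map
  \<open>V f\<close> on \<open>N\<close> for a vector field \<open>V\<close>.
\<close>

definition applyN :: "'a::real_normed_vector set \<Rightarrow> nat \<Rightarrow> 'a measure \<Rightarrow> 'w::real_vector nspace \<Rightarrow>
    'a measure \<Rightarrow> 'a smeasure \<Rightarrow> ('a measure \<Rightarrow> 'w) \<Rightarrow> 'w" where
  "applyN B k \<mu> F P U f =
     fderiv (Cb0 k B \<mu>) F (carr (Cb0 k B \<mu>)) (f \<circ> phie_inv B k \<mu>)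
       (phie B k \<mu> P) (coordN B k \<mu> P U)"

definition vf_apply :: "'a::real_normed_vector set \<Rightarrow> nat \<Rightarrow> 'a measure \<Rightarrow> 'w::real_vector nspace \<Rightarrow>
    ('a measure \<Rightarrow> 'a smeasure) \<Rightarrow> ('a measure \<Rightarrow> 'w) \<Rightarrow> 'a measure \<Rightarrow> 'w" where
  "vf_apply B k \<mu> F V f = (\<lambda>P. applyN B k \<mu> F P (V P) f)"

text \<open>Smoothness of a section of \<open>TN\<close> is read in the global chart induced by \<open>\<phi>\<^sub>e\<close>.\<close>

definition smooth_vf :: "'a::real_normed_vector set \<Rightarrow> nat \<Rightarrow> 'a measure \<Rightarrow> ('a measure \<Rightarrow> 'a smeasure) \<Rightarrow> bool" where
  "smooth_vf B k \<mu> V \<longleftrightarrow>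
     (\<forall>P\<in>manN B k \<mu>. V P \<in> TN B k P) \<and>
     smooth_map (Cb0 k B \<mu>) (Cb0 k B \<mu>) (carr (Cb0 k B \<mu>))
       (\<lambda>b. coordN B k \<mu> (phie_inv B k \<mu> b) (V (phie_inv B k \<mu> b)))"

definition normalise :: "'a set \<Rightarrow> 'a measure \<Rightarrow> 'a measure" where
  "normalise B P = scale_measure (1 / emeasure P B) P"

definition T_normalise :: "'a::real_normed_vector set \<Rightarrow> nat \<Rightarrow> 'a measure \<Rightarrow> 'a measure \<Rightarrow> 'a smeasure \<Rightarrow> 'a smeasure" where
  "T_normalise B k \<mu> P X =
     (THE Y. Y \<in> TN B k (normalise B P) \<and>
        applyN B k \<mu> (Cb0 k B \<mu>) (normalise B P) Y (phie B k \<mu>) =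
        applyM B k \<mu> (Cb0 k B \<mu>) P X (phie B k \<mu> \<circ> normalise B))"

text \<open>
  The inclusion of \<open>N\<close> in \<open>M\<close> is the identity on measures, so \<open>\<phi>\<^sub>\<alpha> \<circ> \<iota>\<close> is written \<open>phi B k \<mu> \<alpha>\<close>.
\<close>

definition cov_deriv :: "'a::real_normed_vector set \<Rightarrow> nat \<Rightarrow> 'a measure \<Rightarrow> real \<Rightarrow>
    ('a measure \<Rightarrow> 'a smeasure) \<Rightarrow> ('a measure \<Rightarrow> 'a smeasure) \<Rightarrow> 'a measure \<Rightarrow> 'a smeasure" where
  "cov_deriv B k \<mu> \<alpha> U V = (\<lambda>P. T_normalise B k \<mu> P
     (THE W. W \<in> TM B k P \<and>
        applyM B k \<mu> (Cb k B) P W (phi B k \<mu> \<alpha>) =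
        vf_apply B k \<mu> (Cb k B) U (vf_apply B k \<mu> (Cb k B) V (phi B k \<mu> \<alpha>)) P))"

end

theory Submission
  imports Defs
begin

text \<open>
  Write \<open>\<beta> = (1 - \<alpha>) / 2\<close>. Expressed through the exponent \<open>a\<close> of the density, the derivative of the
  chart \<open>\<phi>\<^sub>\<alpha>\<close> at \<open>a\<close> is \<open>u \<mapsto> exp (\<beta> a) u\<close>, for every \<open>\<alpha>\<close>. A probability measure whose coordinate in
  the chart \<open>\<phi>\<^sub>e\<close> is \<open>b\<close> has the exponent \<open>a = b - log \<^bold>E\<^sub>\<mu> exp b\<close>, and the derivative of \<open>b \<mapsto> a\<close> is
  \<open>u \<mapsto> u - \<^bold>E\<^sub>P u\<close>. Hence, if \<open>v\<close> is the vector field \<open>V\<close> in the chart \<open>\<phi>\<^sub>e\<close>,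
  \<open>V \<phi>\<^sub>\<alpha> = exp (\<beta> a) (v - \<^bold>E\<^sub>P v)\<close>. Differentiating once more in the direction \<open>u\<close> of \<open>U\<close> gives
  \<open>exp (\<beta> a) (\<beta> (u - \<^bold>E\<^sub>P u) (v - \<^bold>E\<^sub>P v) + v' u - c)\<close> with a constant \<open>c\<close> that comes from the
  mean of \<open>v\<close>. So the tangent vector \<open>W\<close> of \<open>M\<close> with the same image under the derivative of \<open>\<phi>\<^sub>\<alpha>\<close> has
  the density in parentheses, and projecting to \<open>N\<close> subtracts its mean under \<open>\<mu>\<close>. This removes \<open>c\<close>
  and leaves \<open>v' u = U V \<phi>\<^sub>e\<close>, whose mean is zero, as it is; the claim follows. The computation is
  carried out in \<open>has_fderiv_first_derivative\<close>, \<open>T_normalise_sdensity\<close> and \<open>cov_deriv_phie\<close>.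

  The analysis behind it is that \<open>C\<^sub>b\<^sup>k(B)\<close> is a normed algebra on which the pointwise exponential is
  Frechet differentiable with derivative \<open>u \<mapsto> exp a \<cdot> u\<close> (\<open>has_fderiv_exp_G\<close>). By
  \<open>exp (a + h) - exp a - exp a \<cdot> h = exp a \<cdot> (exp h - 1 - h)\<close> this reduces to a quadratic estimate of
  \<open>exp h - 1 - h\<close> in the norm of \<open>C\<^sub>b\<^sup>k(B)\<close>. All derivatives up to order \<open>k\<close> are treated at once as a
  jet, a function on lists of directions. On jets the Leibniz rule is the recursion
  \<open>D\<^sub>v (f g) = D\<^sub>v f g + f D\<^sub>v g\<close> on lists, and the exponential is the recursion
  \<open>D\<^sub>v (exp f) = exp f D\<^sub>v f\<close>; the estimates follow by induction along these recursions, without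
  explicit formulas for higher derivatives. The lemmas \<open>nth_fderiv_eq_level\<close> and \<open>is_jet_jet\<close> connect
  jets to iterated Frechet derivatives.
\<close>

section \<open>Differential calculus in normed spaces with an explicit carrier\<close>

locale normed_nspace =
  fixes E :: "'v::real_vector nspace"
  assumes zero_mem: "0 \<in> carr E"
    and add_mem: "u \<in> carr E \<Longrightarrow> v \<in> carr E \<Longrightarrow> u + v \<in> carr E"
    and scale_mem: "u \<in> carr E \<Longrightarrow> c *\<^sub>R u \<in> carr E"
    and nrm_triangle: "u \<in> carr E \<Longrightarrow> v \<in> carr E \<Longrightarrow> nrm E (u + v) \<le> nrm E u + nrm E v"
    and nrm_scale: "u \<in> carr E \<Longrightarrow> nrm E (c *\<^sub>R u) = \<bar>c\<bar> * nrm E u"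
    and nrm_eq_0D: "u \<in> carr E \<Longrightarrow> nrm E u = 0 \<Longrightarrow> u = 0"
begin

lemma minus_mem: "u \<in> carr E \<Longrightarrow> - u \<in> carr E"
  using scale_mem[of u "-1"] by simp

lemma diff_mem: "u \<in> carr E \<Longrightarrow> v \<in> carr E \<Longrightarrow> u - v \<in> carr E"
  using add_mem[of u "- v"] minus_mem by simp

lemma nrm_zero: "nrm E 0 = 0"
  using nrm_scale[of 0 0] zero_mem by simp

lemma nrm_minus: "u \<in> carr E \<Longrightarrow> nrm E (- u) = nrm E u"
  using nrm_scale[of u "-1"] by simp

lemma nrm_nonneg: "u \<in> carr E \<Longrightarrow> 0 \<le> nrm E u"
  using nrm_triangle[of u "- u"] nrm_minus[of u] minus_mem[of u] nrm_zero by simp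

lemma nrm_diff_le: "u \<in> carr E \<Longrightarrow> v \<in> carr E \<Longrightarrow> nrm E (u - v) \<le> nrm E u + nrm E v"
  using nrm_triangle[of u "- v"] minus_mem[of v] nrm_minus[of v] by simp

lemmas mem = zero_mem add_mem scale_mem minus_mem diff_mem

lemma bounded_linear_map_id: "bounded_linear_map E E (\<lambda>u. u)"
  unfolding bounded_linear_map_def by (auto intro: exI[of _ 1])

end

lemma normed_nspace_type_space: "normed_nspace (type_space :: 'a::real_normed_vector nspace)"
  by unfold_locales (auto simp: type_space_def norm_triangle_ineq)

lemma bounded_linear_mapI:
  assumes "\<And>u. u \<in> carr E \<Longrightarrow> L u \<in> carr F"
    and "\<And>u v. u \<in> carr E \<Longrightarrow> v \<in> carr E \<Longrightarrow> L (u + v) = L u + L v"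
    and "\<And>c u. u \<in> carr E \<Longrightarrow> L (c *\<^sub>R u) = c *\<^sub>R L u"
    and "\<And>u. u \<in> carr E \<Longrightarrow> nrm F (L u) \<le> C * nrm E u"
  shows "bounded_linear_map E F L"
  using assms unfolding bounded_linear_map_def by blast

lemma bounded_linear_mapD:
  assumes "bounded_linear_map E F L"
  shows "\<And>u. u \<in> carr E \<Longrightarrow> L u \<in> carr F"
    and "\<And>u v. u \<in> carr E \<Longrightarrow> v \<in> carr E \<Longrightarrow> L (u + v) = L u + L v"
    and "\<And>c u. u \<in> carr E \<Longrightarrow> L (c *\<^sub>R u) = c *\<^sub>R L u"
  using assms unfolding bounded_linear_map_def by blast+

text \<open>
  A bound of a linear map may be taken positive, which permits to divide by it.
\<close>

lemma bounded_linear_map_bound: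
  assumes "normed_nspace E" "bounded_linear_map E F L"
  obtains C where "C > 0" "\<And>u. u \<in> carr E \<Longrightarrow> nrm F (L u) \<le> C * nrm E u"
proof -
  obtain C where C: "\<And>u. u \<in> carr E \<Longrightarrow> nrm F (L u) \<le> C * nrm E u"
    using assms(2) unfolding bounded_linear_map_def by blast
  have "nrm F (L u) \<le> max C 1 * nrm E u" if "u \<in> carr E" for u
    using C[OF that] mult_right_mono[of C "max C 1" "nrm E u"]
      normed_nspace.nrm_nonneg[OF assms(1) that] by simp
  then show ?thesis by (intro that[of "max C 1"]) auto
qed

lemma bounded_linear_map_diff:
  assumes "normed_nspace E" "bounded_linear_map E F L" "u \<in> carr E" "v \<in> carr E"
  shows "L (u - v) = L u - L v"
proof -
  interpret normed_nspace E by fact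
  have "L (u - v) = L (u + (-1) *\<^sub>R v)" by simp
  also have "\<dots> = L u + L ((-1) *\<^sub>R v)"
    by (intro bounded_linear_mapD(2)[OF assms(2)] assms mem)
  also have "L ((-1) *\<^sub>R v) = (-1) *\<^sub>R L v"
    by (intro bounded_linear_mapD(3)[OF assms(2)] assms)
  finally show ?thesis by simp
qed

lemma bounded_linear_map_compose:
  assumes "normed_nspace E" "normed_nspace F" "bounded_linear_map E F L" "bounded_linear_map F G M"
  shows "bounded_linear_map E G (\<lambda>u. M (L u))"
proof -
  obtain C where C: "C > 0" "\<And>u. u \<in> carr E \<Longrightarrow> nrm F (L u) \<le> C * nrm E u"
    using bounded_linear_map_bound[OF assms(1,3)] by blast
  obtain D where D: "D > 0" "\<And>u. u \<in> carr F \<Longrightarrow> nrm G (M u) \<le> D * nrm F u"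
    using bounded_linear_map_bound[OF assms(2,4)] by blast
  note L = bounded_linear_mapD[OF assms(3)] and M = bounded_linear_mapD[OF assms(4)]
  show ?thesis
  proof (rule bounded_linear_mapI[where C = "D * C"])
    fix u assume u: "u \<in> carr E"
    show "nrm G (M (L u)) \<le> D * C * nrm E u"
      using D(2)[OF L(1)[OF u]] mult_left_mono[OF C(2)[OF u], of D] D(1)
      unfolding mult.assoc by (meson less_imp_le order_trans)
  qed (auto simp: L M)
qed

lemma bounded_linear_map_add:
  assumes "normed_nspace E" "normed_nspace F" "bounded_linear_map E F L" "bounded_linear_map E F M"
  shows "bounded_linear_map E F (\<lambda>u. L u + M u)"
proof -
  interpret F: normed_nspace F by fact
  obtain C where C: "C > 0" "\<And>u. u \<in> carr E \<Longrightarrow> nrm F (L u) \<le> C * nrm E u"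
    using bounded_linear_map_bound[OF assms(1,3)] by blast
  obtain D where D: "D > 0" "\<And>u. u \<in> carr E \<Longrightarrow> nrm F (M u) \<le> D * nrm E u"
    using bounded_linear_map_bound[OF assms(1,4)] by blast
  note L = bounded_linear_mapD[OF assms(3)] and M = bounded_linear_mapD[OF assms(4)]
  show ?thesis
  proof (rule bounded_linear_mapI[where C = "C + D"])
    fix u assume u: "u \<in> carr E"
    show "nrm F (L u + M u) \<le> (C + D) * nrm E u"
      using F.nrm_triangle[OF L(1)[OF u] M(1)[OF u]] C(2)[OF u] D(2)[OF u]
      by (simp add: algebra_simps)
  qed (auto simp: L M F.mem scaleR_add_right)
qed

lemma bounded_linear_map_scale:
  assumes "normed_nspace E" "normed_nspace F" "bounded_linear_map E F L"
  shows "bounded_linear_map E F (\<lambda>u. c *\<^sub>R L u)"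
proof -
  interpret F: normed_nspace F by fact
  obtain C where C: "C > 0" "\<And>u. u \<in> carr E \<Longrightarrow> nrm F (L u) \<le> C * nrm E u"
    using bounded_linear_map_bound[OF assms(1,3)] by blast
  note L = bounded_linear_mapD[OF assms(3)]
  show ?thesis
  proof (rule bounded_linear_mapI[where C = "\<bar>c\<bar> * C"])
    fix u assume u: "u \<in> carr E"
    show "nrm F (c *\<^sub>R L u) \<le> \<bar>c\<bar> * C * nrm E u"
      using F.nrm_scale[OF L(1)[OF u]] mult_left_mono[OF C(2)[OF u], of "\<bar>c\<bar>"]
      by (simp add: mult.assoc)
  qed (auto simp: L F.mem scaleR_add_right)
qed

lemma has_fderivD:
  assumes "has_fderiv E F U f L x"
  shows "x \<in> U" "f ` U \<subseteq> carr F" "bounded_linear_map E F L"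
    and "e > 0 \<Longrightarrow> \<exists>d>0. \<forall>y\<in>U. nrm E (y - x) < d \<longrightarrow>
        nrm F (f y - f x - L (y - x)) \<le> e * nrm E (y - x)"
  using assms unfolding has_fderiv_def by blast+

lemma has_fderiv_cong:
  assumes "has_fderiv E F U f L x" "\<And>y. y \<in> U \<Longrightarrow> f y = g y"
  shows "has_fderiv E F U g L x"
proof -
  have "x \<in> U" and im: "f ` U \<subseteq> carr F" using assms(1) unfolding has_fderiv_def by auto
  have "g ` U = f ` U" using assms(2) by (intro image_cong) auto
  then show ?thesis using assms \<open>x \<in> U\<close> unfolding has_fderiv_def by simp
qed

lemma fderiv_cong:
  assumes "\<And>y. y \<in> U \<Longrightarrow> f y = g y"
  shows "fderiv E F U f x u = fderiv E F U g x u"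
proof -
  have "has_fderiv E F U f L x = has_fderiv E F U g L x" for L
    using assms by (metis has_fderiv_cong)
  then show ?thesis unfolding fderiv_def by simp
qed

text \<open>
  Only the radial behaviour of the domain at the point matters: two derivatives agree in a
  direction along which the domain contains a whole segment.
\<close>

lemma has_fderiv_unique:
  assumes "normed_nspace E" "normed_nspace F"
    and L: "has_fderiv E F U f L x" and M: "has_fderiv E F U f M x"
    and u: "u \<in> carr E" and t0: "t0 > 0" and seg: "\<And>t. 0 < t \<Longrightarrow> t < t0 \<Longrightarrow> x + t *\<^sub>R u \<in> U"
  shows "L u = M u"
proof -
  interpret E: normed_nspace E by fact
  interpret F: normed_nspace F by fact
  note LD = has_fderivD[OF L] and MD = has_fderivD[OF M]
  note Ll = bounded_linear_mapD[OF LD(3)] and Ml = bounded_linear_mapD[OF MD(3)]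
  have mem: "L u - M u \<in> carr F" using Ll(1)[OF u] Ml(1)[OF u] by (rule F.diff_mem)
  have small: "nrm F (L u - M u) \<le> 2 * e * nrm E u" if e: "e > 0" for e
  proof -
    obtain d1 where d1: "d1 > 0" "\<And>y. y \<in> U \<Longrightarrow> nrm E (y - x) < d1 \<Longrightarrow>
        nrm F (f y - f x - L (y - x)) \<le> e * nrm E (y - x)" using LD(4)[OF e] by blast
    obtain d2 where d2: "d2 > 0" "\<And>y. y \<in> U \<Longrightarrow> nrm E (y - x) < d2 \<Longrightarrow>
        nrm F (f y - f x - M (y - x)) \<le> e * nrm E (y - x)" using MD(4)[OF e] by blast
    define n where "n = nrm E u"
    have n: "n \<ge> 0" using E.nrm_nonneg[OF u] n_def by simp
    \<comment> \<open>The step stays in the segment and within both radii; dividing by \<open>n + 1\<close> covers \<open>n = 0\<close>.\<close>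
    define t where "t = min (t0 / 2) (min d1 d2 / (2 * (n + 1)))"
    have t: "t > 0" using t0 d1(1) d2(1) n by (simp add: t_def)
    have "t \<le> t0 / 2" unfolding t_def by (rule min.cobounded1)
    with t0 have "t < t0" by linarith
    note t = t this
    have "t * n < t * (n + 1)" using t by simp
    also have "\<dots> \<le> min d1 d2 / (2 * (n + 1)) * (n + 1)"
      by (intro mult_right_mono) (use n in \<open>auto simp: t_def\<close>)
    also have "\<dots> = min d1 d2 / 2" using n by (simp add: field_simps)
    also have "\<dots> < min d1 d2" using d1(1) d2(1) by (simp add: min_def)
    finally have tn: "t * n < min d1 d2" .
    let ?y = "x + t *\<^sub>R u"
    have yU: "?y \<in> U" using seg t by simp
    have ny: "nrm E (?y - x) = t * n" using E.nrm_scale[OF u, of t] t n_def by simp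
    have A: "nrm F (f ?y - f x - t *\<^sub>R L u) \<le> e * (t * n)"
      using d1(2)[OF yU] ny tn Ll(3)[OF u, of t] by simp
    have B: "nrm F (f ?y - f x - t *\<^sub>R M u) \<le> e * (t * n)"
      using d2(2)[OF yU] ny tn Ml(3)[OF u, of t] by simp
    have fy: "f ?y - f x \<in> carr F" using LD(1,2) yU by (intro F.diff_mem) auto
    have "t * nrm F (L u - M u) = nrm F (t *\<^sub>R (L u - M u))" using F.nrm_scale[OF mem, of t] t by simp
    also have "t *\<^sub>R (L u - M u) = (f ?y - f x - t *\<^sub>R M u) - (f ?y - f x - t *\<^sub>R L u)"
      by (simp add: scaleR_diff_right)
    also have "nrm F \<dots> \<le> e * (t * n) + e * (t * n)"
      by (rule order_trans[OF F.nrm_diff_le add_mono[OF B A]])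
        (intro F.mem fy Ll(1)[OF u] Ml(1)[OF u])+
    finally have "t * nrm F (L u - M u) \<le> t * (2 * e * n)" by (simp add: algebra_simps)
    then show ?thesis using t n_def by simp
  qed
  have "nrm F (L u - M u) \<le> 0"
  proof (rule field_le_epsilon)
    fix e :: real assume e: "e > 0"
    define n where "n = nrm E u"
    have n: "n \<ge> 0" using E.nrm_nonneg[OF u] n_def by simp
    have "nrm F (L u - M u) \<le> 2 * (e / (2 * (n + 1))) * n"
      using small[of "e / (2 * (n + 1))"] e n n_def by simp
    also have "\<dots> \<le> e" using e n by (simp add: field_simps)
    finally show "nrm F (L u - M u) \<le> 0 + e" by simp
  qed
  then show ?thesis using F.nrm_eq_0D[OF mem] F.nrm_nonneg[OF mem] by simp
qed

lemma fderiv_eq: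
  assumes "normed_nspace E" "normed_nspace F" "has_fderiv E F U f L x" "u \<in> carr E"
    and "t0 > 0" "\<And>t. 0 < t \<Longrightarrow> t < t0 \<Longrightarrow> x + t *\<^sub>R u \<in> U"
  shows "fderiv E F U f x u = L u"
  unfolding fderiv_def
  using has_fderiv_unique[OF assms(1,2) _ assms(3,4,5,6)] assms(3) by (intro the_equality) blast+

lemma fderiv_eq_carr:
  assumes "normed_nspace E" "normed_nspace F" "has_fderiv E F (carr E) f L x" "u \<in> carr E"
  shows "fderiv E F (carr E) f x u = L u"
proof -
  interpret E: normed_nspace E by fact
  have "x \<in> carr E" by (rule has_fderivD(1)[OF assms(3)])
  then show ?thesis by (intro fderiv_eq[OF assms zero_less_one] E.mem assms(4))
qed

lemma has_fderiv_lipschitz: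
  assumes "normed_nspace E" "normed_nspace F" "U \<subseteq> carr E" "has_fderiv E F U f L x"
  shows "\<exists>C>0. \<exists>d>0. \<forall>y\<in>U. nrm E (y - x) < d \<longrightarrow> nrm F (f y - f x) \<le> C * nrm E (y - x)"
proof -
  interpret E: normed_nspace E by fact
  interpret F: normed_nspace F by fact
  note D = has_fderivD[OF assms(4)]
  obtain C where C: "C > 0" "\<And>u. u \<in> carr E \<Longrightarrow> nrm F (L u) \<le> C * nrm E u"
    using bounded_linear_map_bound[OF assms(1) D(3)] by blast
  obtain d where d: "d > 0" "\<And>y. y \<in> U \<Longrightarrow> nrm E (y - x) < d \<Longrightarrow>
        nrm F (f y - f x - L (y - x)) \<le> 1 * nrm E (y - x)" using D(4)[OF zero_less_one] by blast
  have "nrm F (f y - f x) \<le> (C + 1) * nrm E (y - x)" if y: "y \<in> U" "nrm E (y - x) < d" for y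
  proof -
    have yx: "y - x \<in> carr E" using D(1) y assms(3) by (auto intro: E.mem)
    note Lm = bounded_linear_mapD(1)[OF D(3) yx]
    have fm: "f y - f x \<in> carr F" using D(1,2) y by (intro F.mem) auto
    have "nrm F ((f y - f x - L (y - x)) + L (y - x)) \<le> 1 * nrm E (y - x) + C * nrm E (y - x)"
      using F.nrm_triangle[of "f y - f x - L (y - x)" "L (y - x)"] d(2)[OF y] C(2)[OF yx] fm Lm
      by (simp add: F.mem)
    then show ?thesis by (simp add: algebra_simps)
  qed
  then show ?thesis using C(1) d(1) by (intro exI[of _ "C + 1"] exI[of _ d]) auto
qed

lemma has_fderiv_bounded_linear_map:
  assumes "normed_nspace E" "normed_nspace F" "bounded_linear_map E F L" "U \<subseteq> carr E" "x \<in> U"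
  shows "has_fderiv E F U L L x"
proof -
  interpret E: normed_nspace E by fact
  interpret F: normed_nspace F by fact
  have "L y - L x - L (y - x) = 0" if "y \<in> U" for y
    using bounded_linear_map_diff[OF assms(1,3) subsetD[OF assms(4) that] subsetD[OF assms(4,5)]]
    by simp
  moreover have "0 \<le> e * nrm E (y - x)" if "y \<in> U" "e > 0" for y e
    using that E.nrm_nonneg[OF E.diff_mem[OF subsetD[OF assms(4) that(1)] subsetD[OF assms(4,5)]]]
    by simp
  ultimately show ?thesis
    using assms bounded_linear_mapD(1)[OF assms(3)]
    unfolding has_fderiv_def by (auto simp: F.nrm_zero intro: exI[of _ 1])
qed

lemma has_fderiv_const:
  assumes "normed_nspace E" "normed_nspace F" "c \<in> carr F" "U \<subseteq> carr E" "x \<in> U"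
  shows "has_fderiv E F U (\<lambda>_. c) (\<lambda>_. 0) x"
proof -
  interpret E: normed_nspace E by fact
  interpret F: normed_nspace F by fact
  have "0 \<le> e * nrm E (y - x)" if "y \<in> U" "e > 0" for y e
    using that E.nrm_nonneg[OF E.diff_mem[OF subsetD[OF assms(4) that(1)] subsetD[OF assms(4,5)]]]
    by simp
  moreover have "bounded_linear_map E F (\<lambda>_. 0)"
    by (rule bounded_linear_mapI[where C = 0]) (auto simp: F.mem F.nrm_zero)
  ultimately show ?thesis
    using assms unfolding has_fderiv_def by (auto simp: F.nrm_zero intro: exI[of _ 1])
qed

lemma has_fderiv_add:
  assumes "normed_nspace E" "normed_nspace F" "U \<subseteq> carr E"
    and f: "has_fderiv E F U f L x" and g: "has_fderiv E F U g M x"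
  shows "has_fderiv E F U (\<lambda>y. f y + g y) (\<lambda>u. L u + M u) x"
  unfolding has_fderiv_def
proof (intro conjI allI impI)
  interpret E: normed_nspace E by fact
  interpret F: normed_nspace F by fact
  note f = has_fderivD[OF f] and g = has_fderivD[OF g]
  show "x \<in> U" by (rule f(1))
  show "(\<lambda>y. f y + g y) ` U \<subseteq> carr F" using f(2) g(2) by (auto intro: F.mem)
  show "bounded_linear_map E F (\<lambda>u. L u + M u)" 
    by (rule bounded_linear_map_add[OF assms(1,2) f(3) g(3)])
  fix e :: real assume "e > 0"
  then have e: "e / 2 > 0" by simp
  obtain d1 where d1: "d1 > 0" "\<And>y. y \<in> U \<Longrightarrow> nrm E (y - x) < d1 \<Longrightarrow>
        nrm F (f y - f x - L (y - x)) \<le> e / 2 * nrm E (y - x)" using f(4)[OF e] by blast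
  obtain d2 where d2: "d2 > 0" "\<And>y. y \<in> U \<Longrightarrow> nrm E (y - x) < d2 \<Longrightarrow>
        nrm F (g y - g x - M (y - x)) \<le> e / 2 * nrm E (y - x)" using g(4)[OF e] by blast
  show "\<exists>d>0. \<forall>y\<in>U. nrm E (y - x) < d \<longrightarrow>
     nrm F (f y + g y - (f x + g x) - (L (y - x) + M (y - x))) \<le> e * nrm E (y - x)"
  proof (intro exI[of _ "min d1 d2"] conjI ballI impI)
    fix y assume y: "y \<in> U" "nrm E (y - x) < min d1 d2"
    have yx: "y - x \<in> carr E" using f(1) y assms(3) by (auto intro: E.mem)
    have m1: "f y - f x - L (y - x) \<in> carr F"
      using f(1,2) y bounded_linear_mapD(1)[OF f(3) yx] by (intro F.mem) auto
    have m2: "g y - g x - M (y - x) \<in> carr F"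
      using g(1,2) y bounded_linear_mapD(1)[OF g(3) yx] by (intro F.mem) auto
    have "f y + g y - (f x + g x) - (L (y - x) + M (y - x)) =
      (f y - f x - L (y - x)) + (g y - g x - M (y - x))" by (simp add: algebra_simps)
    then show "nrm F (f y + g y - (f x + g x) - (L (y - x) + M (y - x))) \<le> e * nrm E (y - x)"
      using F.nrm_triangle[OF m1 m2] d1(2)[OF y(1)] d2(2)[OF y(1)] y(2) by (simp add: field_simps)
  qed (use d1(1) d2(1) in auto)
qed

text \<open>
  The remainder of \<open>g \<circ> f\<close> is the remainder of \<open>g\<close> at the increment of \<open>f\<close>, which is Lipschitz in
  the increment of the argument, plus the image under \<open>M\<close> of the remainder of \<open>f\<close>.
\<close>

lemma has_fderiv_compose:
  assumes "normed_nspace E" "normed_nspace F" "normed_nspace G" "U \<subseteq> carr E" "W \<subseteq> carr F"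
    and f: "has_fderiv E F U f L x" and g: "has_fderiv F G W g M (f x)" and UW: "f ` U \<subseteq> W"
  shows "has_fderiv E G U (\<lambda>y. g (f y)) (\<lambda>u. M (L u)) x"
  unfolding has_fderiv_def
proof (intro conjI allI impI)
  interpret E: normed_nspace E by fact
  interpret F: normed_nspace F by fact
  interpret G: normed_nspace G by fact
  obtain C d0 where C: "C > 0" "d0 > 0"
    and CL: "\<forall>y\<in>U. nrm E (y - x) < d0 \<longrightarrow> nrm F (f y - f x) \<le> C * nrm E (y - x)"
    using has_fderiv_lipschitz[OF assms(1,2,4) f] by blast
  note f = has_fderivD[OF f] and g = has_fderivD[OF g]
  obtain K where K: "K > 0" "\<And>u. u \<in> carr F \<Longrightarrow> nrm G (M u) \<le> K * nrm F u"
    using bounded_linear_map_bound[OF assms(2) g(3)] by blast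
  show "x \<in> U" by (rule f(1))
  show "(\<lambda>y. g (f y)) ` U \<subseteq> carr G" using UW g(2) by (simp add: image_subset_iff)
  show "bounded_linear_map E G (\<lambda>u. M (L u))" 
    by (rule bounded_linear_map_compose[OF assms(1,2) f(3) g(3)])
  fix e :: real assume e: "e > 0"
  have e1: "e / (2 * K) > 0" and e2: "e / (2 * C) > 0" using e K C by auto
  obtain d1 where d1: "d1 > 0" "\<And>y. y \<in> U \<Longrightarrow> nrm E (y - x) < d1 \<Longrightarrow>
        nrm F (f y - f x - L (y - x)) \<le> e / (2 * K) * nrm E (y - x)" using f(4)[OF e1] by blast
  obtain d2 where d2: "d2 > 0" "\<And>z. z \<in> W \<Longrightarrow> nrm F (z - f x) < d2 \<Longrightarrow>
        nrm G (g z - g (f x) - M (z - f x)) \<le> e / (2 * C) * nrm F (z - f x)" using g(4)[OF e2] by blast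
  show "\<exists>d>0. \<forall>y\<in>U. nrm E (y - x) < d \<longrightarrow>
     nrm G (g (f y) - g (f x) - M (L (y - x))) \<le> e * nrm E (y - x)"
  proof (intro exI[of _ "min d0 (min d1 (d2 / C))"] conjI ballI impI)
    fix y assume y: "y \<in> U" "nrm E (y - x) < min d0 (min d1 (d2 / C))"
    let ?n = "nrm E (y - x)"
    have yx: "y - x \<in> carr E" using f(1) y assms(4) by (auto intro: E.mem)
    note Lm = bounded_linear_mapD(1)[OF f(3) yx]
    have fm: "f y - f x \<in> carr F" using f(1,2) y by (intro F.mem) auto
    have lip: "nrm F (f y - f x) \<le> C * ?n" using CL[rule_format, OF y(1)] y(2) by simp
    also have "\<dots> < d2" using y(2) C(1) by (simp add: field_simps)
    finally have "nrm G (g (f y) - g (f x) - M (f y - f x)) \<le> e / (2 * C) * nrm F (f y - f x)"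
      using d2(2)[of "f y"] UW y(1) by (simp add: image_subset_iff)
    also have "\<dots> \<le> e / (2 * C) * (C * ?n)" using lip e2 by (intro mult_left_mono) auto
    also have "\<dots> = e / 2 * ?n" using C by simp
    finally have A: "nrm G (g (f y) - g (f x) - M (f y - f x)) \<le> e / 2 * ?n" .
    have "nrm G (M (f y - f x - L (y - x))) \<le> K * nrm F (f y - f x - L (y - x))"
      by (intro K F.mem fm Lm)
    also have "\<dots> \<le> K * (e / (2 * K) * ?n)" using d1(2)[OF y(1)] y(2) K by (intro mult_left_mono) auto
    also have "\<dots> = e / 2 * ?n" using K by simp
    finally have B: "nrm G (M (f y - f x - L (y - x))) \<le> e / 2 * ?n" .
    have eq: "g (f y) - g (f x) - M (L (y - x)) =
       (g (f y) - g (f x) - M (f y - f x)) + M (f y - f x - L (y - x))"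
      using bounded_linear_map_diff[OF assms(2) g(3) fm Lm] by simp
    have m1: "g (f y) - g (f x) - M (f y - f x) \<in> carr G"
      using g(2) UW y(1) f(1) bounded_linear_mapD(1)[OF g(3) fm] by (intro G.mem) auto
    have m2: "M (f y - f x - L (y - x)) \<in> carr G"
      by (intro bounded_linear_mapD(1)[OF g(3)] F.mem fm Lm)
    show "nrm G (g (f y) - g (f x) - M (L (y - x))) \<le> e * ?n"
      unfolding eq using G.nrm_triangle[OF m1 m2] A B by (simp add: field_simps)
  qed (use C(1,2) d1(1) d2(1) in auto)
qed

lemma has_fderiv_linear_compose:
  assumes "normed_nspace E" "normed_nspace F" "normed_nspace G" "U \<subseteq> carr E"
    and f: "has_fderiv E F U f L x" and M: "bounded_linear_map F G M"
  shows "has_fderiv E G U (\<lambda>y. M (f y)) (\<lambda>u. M (L u)) x"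
  using has_fderivD(1,2)[OF f]
  by (intro has_fderiv_compose[OF assms(1-4) subset_refl f]
      has_fderiv_bounded_linear_map[OF assms(2,3) M]) auto

lemma has_fderiv_scale:
  assumes "normed_nspace E" "normed_nspace F" "U \<subseteq> carr E" "has_fderiv E F U f L x"
  shows "has_fderiv E F U (\<lambda>y. c *\<^sub>R f y) (\<lambda>u. c *\<^sub>R L u) x"
  using bounded_linear_map_scale[OF assms(2,2) normed_nspace.bounded_linear_map_id[OF assms(2)]]
  by (rule has_fderiv_linear_compose[OF assms(1,2,2,3,4)])

lemma has_fderiv_diff:
  assumes "normed_nspace E" "normed_nspace F" "U \<subseteq> carr E"
    and f: "has_fderiv E F U f L x" and g: "has_fderiv E F U g M x"
  shows "has_fderiv E F U (\<lambda>y. f y - g y) (\<lambda>u. L u - M u) x"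
  using has_fderiv_add[OF assms(1-4) has_fderiv_scale[OF assms(1-3) g, of "-1"]] by simp

text \<open>
  The Leibniz rule in a normed algebra of real functions: with \<open>\<Delta>f\<close> and \<open>\<Delta>g\<close> the increments,
  \<open>\<Delta>(f g) = \<Delta>f g + f \<Delta>g + \<Delta>f \<Delta>g\<close> and the last term is of second order.
\<close>

lemma has_fderiv_mult:
  fixes f g :: "'v::real_vector \<Rightarrow> 'b \<Rightarrow> real"
  assumes "normed_nspace E" "normed_nspace F" "U \<subseteq> carr E"
    and times_mem: "\<And>a b. a \<in> carr F \<Longrightarrow> b \<in> carr F \<Longrightarrow> a * b \<in> carr F"
    and times_le: "\<And>a b. a \<in> carr F \<Longrightarrow> b \<in> carr F \<Longrightarrow> nrm F (a * b) \<le> K * (nrm F a * nrm F b)"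
    and f: "has_fderiv E F U f L x" and g: "has_fderiv E F U g M x"
  shows "has_fderiv E F U (\<lambda>y. f y * g y) (\<lambda>u. L u * g x + f x * M u) x"
proof -
  interpret E: normed_nspace E by fact
  interpret F: normed_nspace F by fact
  obtain C d0 where C: "C > 0" "d0 > 0"
    and CL: "\<forall>y\<in>U. nrm E (y - x) < d0 \<longrightarrow> nrm F (f y - f x) \<le> C * nrm E (y - x)"
    using has_fderiv_lipschitz[OF assms(1,2,3) f] by blast
  obtain D d1 where D: "D > 0" "d1 > 0"
    and DL: "\<forall>y\<in>U. nrm E (y - x) < d1 \<longrightarrow> nrm F (g y - g x) \<le> D * nrm E (y - x)"
    using has_fderiv_lipschitz[OF assms(1,2,3) g] by blast
  note fD = has_fderivD[OF f] and gD = has_fderivD[OF g]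
  have fx: "f x \<in> carr F" and gx: "g x \<in> carr F" using fD gD by auto
  have lin: "bounded_linear_map F F (\<lambda>a. a * b)" if b: "b \<in> carr F" for b
    by (rule bounded_linear_mapI[where C = "K * nrm F b"])
      (use b times_mem times_le in \<open>auto simp: fun_eq_iff scaleR_fun_def algebra_simps\<close>)
  have one: "has_fderiv E F U (\<lambda>y. f y * g x) (\<lambda>u. L u * g x) x"
    by (rule has_fderiv_linear_compose[OF assms(1,2,2,3) f lin[OF gx]])
  have two: "has_fderiv E F U (\<lambda>y. g y * f x) (\<lambda>u. M u * f x) x"
    by (rule has_fderiv_linear_compose[OF assms(1,2,2,3) g lin[OF fx]])
  have three: "has_fderiv E F U (\<lambda>y. (f y - f x) * (g y - g x)) (\<lambda>_. 0) x"
    unfolding has_fderiv_def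
  proof (intro conjI allI impI)
    show "x \<in> U" by (rule fD(1))
    show "(\<lambda>y. (f y - f x) * (g y - g x)) ` U \<subseteq> carr F"
      using fD gD fx gx by (auto intro!: times_mem F.diff_mem)
    show "bounded_linear_map E F (\<lambda>_. 0)"
      by (rule bounded_linear_mapI[where C = 0]) (auto simp: F.mem F.nrm_zero)
    fix e :: real assume e: "e > 0"
    define K' where "K' = max K 1"
    have K': "K' \<ge> K" "K' > 0" by (auto simp: K'_def)
    show "\<exists>d>0. \<forall>y\<in>U. nrm E (y - x) < d \<longrightarrow>
      nrm F ((f y - f x) * (g y - g x) - (f x - f x) * (g x - g x) - 0) \<le> e * nrm E (y - x)"
    proof (intro exI[of _ "min d0 (min d1 (e / (K' * C * D)))"] conjI ballI impI)
      fix y assume y: "y \<in> U" "nrm E (y - x) < min d0 (min d1 (e / (K' * C * D)))"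
      let ?n = "nrm E (y - x)"
      have "y - x \<in> carr E" using fD(1) y assms(3) by (auto intro: E.mem)
      then have n: "?n \<ge> 0" by (rule E.nrm_nonneg)
      have m: "f y - f x \<in> carr F" "g y - g x \<in> carr F" using fD gD fx gx y by (auto intro!: F.diff_mem)
      have "nrm F ((f y - f x) * (g y - g x)) \<le> K * (nrm F (f y - f x) * nrm F (g y - g x))"
        by (rule times_le[OF m])
      also have "\<dots> \<le> K' * (nrm F (f y - f x) * nrm F (g y - g x))"
        using K' F.nrm_nonneg m by (intro mult_right_mono mult_nonneg_nonneg) auto
      also have "\<dots> \<le> K' * ((C * ?n) * (D * ?n))"
        using CL[rule_format, OF y(1)] DL[rule_format, OF y(1)] y(2) K' F.nrm_nonneg m C(1) D(1) n
        by (intro mult_left_mono mult_mono) auto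
      also have "\<dots> = (?n * (K' * C * D)) * ?n" by (simp add: algebra_simps)
      also have "\<dots> \<le> e * ?n"
        using y(2) K' C(1) D(1) n by (intro mult_right_mono) (auto simp: field_simps)
      finally show "nrm F ((f y - f x) * (g y - g x) - (f x - f x) * (g x - g x) - 0) \<le> e * ?n"
        by simp
    qed (use C(1,2) D(1,2) e K'(2) in auto)
  qed
  have four: "has_fderiv E F U (\<lambda>y. - (f x * g x)) (\<lambda>_. 0) x"
    by (intro has_fderiv_const assms F.minus_mem times_mem fx gx fD(1))
  have sum: "has_fderiv E F U
      (\<lambda>y. f y * g x + g y * f x + (f y - f x) * (g y - g x) + - (f x * g x))
      (\<lambda>u. L u * g x + M u * f x + 0 + 0) x"
    by (intro has_fderiv_add[OF assms(1-3)] one two three four)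
  have eq: "(\<lambda>u. L u * g x + M u * f x + 0 + 0) = (\<lambda>u. L u * g x + f x * M u)"
    by (simp add: fun_eq_iff algebra_simps)
  then show ?thesis
    by (intro has_fderiv_cong[OF sum[unfolded eq]]) (auto simp: fun_eq_iff algebra_simps)
qed

text \<open>
  Only the values of the linear map on the carrier matter, and two formulas for it may differ
  elsewhere, like \<open>u\<close> and \<open>exp 0 \<cdot> u\<close>, where the exponential is understood to vanish off \<open>B\<close>.
\<close>

lemma has_fderiv_cong_deriv:
  assumes "normed_nspace E" "U \<subseteq> carr E" "has_fderiv E F U f L x"
    and eq: "\<And>u. u \<in> carr E \<Longrightarrow> L u = M u"
  shows "has_fderiv E F U f M x"
proof -
  interpret E: normed_nspace E by fact
  note D = has_fderivD[OF assms(3)]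
  obtain C where C: "C > 0" "\<And>u. u \<in> carr E \<Longrightarrow> nrm F (L u) \<le> C * nrm E u"
    using bounded_linear_map_bound[OF assms(1) D(3)] by blast
  note Lm = bounded_linear_mapD[OF D(3)]
  have "bounded_linear_map E F M"
  proof (rule bounded_linear_mapI[where C = C])
    fix u w :: 'a and c :: real assume u: "u \<in> carr E"
    show "M u \<in> carr F" using Lm(1)[OF u] eq[OF u] by simp
    show "M (c *\<^sub>R u) = c *\<^sub>R M u" using Lm(3)[OF u] eq[OF u] eq[OF E.scale_mem[OF u]] by simp
    show "nrm F (M u) \<le> C * nrm E u" using C(2)[OF u] eq[OF u] by simp
    assume w: "w \<in> carr E"
    show "M (u + w) = M u + M w" using Lm(2)[OF u w] eq[OF u] eq[OF w] eq[OF E.add_mem[OF u w]] by simp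
  qed
  moreover have "L (y - x) = M (y - x)" if "y \<in> U" for y
    using eq E.diff_mem subsetD[OF assms(2)] D(1) that by blast
  ultimately show ?thesis using assms(3) unfolding has_fderiv_def by simp
qed

text \<open>
  \<open>L(E\<^sup>0; F)\<close> is \<open>F\<close>, a form of no arguments being the value it takes on the empty list.
\<close>

lemma has_fderiv_multilin_0D:
  assumes "normed_nspace E"
    and f: "has_fderiv E (multilin E F 0) U (\<lambda>x vs. if vs = [] then f x else 0) L x"
  shows "has_fderiv E F U f (\<lambda>u. L u []) x"
proof -
  have args0: "args E 0 = {[]}" by (auto simp: args_def)
  have "{vs \<in> args E 0. \<forall>v\<in>set vs. nrm E v \<le> 1} = {[]}" unfolding args0 by auto
  then have nrm0: "nrm (multilin E F 0) A = nrm F (A [])" for A by (simp add: multilin_def)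
  have carr0: "A \<in> carr (multilin E F 0) \<Longrightarrow> A [] \<in> carr F" for A by (simp add: multilin_def args0)
  note D = has_fderivD[OF f]
  obtain C where C: "C > 0" "\<And>u. u \<in> carr E \<Longrightarrow> nrm (multilin E F 0) (L u) \<le> C * nrm E u"
    using bounded_linear_map_bound[OF assms(1) D(3)] by blast
  note Lm = bounded_linear_mapD[OF D(3)]
  have "bounded_linear_map E F (\<lambda>u. L u [])"
    by (rule bounded_linear_mapI[where C = C])
      (use Lm C(2) carr0 in \<open>auto simp: nrm0 scaleR_fun_def\<close>)
  moreover have "f y \<in> carr F" if "y \<in> U" for y using carr0[of "\<lambda>vs. if vs = [] then f y else 0"] D(2) that by auto
  ultimately show ?thesis using f unfolding has_fderiv_def nrm0 by auto
qed

section \<open>Jets: all derivatives of a function at a point\<close>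

text \<open>
  A jet is the family of all derivatives of a real function at one point: it sends a list of
  directions, in the order from the last to the first differentiation, to the corresponding
  iterated directional derivative. Working with lists of directions instead of with the spaces
  \<open>L(X\<^sup>i; \<real>)\<close> makes every formula for derivatives a recursion on lists. In the following two
  definitions \<open>n\<close> strictly exceeds the orders considered, so that fixing the first direction of a
  jet turns \<open>Suc n\<close> into \<open>n\<close>.
\<close>

definition jet_bounded :: "nat \<Rightarrow> real \<Rightarrow> ('a::real_normed_vector list \<Rightarrow> real) \<Rightarrow> bool" where
  "jet_bounded n C A \<longleftrightarrow> (\<forall>vs. length vs < n \<longrightarrow> \<bar>A vs\<bar> \<le> C * prod_list (map norm vs))"

definition jet_multilinear :: "nat \<Rightarrow> ('a::real_normed_vector list \<Rightarrow> real) \<Rightarrow> bool" where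
  "jet_multilinear n A \<longleftrightarrow> (\<forall>vs j u w c. length vs < n \<longrightarrow> j < length vs \<longrightarrow>
     A (vs[j := c *\<^sub>R u + w]) = c * A (vs[j := u]) + A (vs[j := w]))"

text \<open>
  The jet of a product: each direction differentiates either the first factor or the second.
\<close>

fun leibniz :: "('a list \<Rightarrow> real) \<Rightarrow> ('a list \<Rightarrow> real) \<Rightarrow> 'a list \<Rightarrow> real" where
  "leibniz A B [] = A [] * B []"
| "leibniz A B (v # vs) = leibniz (\<lambda>ws. A (v # ws)) B vs + leibniz A (\<lambda>ws. B (v # ws)) vs"

text \<open>
  The product depends only on the two jets up to the order at which it is evaluated. As a
  congruence rule for recursive definitions this yields the termination of \<open>exp_jet\<close>.
\<close>

lemma leibniz_cong [fundef_cong]: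
  assumes "vs = vs'" "\<And>ws. length ws \<le> length vs' \<Longrightarrow> A ws = A' ws"
    "\<And>ws. length ws \<le> length vs' \<Longrightarrow> B ws = B' ws"
  shows "leibniz A B vs = leibniz A' B' vs'"
  using assms(2,3) unfolding assms(1)
proof (induction vs' arbitrary: A A' B B')
  case (Cons v vs')
  have "leibniz (\<lambda>ws. A (v # ws)) B vs' = leibniz (\<lambda>ws. A' (v # ws)) B' vs'"
    by (rule Cons.IH) (use Cons.prems in auto)
  moreover have "leibniz A (\<lambda>ws. B (v # ws)) vs' = leibniz A' (\<lambda>ws. B' (v # ws)) vs'"
    by (rule Cons.IH) (use Cons.prems in auto)
  ultimately show ?case by simp
qed simp

lemma leibniz_commute: "leibniz A B vs = leibniz B A vs"
  by (induction vs arbitrary: A B) (auto simp: add.commute)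

lemma leibniz_add_left: "leibniz (\<lambda>ws. A ws + A' ws) B vs = leibniz A B vs + leibniz A' B vs"
  by (induction vs arbitrary: A A' B) (auto simp: algebra_simps)

lemma leibniz_scale_left: "leibniz (\<lambda>ws. c * A ws) B vs = c * leibniz A B vs"
  by (induction vs arbitrary: A B) (auto simp: algebra_simps)

lemma leibniz_diff_left: "leibniz (\<lambda>ws. A ws - A' ws) B vs = leibniz A B vs - leibniz A' B vs"
  by (induction vs arbitrary: A A' B) (auto simp: algebra_simps)

lemma leibniz_add_right: "leibniz A (\<lambda>ws. B ws + B' ws) vs = leibniz A B vs + leibniz A B' vs"
  by (induction vs arbitrary: A B B') (auto simp: algebra_simps)

lemma leibniz_scale_right: "leibniz A (\<lambda>ws. c * B ws) vs = c * leibniz A B vs"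
  by (induction vs arbitrary: A B) (auto simp: algebra_simps)

lemma leibniz_diff_right: "leibniz A (\<lambda>ws. B ws - B' ws) vs = leibniz A B vs - leibniz A B' vs"
  by (induction vs arbitrary: A B B') (auto simp: algebra_simps)

lemma leibniz_assoc: "leibniz (leibniz A B) C vs = leibniz A (leibniz B C) vs"
  by (induction vs arbitrary: A B C) (auto simp: leibniz_add_left leibniz_add_right algebra_simps)

lemma leibniz_right_commute: "leibniz (leibniz A B) C vs = leibniz (leibniz A C) B vs"
proof -
  have "leibniz B C = leibniz C B" by (rule ext) (rule leibniz_commute)
  then show ?thesis by (simp add: leibniz_assoc)
qed

lemma jet_boundedD: "jet_bounded n C A \<Longrightarrow> length vs < n \<Longrightarrow> \<bar>A vs\<bar> \<le> C * prod_list (map norm vs)"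
  unfolding jet_bounded_def by blast

lemma prod_list_norm_nonneg: "0 \<le> prod_list (map norm vs)"
  by (induction vs) auto

lemma jet_bounded_mono: "jet_bounded n C A \<Longrightarrow> m \<le> n \<Longrightarrow> C \<le> D \<Longrightarrow> jet_bounded m D A"
  unfolding jet_bounded_def
  by (meson order_less_le_trans order_trans mult_right_mono prod_list_norm_nonneg)

lemma jet_bounded_nonneg: "jet_bounded n C A \<Longrightarrow> n > 0 \<Longrightarrow> 0 \<le> C"
  using jet_boundedD[of n C A "[]"] by simp

lemma jet_bounded_Suc_iff:
  "jet_bounded (Suc n) C A \<longleftrightarrow>
     \<bar>A []\<bar> \<le> C \<and> (\<forall>v. jet_bounded n (C * norm v) (\<lambda>vs. A (v # vs)))"
proof
  assume *: "jet_bounded (Suc n) C A"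
  show "\<bar>A []\<bar> \<le> C \<and> (\<forall>v. jet_bounded n (C * norm v) (\<lambda>vs. A (v # vs)))"
    using jet_boundedD[OF *, of "[]"] jet_boundedD[OF *, of "v # vs" for v vs]
    by (auto simp: jet_bounded_def mult.assoc)
next
  assume *: "\<bar>A []\<bar> \<le> C \<and> (\<forall>v. jet_bounded n (C * norm v) (\<lambda>vs. A (v # vs)))"
  show "jet_bounded (Suc n) C A"
    unfolding jet_bounded_def
  proof (intro allI impI)
    fix vs :: "'a list" assume "length vs < Suc n"
    then show "\<bar>A vs\<bar> \<le> C * prod_list (map norm vs)"
      using * by (cases vs) (auto simp: jet_bounded_def mult.assoc)
  qed
qed

lemma jet_bounded_slot: "jet_bounded (Suc n) C A \<Longrightarrow> jet_bounded n (C * norm v) (\<lambda>vs. A (v # vs))"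
  by (simp add: jet_bounded_Suc_iff)

lemma jet_bounded_add:
  assumes "jet_bounded n C A" "jet_bounded n D B"
  shows "jet_bounded n (C + D) (\<lambda>vs. A vs + B vs)"
  unfolding jet_bounded_def
proof (intro allI impI)
  fix vs :: "'a list" assume "length vs < n"
  then show "\<bar>A vs + B vs\<bar> \<le> (C + D) * prod_list (map norm vs)"
    using jet_boundedD[OF assms(1), of vs] jet_boundedD[OF assms(2), of vs]
    unfolding distrib_right by linarith
qed

lemma jet_bounded_scale:
  assumes "jet_bounded n C A"
  shows "jet_bounded n (\<bar>c\<bar> * C) (\<lambda>vs. c * A vs)"
  unfolding jet_bounded_def
proof (intro allI impI)
  fix vs :: "'a list" assume "length vs < n"
  then show "\<bar>c * A vs\<bar> \<le> \<bar>c\<bar> * C * prod_list (map norm vs)"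
    using mult_left_mono[OF jet_boundedD[OF assms(1), of vs], of "\<bar>c\<bar>"] by (simp add: abs_mult mult.assoc)
qed

text \<open>
  The factor \<open>2\<^sup>n\<close> counts the ways of distributing \<open>n\<close> directions over the two factors.
\<close>

lemma leibniz_le:
  assumes "jet_bounded n C A" "jet_bounded n D B" "length vs < n"
  shows "\<bar>leibniz A B vs\<bar> \<le> 2 ^ length vs * (C * D) * prod_list (map norm vs)"
  using assms
proof (induction vs arbitrary: n A B C D)
  case Nil
  then show ?case
    using jet_boundedD[of n C A "[]"] jet_boundedD[of n D B "[]"]
    by (auto simp: abs_mult intro: mult_mono)
next
  case (Cons v vs)
  then obtain m where n: "n = Suc m" and m: "length vs < m" by (cases n) auto
  have m': "jet_bounded m C A" "jet_bounded m D B"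
    using Cons.prems n by (auto intro: jet_bounded_mono)
  have "\<bar>leibniz (\<lambda>ws. A (v # ws)) B vs\<bar> \<le> 2 ^ length vs * (C * norm v * D) * prod_list (map norm vs)"
    by (rule Cons.IH[OF _ m'(2) m]) (use Cons.prems n in \<open>auto intro: jet_bounded_slot\<close>)
  moreover have "\<bar>leibniz A (\<lambda>ws. B (v # ws)) vs\<bar> \<le> 2 ^ length vs * (C * (D * norm v)) * prod_list (map norm vs)"
    by (rule Cons.IH[OF m'(1) _ m]) (use Cons.prems n in \<open>auto intro: jet_bounded_slot\<close>)
  ultimately show ?case by (simp add: algebra_simps)
qed

lemma jet_bounded_leibniz:
  assumes "jet_bounded n C A" "jet_bounded n D B"
  shows "jet_bounded n (2 ^ n * (C * D)) (leibniz A B)"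
  unfolding jet_bounded_def
proof (intro allI impI)
  fix vs :: "'a list" assume l: "length vs < n"
  then have CD: "C * D \<ge> 0" using assms jet_bounded_nonneg by (metis mult_nonneg_nonneg not_less_zero neq0_conv)
  have "2 ^ length vs * (C * D) * prod_list (map norm vs) \<le> 2 ^ n * (C * D) * prod_list (map norm vs)"
    using l CD prod_list_norm_nonneg by (intro mult_right_mono) auto
  with leibniz_le[OF assms l]
  show "\<bar>leibniz A B vs\<bar> \<le> 2 ^ n * (C * D) * prod_list (map norm vs)" by linarith
qed

lemma jet_multilinearD:
  assumes "jet_multilinear n A" "length vs < n" "j < length vs"
  shows "A (vs[j := c *\<^sub>R u + w]) = c * A (vs[j := u]) + A (vs[j := w])"
  using assms unfolding jet_multilinear_def by blast

lemma jet_multilinear_mono: "jet_multilinear n A \<Longrightarrow> m \<le> n \<Longrightarrow> jet_multilinear m A"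
  unfolding jet_multilinear_def by (meson order_less_le_trans)

lemma jet_multilinear_slot: "jet_multilinear (Suc n) A \<Longrightarrow> jet_multilinear n (\<lambda>vs. A (v # vs))"
  unfolding jet_multilinear_def
proof (intro allI impI)
  fix vs :: "'a list" and j u w c
  assume *: "\<forall>vs j u w c. length vs < Suc n \<longrightarrow> j < length vs \<longrightarrow>
     A (vs[j := c *\<^sub>R u + w]) = c * A (vs[j := u]) + A (vs[j := w])" "length vs < n" "j < length vs"
  show "A (v # vs[j := c *\<^sub>R u + w]) = c * A (v # vs[j := u]) + A (v # vs[j := w])"
    using *(1)[rule_format, of "v # vs" "Suc j"] *(2,3) by simp
qed

lemma jet_multilinear_head:
  "jet_multilinear n A \<Longrightarrow> Suc (length vs) < n \<Longrightarrow> A ((c *\<^sub>R u + w) # vs) = c * A (u # vs) + A (w # vs)"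
  using jet_multilinearD[of n A "u # vs" 0 c u w] by simp

lemma jet_multilinear_leibniz:
  assumes "jet_multilinear n A" "jet_multilinear n B"
  shows "jet_multilinear n (leibniz A B)"
proof -
  have "leibniz A B (vs[j := c *\<^sub>R u + w]) = c * leibniz A B (vs[j := u]) + leibniz A B (vs[j := w])"
    if "length vs < n" "j < length vs" for vs j c u w
    using that assms
  proof (induction vs arbitrary: A B j n)
    case (Cons v vs)
    then obtain m where n: "n = Suc m" and m: "length vs < m" by (cases n) auto
    have mono: "jet_multilinear m A" "jet_multilinear m B"
      using Cons.prems n by (auto intro: jet_multilinear_mono)
    have slot: "jet_multilinear m (\<lambda>vs. A (v # vs))" "jet_multilinear m (\<lambda>vs. B (v # vs))" for v
      using Cons.prems n by (auto intro: jet_multilinear_slot)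
    show ?case
    proof (cases j)
      case 0
      have A: "leibniz (\<lambda>ws. A ((c *\<^sub>R u + w) # ws)) B vs =
        leibniz (\<lambda>ws. c * A (u # ws) + A (w # ws)) B vs"
        by (rule leibniz_cong) (use Cons.prems n m in \<open>auto intro!: jet_multilinear_head\<close>)
      have B: "leibniz A (\<lambda>ws. B ((c *\<^sub>R u + w) # ws)) vs =
        leibniz A (\<lambda>ws. c * B (u # ws) + B (w # ws)) vs"
        by (rule leibniz_cong) (use Cons.prems n m in \<open>auto intro!: jet_multilinear_head\<close>)
      show ?thesis
        using A B 0 by (simp add: leibniz_add_left leibniz_add_right leibniz_scale_left
            leibniz_scale_right algebra_simps)
    next
      case (Suc i)
      then have i: "i < length vs" using Cons.prems by simp
      show ?thesis
        using Cons.IH[OF m i slot(1) mono(2)] Cons.IH[OF m i mono(1) slot(2)] Suc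
        by (simp add: algebra_simps)
    qed
  qed simp
  then show ?thesis unfolding jet_multilinear_def by blast
qed

lemma jet_multilinear_add:
  "jet_multilinear n A \<Longrightarrow> jet_multilinear n B \<Longrightarrow> jet_multilinear n (\<lambda>vs. A vs + B vs)"
  unfolding jet_multilinear_def by (simp add: algebra_simps)

definition const_jet :: "real \<Rightarrow> 'a list \<Rightarrow> real" where
  "const_jet c = (\<lambda>vs. if vs = [] then c else 0)"

lemma const_jet_simps [simp]: "const_jet c [] = c" "const_jet c (v # vs) = 0"
  by (simp_all add: const_jet_def)

lemma jet_multilinear_const: "jet_multilinear n (const_jet c)"
  unfolding jet_multilinear_def const_jet_def
  by auto

lemma jet_bounded_const: "jet_bounded n \<bar>c\<bar> (const_jet c)"
  unfolding jet_bounded_def const_jet_def by (auto intro: mult_nonneg_nonneg prod_list_norm_nonneg)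

lemma leibniz_const_left: "leibniz (const_jet c) B vs = c * B vs"
proof (induction vs arbitrary: B)
  case (Cons v vs)
  have "leibniz (\<lambda>ws. 0) B vs = 0" for B using leibniz_scale_left[of 0 "\<lambda>_. 0" B vs] by simp
  then show ?case using Cons by simp
qed simp

text \<open>
  The jet of \<open>exp \<circ> f\<close> in terms of that of \<open>f\<close>: the derivative of \<open>exp \<circ> f\<close> in a direction \<open>v\<close> is
  the product of \<open>exp \<circ> f\<close> with the derivative of \<open>f\<close> in that direction.
\<close>

fun exp_jet :: "('a list \<Rightarrow> real) \<Rightarrow> 'a list \<Rightarrow> real" where
  "exp_jet A [] = exp (A [])"
| "exp_jet A (v # vs) = leibniz (\<lambda>ws. exp_jet A ws) (\<lambda>ws. A (v # ws)) vs"

lemma jet_multilinear_exp_jet: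
  assumes "jet_multilinear n A"
  shows "jet_multilinear n (exp_jet A)"
  using assms
proof (induction n)
  case (Suc n)
  have IH: "jet_multilinear n (exp_jet A)"
    by (rule Suc.IH[OF jet_multilinear_mono[OF Suc.prems]]) simp
  have "exp_jet A (vs[j := c *\<^sub>R u + w]) = c * exp_jet A (vs[j := u]) + exp_jet A (vs[j := w])"
    if l: "length vs < Suc n" and j: "j < length vs" for vs j c u w
  proof (cases vs)
    case (Cons v ws)
    show ?thesis
    proof (cases j)
      case 0
      have "leibniz (exp_jet A) (\<lambda>ws. A ((c *\<^sub>R u + w) # ws)) ws =
        leibniz (exp_jet A) (\<lambda>ws. c * A (u # ws) + A (w # ws)) ws"
        by (rule leibniz_cong) (use Suc.prems l Cons in \<open>auto intro!: jet_multilinear_head\<close>)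
      then show ?thesis
        using 0 Cons by (simp add: leibniz_add_right leibniz_scale_right)
    next
      case (Suc i)
      have "jet_multilinear n (leibniz (exp_jet A) (\<lambda>ws. A (v # ws)))"
        by (intro jet_multilinear_leibniz IH jet_multilinear_slot Suc.prems)
      from jet_multilinearD[OF this, of ws i]
      show ?thesis using Suc Cons l j by simp
    qed
  qed (use j in simp)
  then show ?case unfolding jet_multilinear_def by blast
qed (simp add: jet_multilinear_def)

text \<open>
  The bound depends on the bound of the jet only. This uniformity makes \<open>exp \<circ> a\<close> bounded with all
  its derivatives.
\<close>

lemma jet_bounded_exp_jet:
  "\<exists>M>0. \<forall>A::'a::real_normed_vector list \<Rightarrow> real. jet_bounded n C A \<longrightarrow> jet_bounded n M (exp_jet A)"
proof (induction n)
  case 0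
  show ?case by (rule exI[of _ 1]) (simp add: jet_bounded_def)
next
  case (Suc n)
  then obtain M where M: "M > 0"
    "\<And>A::'a list \<Rightarrow> real. jet_bounded n C A \<Longrightarrow> jet_bounded n M (exp_jet A)" by blast
  define N where "N = max (exp C) (2 ^ n * (M * C))"
  have "jet_bounded (Suc n) N (exp_jet A)" if A: "jet_bounded (Suc n) C A" for A :: "'a list \<Rightarrow> real"
    unfolding jet_bounded_Suc_iff
  proof (intro conjI allI)
    have "\<bar>A []\<bar> \<le> C" using A by (simp add: jet_bounded_Suc_iff)
    then have "exp (A []) \<le> exp C" by simp
    also have "\<dots> \<le> N" unfolding N_def by (rule max.cobounded1)
    finally show "\<bar>exp_jet A []\<bar> \<le> N" by simp
    fix v
    have "jet_bounded n (2 ^ n * (M * (C * norm v))) (leibniz (exp_jet A) (\<lambda>ws. A (v # ws)))"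
      by (rule jet_bounded_leibniz[OF M(2)[OF jet_bounded_mono[OF A]] jet_bounded_slot[OF A]]) auto
    moreover have "2 ^ n * (M * (C * norm v)) \<le> N * norm v"
      using mult_right_mono[of "2 ^ n * (M * C)" N "norm v"] unfolding N_def mult.assoc by simp
    ultimately show "jet_bounded n (N * norm v) (\<lambda>vs. exp_jet A (v # vs))"
      by (simp add: jet_bounded_mono)
  qed
  moreover have "N > 0" by (simp add: N_def less_max_iff_disj)
  ultimately show ?case by blast
qed

lemma abs_exp_minus_one_minus_le:
  assumes "\<bar>t::real\<bar> \<le> 1"
  shows "\<bar>exp t - 1 - t\<bar> \<le> t\<^sup>2"
proof -
  have "exp t \<le> 1 + t + t\<^sup>2"
  proof (cases "t \<ge> 0")
    case True
    then show ?thesis using assms by (intro exp_bound) auto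
  next
    case False
    have "t * t\<^sup>2 \<le> 0" using False by (intro mult_nonpos_nonneg) auto
    then have "1 \<le> (1 + t + t\<^sup>2) * (1 - t)" by (simp add: algebra_simps power2_eq_square)
    also have "\<dots> \<le> (1 + t + t\<^sup>2) * exp (- t)"
    proof (rule mult_left_mono)
      show "1 - t \<le> exp (- t)" using exp_ge_add_one_self[of "- t"] by simp
      have "0 \<le> t\<^sup>2" by simp
      then show "0 \<le> 1 + t + t\<^sup>2" using assms by linarith
    qed
    finally have "1 * exp t \<le> (1 + t + t\<^sup>2) * exp (- t) * exp t" by (rule mult_right_mono) simp
    then show ?thesis by (simp add: mult.assoc flip: exp_add)
  qed
  then show ?thesis using exp_ge_add_one_self[of t] by linarith
qed

lemma abs_exp_minus_one_le:
  assumes "\<bar>t::real\<bar> \<le> 1"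
  shows "\<bar>exp t - 1\<bar> \<le> 2 * \<bar>t\<bar>"
proof -
  have "\<bar>t\<bar> * \<bar>t\<bar> \<le> \<bar>t\<bar> * 1" by (rule mult_left_mono) (use assms in auto)
  then have "t\<^sup>2 \<le> \<bar>t\<bar>" by (simp add: power2_eq_square)
  then show ?thesis using abs_exp_minus_one_minus_le[OF assms] by linarith
qed

text \<open>
  This is the estimate behind the differentiability of the exponential: the directional recursion
  trades one derivative of \<open>exp h - 1 - h\<close> for a product of \<open>exp h - 1\<close> with a derivative of \<open>h\<close>, and
  one of \<open>exp h - 1\<close> for a product of \<open>exp h\<close> with a derivative of \<open>h\<close>.
\<close>

lemma exp_jet_remainder_bounded:
  "\<exists>M>0. \<forall>\<delta> A. \<delta> \<le> 1 \<longrightarrow> jet_bounded n \<delta> (A::'a::real_normed_vector list \<Rightarrow> real) \<longrightarrow>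
     jet_bounded n (M * \<delta>\<^sup>2) (\<lambda>vs. exp_jet A vs - const_jet 1 vs - A vs)"
proof -
  obtain M where M: "M > 0"
    "\<And>A::'a list \<Rightarrow> real. jet_bounded n 1 A \<Longrightarrow> jet_bounded n M (exp_jet A)"
    using jet_bounded_exp_jet[of n 1] by blast
  define N where "N = max 2 (2 ^ n * M)"
  have N: "N > 0" by (simp add: N_def)
  \<comment> \<open>First \<open>exp h - 1 = O(\<delta>)\<close>, from the boundedness of the jet of \<open>exp h\<close>.\<close>
  have one: "jet_bounded n (N * \<delta>) (\<lambda>vs. exp_jet A vs - const_jet 1 vs)"
    if d: "\<delta> \<le> 1" and A: "jet_bounded n \<delta> A" for \<delta> and A :: "'a list \<Rightarrow> real"
  proof (cases n)
    case (Suc m)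
    have E: "jet_bounded n M (exp_jet A)" by (intro M jet_bounded_mono[OF A _ d]) simp
    have d0: "\<delta> \<ge> 0" using jet_bounded_nonneg[OF A] Suc by simp
    show ?thesis unfolding Suc jet_bounded_Suc_iff
    proof (intro conjI allI)
      have "\<bar>A []\<bar> \<le> \<delta>" using jet_boundedD[OF A, of "[]"] Suc by simp
      then have "\<bar>exp (A []) - 1\<bar> \<le> 2 * \<delta>" using abs_exp_minus_one_le[of "A []"] d by simp
      also have "\<dots> \<le> N * \<delta>" using d0 by (intro mult_right_mono) (simp_all add: N_def)
      finally show "\<bar>exp_jet A [] - const_jet 1 []\<bar> \<le> N * \<delta>" by simp
      fix v
      have "jet_bounded m (2 ^ m * (M * (\<delta> * norm v))) (leibniz (exp_jet A) (\<lambda>ws. A (v # ws)))"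
        by (rule jet_bounded_leibniz[OF jet_bounded_mono[OF E] jet_bounded_slot[OF A[unfolded Suc]]])
          (simp_all add: Suc)
      moreover have "2 ^ m * (M * (\<delta> * norm v)) \<le> N * \<delta> * norm v"
      proof -
        have "2 ^ m * M \<le> 2 ^ n * M" using M(1) Suc by (intro mult_right_mono power_increasing) auto
        also have "\<dots> \<le> N" by (simp add: N_def)
        finally have "2 ^ m * M * (\<delta> * norm v) \<le> N * (\<delta> * norm v)"
          using d0 by (intro mult_right_mono) auto
        then show ?thesis by (simp add: mult.assoc)
      qed
      ultimately show "jet_bounded m (N * \<delta> * norm v) (\<lambda>vs. exp_jet A (v # vs) - const_jet 1 (v # vs))"
        by (simp add: jet_bounded_mono)
    qed
  qed (simp add: jet_bounded_def)
  \<comment> \<open>Then \<open>exp h - 1 - h = O(\<delta>\<^sup>2)\<close>, from the estimate just obtained.\<close>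
  define K where "K = max 1 (2 ^ n * N)"
  have K: "K > 0" by (simp add: K_def)
  have "jet_bounded n (K * \<delta>\<^sup>2) (\<lambda>vs. exp_jet A vs - const_jet 1 vs - A vs)"
    if d: "\<delta> \<le> 1" and A: "jet_bounded n \<delta> A" for \<delta> and A :: "'a list \<Rightarrow> real"
  proof (cases n)
    case (Suc m)
    have d0: "\<delta> \<ge> 0" using jet_bounded_nonneg[OF A] Suc by simp
    show ?thesis unfolding Suc jet_bounded_Suc_iff
    proof (intro conjI allI)
      have a: "\<bar>A []\<bar> \<le> \<delta>" using jet_boundedD[OF A, of "[]"] Suc by simp
      then have "\<bar>exp (A []) - 1 - A []\<bar> \<le> (A [])\<^sup>2"
        using abs_exp_minus_one_minus_le[of "A []"] d by simp
      also have "\<dots> \<le> \<delta>\<^sup>2" using a d0 power_mono[OF a, of 2] by simp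
      also have "\<dots> \<le> K * \<delta>\<^sup>2" using mult_right_mono[of 1 K "\<delta>\<^sup>2"] by (simp add: K_def)
      finally show "\<bar>exp_jet A [] - const_jet 1 [] - A []\<bar> \<le> K * \<delta>\<^sup>2" by simp
      fix v
      have eq: "exp_jet A (v # vs) - const_jet 1 (v # vs) - A (v # vs) =
        leibniz (\<lambda>ws. exp_jet A ws - const_jet 1 ws) (\<lambda>ws. A (v # ws)) vs" for vs
        by (simp add: leibniz_diff_left leibniz_const_left)
      have "jet_bounded m (2 ^ m * (N * \<delta> * (\<delta> * norm v)))
         (leibniz (\<lambda>ws. exp_jet A ws - const_jet 1 ws) (\<lambda>ws. A (v # ws)))"
        by (rule jet_bounded_leibniz[OF jet_bounded_mono[OF one[OF d A]] jet_bounded_slot[OF A[unfolded Suc]]])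
          (simp_all add: Suc)
      moreover have "2 ^ m * (N * \<delta> * (\<delta> * norm v)) \<le> K * \<delta>\<^sup>2 * norm v"
      proof -
        have "2 ^ m * N \<le> 2 ^ n * N" using N Suc by (intro mult_right_mono power_increasing) auto
        also have "\<dots> \<le> K" by (simp add: K_def)
        finally have "2 ^ m * N * (\<delta>\<^sup>2 * norm v) \<le> K * (\<delta>\<^sup>2 * norm v)"
          by (intro mult_right_mono) auto
        then show ?thesis by (simp add: algebra_simps power2_eq_square)
      qed
      ultimately show "jet_bounded m (K * \<delta>\<^sup>2 * norm v)
          (\<lambda>vs. exp_jet A (v # vs) - const_jet 1 (v # vs) - A (v # vs))"
        unfolding eq by (simp add: jet_bounded_mono)
    qed
  qed (simp add: jet_bounded_def)
  then show ?thesis using K by blast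
qed

text \<open>
  With \<open>A' = A + A\<^sub>1 + R\<close> and \<open>B' = B + B\<^sub>1 + S\<close>, the increment of the product beyond its linear part
  consists of the terms \<open>R B'\<close>, \<open>(A + A\<^sub>1) S\<close> and \<open>A\<^sub>1 B\<^sub>1\<close>.
\<close>

lemma leibniz_increment_bounded:
  assumes "jet_bounded n r (\<lambda>vs. A' vs - A vs - A1 vs)" "jet_bounded n s (\<lambda>vs. B' vs - B vs - B1 vs)"
    and "jet_bounded n a A" "jet_bounded n a1 A1" "jet_bounded n b' B'" "jet_bounded n b1 B1"
  shows "jet_bounded n (2 ^ n * (r * b' + (a + a1) * s + a1 * b1))
    (\<lambda>vs. leibniz A' B' vs - leibniz A B vs - (leibniz A1 B vs + leibniz A B1 vs))"
proof -
  let ?R = "\<lambda>vs. A' vs - A vs - A1 vs" and ?S = "\<lambda>vs. B' vs - B vs - B1 vs"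
    and ?T = "\<lambda>vs. A vs + A1 vs"
  have 1: "jet_bounded n (2 ^ n * (r * b')) (leibniz ?R B')"
    by (rule jet_bounded_leibniz[OF assms(1,5)])
  have "jet_bounded n (a + a1) ?T" by (rule jet_bounded_add[OF assms(3,4)])
  then have 2: "jet_bounded n (2 ^ n * ((a + a1) * s)) (leibniz ?T ?S)"
    using assms(2) by (rule jet_bounded_leibniz)
  have 3: "jet_bounded n (2 ^ n * (a1 * b1)) (leibniz A1 B1)"
    by (rule jet_bounded_leibniz[OF assms(4,6)])
  have sum: "jet_bounded n (2 ^ n * (r * b') + 2 ^ n * ((a + a1) * s) + 2 ^ n * (a1 * b1))
    (\<lambda>vs. leibniz ?R B' vs + leibniz ?T ?S vs + leibniz A1 B1 vs)"
    by (rule jet_bounded_add[OF jet_bounded_add[OF 1 2] 3])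
  have eq: "leibniz ?R B' vs + leibniz ?T ?S vs + leibniz A1 B1 vs =
    leibniz A' B' vs - leibniz A B vs - (leibniz A1 B vs + leibniz A B1 vs)" for vs
    by (simp add: leibniz_add_left leibniz_diff_left leibniz_diff_right)
  show ?thesis using sum unfolding eq by (simp only: distrib_left)
qed

lemma leibniz_difference_bounded:
  assumes "jet_bounded n r (\<lambda>vs. A' vs - A vs)" "jet_bounded n s (\<lambda>vs. B' vs - B vs)"
    and "jet_bounded n a A" "jet_bounded n b' B'"
  shows "jet_bounded n (2 ^ n * (r * b' + a * s)) (\<lambda>vs. leibniz A' B' vs - leibniz A B vs)"
proof -
  let ?R = "\<lambda>vs. A' vs - A vs" and ?S = "\<lambda>vs. B' vs - B vs"
  have sum: "jet_bounded n (2 ^ n * (r * b') + 2 ^ n * (a * s))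
    (\<lambda>vs. leibniz ?R B' vs + leibniz A ?S vs)"
    by (rule jet_bounded_add[OF jet_bounded_leibniz[OF assms(1,4)] jet_bounded_leibniz[OF assms(3,2)]])
  have eq: "leibniz ?R B' vs + leibniz A ?S vs = leibniz A' B' vs - leibniz A B vs" for vs
    by (simp add: leibniz_diff_left leibniz_diff_right)
  show ?thesis using sum unfolding eq by (simp only: distrib_left)
qed

section \<open>Jet fields\<close>

text \<open>
  \<open>A\<close> is the field of jets of order \<open>k\<close> of \<open>f\<close>. The two limit conditions state that every level of
  \<open>A\<close> below \<open>k\<close> has the next level as its Frechet derivative and that every level is continuous, with
  estimates that are uniform over unit directions.
\<close>

definition is_jet ::
    "'a::real_normed_vector set \<Rightarrow> nat \<Rightarrow> ('a \<Rightarrow> real) \<Rightarrow> ('a \<Rightarrow> 'a list \<Rightarrow> real) \<Rightarrow> bool" where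
  "is_jet B k f A \<longleftrightarrow> (\<forall>x\<in>B. A x [] = f x \<and> jet_multilinear (Suc k) (A x) \<and>
      (\<exists>C. jet_bounded (Suc k) C (A x)) \<and>
      (\<forall>e>0. \<forall>\<^sub>F y in nhds x.
         jet_bounded k (e * norm (y - x)) (\<lambda>vs. A y vs - A x vs - A x ((y - x) # vs))) \<and>
      (\<forall>e>0. \<forall>\<^sub>F y in nhds x. jet_bounded (Suc k) e (\<lambda>vs. A y vs - A x vs)))"

lemma is_jetD:
  assumes "is_jet B k f A" "x \<in> B"
  shows "A x [] = f x" "jet_multilinear (Suc k) (A x)" "\<exists>C. jet_bounded (Suc k) C (A x)"
    and "e > 0 \<Longrightarrow> \<forall>\<^sub>F y in nhds x.
      jet_bounded k (e * norm (y - x)) (\<lambda>vs. A y vs - A x vs - A x ((y - x) # vs))"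
    and "e > 0 \<Longrightarrow> \<forall>\<^sub>F y in nhds x. jet_bounded (Suc k) e (\<lambda>vs. A y vs - A x vs)"
  using assms unfolding is_jet_def by blast+

lemma is_jet_cong: "is_jet B k f A \<Longrightarrow> (\<And>x. x \<in> B \<Longrightarrow> f x = g x) \<Longrightarrow> is_jet B k g A"
  unfolding is_jet_def by simp

lemma is_jet_pred:
  assumes "is_jet B (Suc k) f A"
  shows "is_jet B k f A"
  unfolding is_jet_def
proof (intro ballI conjI allI impI)
  fix x assume x: "x \<in> B"
  note D = is_jetD[OF assms x]
  show "A x [] = f x" by (rule D(1))
  show "jet_multilinear (Suc k) (A x)" by (rule jet_multilinear_mono[OF D(2)]) simp
  show "\<exists>C. jet_bounded (Suc k) C (A x)" using D(3) jet_bounded_mono[of "Suc (Suc k)" _ _ "Suc k"] by (meson le_SucI order_refl)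
  fix e :: real assume e: "e > 0"
  show "\<forall>\<^sub>F y in nhds x. jet_bounded k (e * norm (y - x)) (\<lambda>vs. A y vs - A x vs - A x ((y - x) # vs))"
    using D(4)[OF e] by eventually_elim (auto elim: jet_bounded_mono)
  show "\<forall>\<^sub>F y in nhds x. jet_bounded (Suc k) e (\<lambda>vs. A y vs - A x vs)"
    using D(5)[OF e] by eventually_elim (auto elim: jet_bounded_mono)
qed

lemma eventually_norm_diff_le: "e > 0 \<Longrightarrow> \<forall>\<^sub>F y in nhds x. norm (y - x) \<le> e"
  for x :: "'a::real_normed_vector"
  unfolding eventually_nhds_metric dist_norm by (intro exI[of _ e]) auto

lemma is_jet_const: "is_jet B k (\<lambda>_. c) (\<lambda>_. const_jet c)"
  unfolding is_jet_def
proof (intro ballI conjI allI impI)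
  show "\<exists>C. jet_bounded (Suc k) C (const_jet c)" using jet_bounded_const by blast
qed (auto simp: jet_multilinear_const jet_bounded_def mult_nonneg_nonneg prod_list_norm_nonneg)

lemma is_jet_add:
  assumes "is_jet B k f A" "is_jet B k g A'"
  shows "is_jet B k (\<lambda>x. f x + g x) (\<lambda>x vs. A x vs + A' x vs)"
  unfolding is_jet_def
proof (intro ballI conjI allI impI)
  fix x assume x: "x \<in> B"
  note D = is_jetD[OF assms(1) x] and D' = is_jetD[OF assms(2) x]
  show "A x [] + A' x [] = f x + g x" using D(1) D'(1) by simp
  show "jet_multilinear (Suc k) (\<lambda>vs. A x vs + A' x vs)" by (rule jet_multilinear_add[OF D(2) D'(2)])
  show "\<exists>C. jet_bounded (Suc k) C (\<lambda>vs. A x vs + A' x vs)"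
    using D(3) D'(3) jet_bounded_add by blast
  fix e :: real assume "e > 0"
  then have e: "e / 2 > 0" by simp
  show "\<forall>\<^sub>F y in nhds x. jet_bounded k (e * norm (y - x))
      (\<lambda>vs. A y vs + A' y vs - (A x vs + A' x vs) - (A x ((y - x) # vs) + A' x ((y - x) # vs)))"
    using D(4)[OF e] D'(4)[OF e]
  proof eventually_elim
    case (elim y)
    show ?case using jet_bounded_add[OF elim] by (simp add: algebra_simps)
  qed
  show "\<forall>\<^sub>F y in nhds x. jet_bounded (Suc k) e (\<lambda>vs. A y vs + A' y vs - (A x vs + A' x vs))"
    using D(5)[OF e] D'(5)[OF e]
  proof eventually_elim
    case (elim y)
    show ?case using jet_bounded_add[OF elim] by (simp add: algebra_simps)
  qed
qed

text \<open>
  The arithmetic of the remainder of a product: \<open>\<eta>\<close> is the relative accuracy of the expansions of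
  the two factors, \<open>h\<close> the length of the increment, and \<open>n\<close> the length of a further direction in
  which the second factor has already been differentiated, \<open>n = 1\<close> if there is none.
\<close>

lemma increment_remainder_le:
  fixes \<eta> h a b n :: real
  assumes "0 \<le> h" "h \<le> \<eta>" "\<eta> \<le> 1" "0 \<le> a" "0 \<le> b" "0 \<le> n"
  shows "\<eta> * h * ((b + 1) * n) + (a + a * h) * (\<eta> * h * n) + (a * h) * (b * h * n)
    \<le> (b + 1 + 2 * a + a * b) * \<eta> * h * n"
proof -
  have "(a + a * h) * (\<eta> * h * n) \<le> (a + a) * (\<eta> * h * n)"
    using assms mult_left_mono[of h 1 a] by (intro mult_right_mono) auto
  moreover have "(a * h) * (b * h * n) \<le> (a * \<eta>) * (b * h * n)"
    using assms by (intro mult_right_mono mult_left_mono) auto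
  ultimately show ?thesis by (simp add: algebra_simps)
qed

lemma eventually_jet_bounded_near:
  assumes "is_jet B k f A" "x \<in> B" "jet_bounded (Suc k) a (A x)"
  shows "\<forall>\<^sub>F y in nhds x. jet_bounded (Suc k) (a + 1) (A y)"
  using is_jetD(5)[OF assms(1,2) zero_less_one]
proof eventually_elim
  case (elim y)
  show ?case using jet_bounded_add[OF assms(3) elim] by simp
qed

text \<open>
  The remainders of the two factors are small relative to the increment, and everything that
  multiplies them is bounded near \<open>x\<close>.
\<close>

lemma is_jet_mult:
  assumes A: "is_jet B k f A" and A': "is_jet B k g A'"
  shows "is_jet B k (\<lambda>x. f x * g x) (\<lambda>x. leibniz (A x) (A' x))"
  unfolding is_jet_def
proof (intro ballI conjI allI impI)
  fix x assume x: "x \<in> B"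
  note D = is_jetD[OF A x] and D' = is_jetD[OF A' x]
  obtain a where a: "jet_bounded (Suc k) a (A x)" using D(3) by blast
  obtain b where b: "jet_bounded (Suc k) b (A' x)" using D'(3) by blast
  have a0: "a \<ge> 0" and b0: "b \<ge> 0" using jet_bounded_nonneg[OF a] jet_bounded_nonneg[OF b] by auto
  show "leibniz (A x) (A' x) [] = f x * g x" using D(1) D'(1) by simp
  show "jet_multilinear (Suc k) (leibniz (A x) (A' x))" by (rule jet_multilinear_leibniz[OF D(2) D'(2)])
  show "\<exists>C. jet_bounded (Suc k) C (leibniz (A x) (A' x))" using jet_bounded_leibniz[OF a b] by blast
  have near: "\<forall>\<^sub>F y in nhds x. jet_bounded (Suc k) (b + 1) (A' y)"
    by (rule eventually_jet_bounded_near[OF A' x b])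
  fix e :: real assume e: "e > 0"
  define K where "K = 2 ^ k * (b + 1 + 2 * a + a * b)"
  have "b + 1 + 2 * a + a * b > 0" using a0 b0 mult_nonneg_nonneg[OF a0 b0] by linarith
  then have K: "K > 0" by (simp add: K_def)
  define \<eta> where "\<eta> = min 1 (e / K)"
  have \<eta>: "\<eta> > 0" "\<eta> \<le> 1" using e K by (auto simp: \<eta>_def)
  have "\<eta> \<le> e / K" by (simp add: \<eta>_def)
  then have \<eta>K: "K * \<eta> \<le> e" using K by (simp add: field_simps)
  show "\<forall>\<^sub>F y in nhds x. jet_bounded k (e * norm (y - x))
    (\<lambda>vs. leibniz (A y) (A' y) vs - leibniz (A x) (A' x) vs - leibniz (A x) (A' x) ((y - x) # vs))"
    using D(4)[OF \<eta>(1)] D'(4)[OF \<eta>(1)] near eventually_norm_diff_le[OF \<eta>(1), of x]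
  proof eventually_elim
    case (elim y)
    let ?h = "norm (y - x)"
    have "jet_bounded k (2 ^ k * (\<eta> * ?h * (b + 1) + (a + a * ?h) * (\<eta> * ?h) + (a * ?h) * (b * ?h)))
      (\<lambda>vs. leibniz (A y) (A' y) vs - leibniz (A x) (A' x) vs -
        (leibniz (\<lambda>vs. A x ((y - x) # vs)) (A' x) vs + leibniz (A x) (\<lambda>vs. A' x ((y - x) # vs)) vs))"
      by (rule leibniz_increment_bounded[OF elim(1,2) jet_bounded_mono[OF a] jet_bounded_slot[OF a]
            jet_bounded_mono[OF elim(3)] jet_bounded_slot[OF b]]) auto
    moreover have "2 ^ k * (\<eta> * ?h * (b + 1) + (a + a * ?h) * (\<eta> * ?h) + (a * ?h) * (b * ?h)) \<le> e * ?h"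
    proof -
      have "2 ^ k * (\<eta> * ?h * ((b + 1) * 1) + (a + a * ?h) * (\<eta> * ?h * 1) + (a * ?h) * (b * ?h * 1))
          \<le> 2 ^ k * ((b + 1 + 2 * a + a * b) * \<eta> * ?h * 1)"
        by (intro mult_left_mono increment_remainder_le) (use elim(4) \<eta> a0 b0 in auto)
      also have "\<dots> = (K * \<eta>) * ?h" by (simp add: K_def)
      also have "\<dots> \<le> e * ?h" using \<eta>K by (intro mult_right_mono) auto
      finally show ?thesis by simp
    qed
    ultimately show ?case by (simp add: jet_bounded_mono)
  qed
  define K' where "K' = 2 ^ Suc k * (b + 1 + a)"
  have K': "K' > 0" using a0 b0 by (simp add: K'_def)
  have e': "e / K' > 0" using e K' by simp
  show "\<forall>\<^sub>F y in nhds x. jet_bounded (Suc k) e (\<lambda>vs. leibniz (A y) (A' y) vs - leibniz (A x) (A' x) vs)"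
    using D(5)[OF e'] D'(5)[OF e'] near
  proof eventually_elim
    case (elim y)
    have "2 ^ Suc k * (e / K' * (b + 1) + a * (e / K')) = K' * (e / K')"
      unfolding K'_def by (simp only: algebra_simps)
    also have "\<dots> = e" using K' by simp
    finally show ?case using leibniz_difference_bounded[OF elim(1,2) a elim(3)] by simp
  qed
qed

lemma is_jet_scale:
  assumes "is_jet B k f A"
  shows "is_jet B k (\<lambda>x. c * f x) (\<lambda>x vs. c * A x vs)"
proof -
  have "(\<lambda>x. leibniz (const_jet c) (A x)) = (\<lambda>x vs. c * A x vs)"
    by (simp add: fun_eq_iff leibniz_const_left)
  then show ?thesis using is_jet_mult[OF is_jet_const assms, of c] by simp
qed

text \<open>
  The chain rule for \<open>exp \<circ> f\<close> at order zero, where \<open>L\<close> is the derivative of \<open>f\<close> at \<open>x\<close>.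
\<close>

lemma eventually_exp_increment_le:
  fixes f :: "'a::real_normed_vector \<Rightarrow> real"
  assumes L: "\<And>h. \<bar>L h\<bar> \<le> a * norm h"
    and f: "\<And>e. e > 0 \<Longrightarrow> \<forall>\<^sub>F y in nhds x. \<bar>f y - f x - L (y - x)\<bar> \<le> e * norm (y - x)"
    and e: "e > 0" and a: "a \<ge> 0"
  shows "\<forall>\<^sub>F y in nhds x. \<bar>exp (f y) - exp (f x) - exp (f x) * L (y - x)\<bar> \<le> e * norm (y - x)"
proof -
  \<comment> \<open>For \<open>h \<le> \<eta>\<close> the increment of \<open>f\<close> is at most \<open>(a + 1) h \<le> 1\<close>, where the quadratic bound applies.\<close>
  define K where "K = exp (f x) * ((a + 1)\<^sup>2 + 1)"
  have K: "K > 0" unfolding K_def by (intro mult_pos_pos add_nonneg_pos) auto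
  define \<eta> where "\<eta> = min (1 / (a + 1)) (e / K)"
  have \<eta>: "\<eta> > 0" using e K a by (simp add: \<eta>_def)
  have "\<eta> \<le> e / K" by (simp add: \<eta>_def)
  then have \<eta>K: "K * \<eta> \<le> e" using K by (simp add: field_simps)
  have "\<eta> \<le> 1 / (a + 1)" by (simp add: \<eta>_def)
  then have \<eta>a: "(a + 1) * \<eta> \<le> 1" using a by (simp add: field_simps)
  show ?thesis using f[OF \<eta>] f[OF zero_less_one] eventually_norm_diff_le[OF \<eta>, of x]
  proof eventually_elim
    case (elim y)
    let ?h = "norm (y - x)" and ?t = "f y - f x"
    have t: "\<bar>?t\<bar> \<le> (a + 1) * ?h" using elim(2) L[of "y - x"] by (simp add: algebra_simps)
    also have "\<dots> \<le> (a + 1) * \<eta>" using elim(3) a by (intro mult_left_mono) auto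
    finally have t1: "\<bar>?t\<bar> \<le> 1" using \<eta>a by simp
    have "\<bar>exp ?t - 1 - ?t\<bar> \<le> ?t\<^sup>2" by (rule abs_exp_minus_one_minus_le[OF t1])
    also have "\<dots> = \<bar>?t\<bar>\<^sup>2" by simp
    also have "\<dots> \<le> ((a + 1) * ?h)\<^sup>2" using t by (rule power_mono) simp
    also have "\<dots> = (a + 1)\<^sup>2 * ?h * ?h" by (simp add: power2_eq_square)
    also have "\<dots> \<le> (a + 1)\<^sup>2 * \<eta> * ?h" using elim(3) by (intro mult_right_mono mult_left_mono) auto
    finally have "\<bar>(exp ?t - 1 - ?t) + (?t - L (y - x))\<bar> \<le> (a + 1)\<^sup>2 * \<eta> * ?h + \<eta> * ?h"
      using elim(1) by linarith
    then have "exp (f x) * \<bar>(exp ?t - 1 - ?t) + (?t - L (y - x))\<bar> \<le> exp (f x) * ((a + 1)\<^sup>2 * \<eta> * ?h + \<eta> * ?h)"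
      by (intro mult_left_mono) auto
    also have "\<dots> = (K * \<eta>) * ?h" by (simp add: K_def algebra_simps)
    also have "\<dots> \<le> e * ?h" using \<eta>K by (intro mult_right_mono) auto
    finally have le: "exp (f x) * \<bar>(exp ?t - 1 - ?t) + (?t - L (y - x))\<bar> \<le> e * ?h" .
    have "exp (f y) - exp (f x) - exp (f x) * L (y - x) = exp (f x) * ((exp ?t - 1 - ?t) + (?t - L (y - x)))"
      by (simp add: algebra_simps flip: exp_add)
    then show ?case using le by (simp add: abs_mult)
  qed
qed

text \<open>
  By induction on the order: a directional derivative of \<open>exp_jet A\<close> is a product of the jet
  \<open>exp_jet A\<close> of lower order with a directional derivative of \<open>A\<close>, so its increments are those of a
  product, uniformly in the direction \<open>v\<close>. With \<open>E\<close> for the jet of the exponential, the linear part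
  of that product contains \<open>(E A\<^sub>h) A\<^sub>v\<close>, whereas \<open>exp_jet\<close> at the directions \<open>h, v\<close> gives
  \<open>(E A\<^sub>v) A\<^sub>h\<close>; these agree by \<open>leibniz_right_commute\<close>.
\<close>

lemma is_jet_exp:
  assumes "is_jet B k f A"
  shows "is_jet B k (\<lambda>x. exp (f x)) (\<lambda>x. exp_jet (A x))"
  using assms
proof (induction k)
  case 0
  show ?case
    unfolding is_jet_def
  proof (intro ballI conjI allI impI)
    fix x assume x: "x \<in> B"
    note D = is_jetD[OF 0 x]
    show "exp_jet (A x) [] = exp (f x)" using D(1) by simp
    show "jet_multilinear (Suc 0) (exp_jet (A x))" by (rule jet_multilinear_exp_jet[OF D(2)])
    show "\<exists>C. jet_bounded (Suc 0) C (exp_jet (A x))" using D(3) jet_bounded_exp_jet by metis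
    fix e :: real assume e: "e > 0"
    show "\<forall>\<^sub>F y in nhds x. jet_bounded 0 (e * norm (y - x))
        (\<lambda>vs. exp_jet (A y) vs - exp_jet (A x) vs - exp_jet (A x) ((y - x) # vs))"
      by (simp add: jet_bounded_def)
    have "((\<lambda>y. A y []) \<longlongrightarrow> A x []) (nhds x)"
    proof (rule tendstoI)
      fix r :: real assume "r > 0"
      then have r: "r / 2 > 0" by simp
      show "\<forall>\<^sub>F y in nhds x. dist (A y []) (A x []) < r"
        using D(5)[OF r] by eventually_elim (use r in \<open>auto simp: jet_bounded_Suc_iff dist_real_def\<close>)
    qed
    then have "((\<lambda>y. exp (A y [])) \<longlongrightarrow> exp (A x [])) (nhds x)" by (rule tendsto_exp)
    from tendstoD[OF this e] show "\<forall>\<^sub>F y in nhds x. jet_bounded (Suc 0) e (\<lambda>vs. exp_jet (A y) vs - exp_jet (A x) vs)"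
      by eventually_elim (auto simp: jet_bounded_def dist_real_def)
  qed
next
  case (Suc k)
  have IH: "is_jet B k (\<lambda>x. exp (f x)) (\<lambda>x. exp_jet (A x))"
    by (rule Suc.IH[OF is_jet_pred[OF Suc.prems]])
  show ?case
    unfolding is_jet_def
  proof (intro ballI conjI allI impI)
    fix x assume x: "x \<in> B"
    note D = is_jetD[OF Suc.prems x] and E = is_jetD[OF IH x]
    obtain b where b: "jet_bounded (Suc (Suc k)) b (A x)" using D(3) by blast
    obtain a where a: "jet_bounded (Suc k) a (exp_jet (A x))" using E(3) by blast
    have a0: "a \<ge> 0" and b0: "b \<ge> 0" using jet_bounded_nonneg[OF a] jet_bounded_nonneg[OF b] by auto
    show "exp_jet (A x) [] = exp (f x)" using D(1) by simp
    show "jet_multilinear (Suc (Suc k)) (exp_jet (A x))" by (rule jet_multilinear_exp_jet[OF D(2)])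
    show "\<exists>C. jet_bounded (Suc (Suc k)) C (exp_jet (A x))" using b jet_bounded_exp_jet by metis
    have near: "\<forall>\<^sub>F y in nhds x. jet_bounded (Suc (Suc k)) (b + 1) (A y)"
      by (rule eventually_jet_bounded_near[OF Suc.prems x b])
    fix e :: real assume e: "e > 0"
    define K where "K = 2 ^ k * (b + 1 + 2 * a + a * b)"
    have "b + 1 + 2 * a + a * b > 0" using a0 b0 mult_nonneg_nonneg[OF a0 b0] by linarith
  then have K: "K > 0" by (simp add: K_def)
    define \<eta> where "\<eta> = min 1 (e / K)"
    have \<eta>: "\<eta> > 0" "\<eta> \<le> 1" using e K by (auto simp: \<eta>_def)
    have "\<eta> \<le> e / K" by (simp add: \<eta>_def)
    then have \<eta>K: "K * \<eta> \<le> e" using K by (simp add: field_simps)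
    have zero: "\<forall>\<^sub>F y in nhds x. \<bar>exp (A y []) - exp (A x []) - exp (A x []) * A x [y - x]\<bar> \<le> e * norm (y - x)"
    proof (rule eventually_exp_increment_le[OF _ _ e b0])
      show "\<bar>A x [h]\<bar> \<le> b * norm h" for h using jet_boundedD[OF b, of "[h]"] by simp
      fix r :: real assume "r > 0"
      from D(4)[OF this]
      show "\<forall>\<^sub>F y in nhds x. \<bar>A y [] - A x [] - A x [y - x]\<bar> \<le> r * norm (y - x)"
        by eventually_elim (simp add: jet_bounded_Suc_iff)
    qed
    show "\<forall>\<^sub>F y in nhds x. jet_bounded (Suc k) (e * norm (y - x))
        (\<lambda>vs. exp_jet (A y) vs - exp_jet (A x) vs - exp_jet (A x) ((y - x) # vs))"
      using D(4)[OF \<eta>(1)] E(4)[OF \<eta>(1)] near eventually_norm_diff_le[OF \<eta>(1), of x] zero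
    proof eventually_elim
      case (elim y)
      let ?h = "norm (y - x)" and ?E = "exp_jet (A x)"
      show ?case unfolding jet_bounded_Suc_iff
      proof (intro conjI allI)
        show "\<bar>exp_jet (A y) [] - ?E [] - ?E [y - x]\<bar> \<le> e * ?h" using elim(5) by simp
        fix v :: 'a
        let ?n = "norm v"
        have "jet_bounded k (2 ^ k * (\<eta> * ?h * ((b + 1) * ?n) + (a + a * ?h) * (\<eta> * ?h * ?n) + (a * ?h) * (b * ?h * ?n)))
          (\<lambda>vs. leibniz (exp_jet (A y)) (\<lambda>ws. A y (v # ws)) vs - leibniz ?E (\<lambda>ws. A x (v # ws)) vs -
            (leibniz (\<lambda>ws. ?E ((y - x) # ws)) (\<lambda>ws. A x (v # ws)) vs +
             leibniz ?E (\<lambda>ws. A x ((y - x) # v # ws)) vs))"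
          by (rule leibniz_increment_bounded[OF elim(2) jet_bounded_slot[OF elim(1)] jet_bounded_mono[OF a]
                jet_bounded_slot[OF a] jet_bounded_slot[OF jet_bounded_mono[OF elim(3)]]
                jet_bounded_slot[OF jet_bounded_slot[OF b]]]) auto
        moreover have "2 ^ k * (\<eta> * ?h * ((b + 1) * ?n) + (a + a * ?h) * (\<eta> * ?h * ?n) + (a * ?h) * (b * ?h * ?n))
          \<le> e * ?h * ?n"
        proof -
          have "2 ^ k * (\<eta> * ?h * ((b + 1) * ?n) + (a + a * ?h) * (\<eta> * ?h * ?n) + (a * ?h) * (b * ?h * ?n))
              \<le> 2 ^ k * ((b + 1 + 2 * a + a * b) * \<eta> * ?h * ?n)"
            by (intro mult_left_mono increment_remainder_le) (use elim(4) \<eta> a0 b0 in auto)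
          also have "\<dots> = (K * \<eta>) * (?h * ?n)" by (simp add: K_def)
          also have "\<dots> \<le> e * (?h * ?n)" using \<eta>K by (intro mult_right_mono) auto
          finally show ?thesis by (simp add: mult.assoc)
        qed
        ultimately have bd: "jet_bounded k (e * ?h * ?n)
          (\<lambda>vs. leibniz (exp_jet (A y)) (\<lambda>ws. A y (v # ws)) vs - leibniz ?E (\<lambda>ws. A x (v # ws)) vs -
            (leibniz (\<lambda>ws. ?E ((y - x) # ws)) (\<lambda>ws. A x (v # ws)) vs +
             leibniz ?E (\<lambda>ws. A x ((y - x) # v # ws)) vs))"
          by (rule jet_bounded_mono[OF _ order_refl])
        have "leibniz (\<lambda>ws. ?E ((y - x) # ws)) (\<lambda>ws. A x (v # ws)) vs =
          leibniz (\<lambda>ws. ?E (v # ws)) (\<lambda>ws. A x ((y - x) # ws)) vs" for vs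
          using leibniz_right_commute[of ?E "\<lambda>ws. A x ((y - x) # ws)" "\<lambda>ws. A x (v # ws)" vs]
          by simp
        with bd show "jet_bounded k (e * ?h * ?n)
          (\<lambda>vs. exp_jet (A y) (v # vs) - ?E (v # vs) - ?E ((y - x) # v # vs))"
          by simp
      qed
    qed
    define K' where "K' = 2 ^ Suc k * (b + 1 + a)"
    have K': "K' > 0" using a0 b0 by (simp add: K'_def)
    have e': "e / K' > 0" using e K' by simp
    show "\<forall>\<^sub>F y in nhds x. jet_bounded (Suc (Suc k)) e (\<lambda>vs. exp_jet (A y) vs - exp_jet (A x) vs)"
      using D(5)[OF e'] E(5)[OF e'] E(5)[OF e] near
    proof eventually_elim
      case (elim y)
      show ?case unfolding jet_bounded_Suc_iff[of "Suc k"]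
      proof (intro conjI allI)
        show "\<bar>exp_jet (A y) [] - exp_jet (A x) []\<bar> \<le> e" using elim(3) by (simp add: jet_bounded_Suc_iff)
        fix v :: 'a
        have "2 ^ Suc k * (e / K' * ((b + 1) * norm v) + a * (e / K' * norm v)) = K' * (e / K') * norm v"
          unfolding K'_def by (simp only: algebra_simps)
        also have "\<dots> = e * norm v" using K' by simp
        finally show "jet_bounded (Suc k) (e * norm v) (\<lambda>vs. exp_jet (A y) (v # vs) - exp_jet (A x) (v # vs))"
          using leibniz_difference_bounded[OF elim(2) jet_bounded_slot[OF elim(1), of v] a
              jet_bounded_slot[OF elim(4), of v]] by simp
      qed
    qed
  qed
qed

section \<open>The spaces of multilinear forms\<close>

text \<open>
  Homogeneity of the norm follows from the inequality, applied to a scalar and to its inverse.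
\<close>

lemma normed_nspaceI:
  fixes E :: "'v::real_vector nspace"
  assumes "0 \<in> carr E"
    and "\<And>u v. u \<in> carr E \<Longrightarrow> v \<in> carr E \<Longrightarrow> u + v \<in> carr E"
    and scale: "\<And>c u. u \<in> carr E \<Longrightarrow> c *\<^sub>R u \<in> carr E"
    and triangle: "\<And>u v. u \<in> carr E \<Longrightarrow> v \<in> carr E \<Longrightarrow> nrm E (u + v) \<le> nrm E u + nrm E v"
    and le: "\<And>c u. u \<in> carr E \<Longrightarrow> nrm E (c *\<^sub>R u) \<le> \<bar>c\<bar> * nrm E u"
    and "\<And>u. u \<in> carr E \<Longrightarrow> nrm E u = 0 \<Longrightarrow> u = 0"
  shows "normed_nspace E"
proof
  fix c :: real and u :: 'v assume u: "u \<in> carr E"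
  show "nrm E (c *\<^sub>R u) = \<bar>c\<bar> * nrm E u"
  proof (cases "c = 0")
    case True
    have "nrm E 0 \<le> 0" using le[OF u, of 0] by simp
    moreover have "0 \<le> nrm E 0" using triangle[OF assms(1,1)] by simp
    ultimately show ?thesis using True by simp
  next
    case False
    have "nrm E u \<le> \<bar>inverse c\<bar> * nrm E (c *\<^sub>R u)" using le[OF scale[OF u], of "inverse c" c] False by simp
    then have "\<bar>c\<bar> * nrm E u \<le> nrm E (c *\<^sub>R u)" using False by (simp add: field_simps)
    then show ?thesis using le[OF u, of c] by simp
  qed
qed (use assms in auto)

abbreviation Mult :: "nat \<Rightarrow> ('a::real_normed_vector list \<Rightarrow> real) nspace" where
  "Mult i \<equiv> multilin type_space type_space i"

lemma args_type_space: "args type_space i = {vs. length vs = i}"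
  by (simp add: args_def type_space_def)

lemma carr_Mult_iff:
  "A \<in> carr (Mult i) \<longleftrightarrow> (\<forall>vs. length vs \<noteq> i \<longrightarrow> A vs = 0) \<and>
     (\<forall>vs j u w c. length vs = i \<longrightarrow> j < i \<longrightarrow>
        A (vs[j := c *\<^sub>R u + w]) = c * A (vs[j := u]) + A (vs[j := w])) \<and>
     (\<exists>C. \<forall>vs. length vs = i \<longrightarrow> \<bar>A vs\<bar> \<le> C * prod_list (map norm vs))"
  unfolding multilin_def args_type_space by (auto simp: type_space_def)

lemma carr_MultI:
  assumes "\<And>vs. length vs \<noteq> i \<Longrightarrow> A vs = 0"
    and "\<And>vs j u w c. length vs = i \<Longrightarrow> j < i \<Longrightarrow>
        A (vs[j := c *\<^sub>R u + w]) = c * A (vs[j := u]) + A (vs[j := w])"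
    and "\<And>vs. length vs = i \<Longrightarrow> \<bar>A vs\<bar> \<le> C * prod_list (map norm vs)"
  shows "A \<in> carr (Mult i)"
  unfolding carr_Mult_iff using assms by blast

lemma carr_MultD:
  assumes "A \<in> carr (Mult i)"
  shows "length vs \<noteq> i \<Longrightarrow> A vs = 0"
    and "length vs = i \<Longrightarrow> j < i \<Longrightarrow>
        A (vs[j := c *\<^sub>R u + w]) = c * A (vs[j := u]) + A (vs[j := w])"
    and "\<exists>C. \<forall>vs. length vs = i \<longrightarrow> \<bar>A vs\<bar> \<le> C * prod_list (map norm vs)"
  using assms unfolding carr_Mult_iff by blast+

lemma nrm_Mult:
  "nrm (Mult i) A = (SUP vs\<in>{vs. length vs = i \<and> (\<forall>v\<in>set vs. norm v \<le> 1)}. \<bar>A vs\<bar>)"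
  unfolding multilin_def args_type_space by (simp add: type_space_def)

lemma prod_list_norm_le_1: "(\<forall>v\<in>set vs. norm v \<le> 1) \<Longrightarrow> prod_list (map norm vs) \<le> 1"
  by (induction vs) (auto intro: mult_le_one prod_list_norm_nonneg)

lemma nrm_Mult_le:
  fixes A :: "'a::real_normed_vector list \<Rightarrow> real"
  assumes "\<And>vs. length vs = i \<Longrightarrow> \<bar>A vs\<bar> \<le> C * prod_list (map norm vs)" "C \<ge> 0"
  shows "nrm (Mult i) A \<le> C"
  unfolding nrm_Mult
proof (rule cSUP_least)
  have "replicate i 0 \<in> {vs::'a list. length vs = i \<and> (\<forall>v\<in>set vs. norm v \<le> 1)}" by auto
  then show "{vs::'a list. length vs = i \<and> (\<forall>v\<in>set vs. norm v \<le> 1)} \<noteq> {}" by blast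
  fix vs :: "'a list" assume vs: "vs \<in> {vs. length vs = i \<and> (\<forall>v\<in>set vs. norm v \<le> 1)}"
  then have "\<bar>A vs\<bar> \<le> C * prod_list (map norm vs)" using assms(1) by simp
  also have "\<dots> \<le> C * 1" using vs assms(2) by (intro mult_left_mono prod_list_norm_le_1) auto
  finally show "\<bar>A vs\<bar> \<le> C" by simp
qed

text \<open>
  Homogeneity in all arguments at once. Together with the supremum over the unit ball it gives the
  usual estimate \<open>le_nrm_Mult\<close>; arguments \<open>0\<close>, which cannot be normalised, are covered there by the
  bound contained in the definition of the carrier.
\<close>

lemma multilinear_scale_args:
  fixes A :: "'a::real_normed_vector list \<Rightarrow> real"
  assumes "\<And>vs j u w c. length vs = n \<Longrightarrow> j < n \<Longrightarrow>
      A (vs[j := c *\<^sub>R u + w]) = c * A (vs[j := u]) + A (vs[j := w])"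
    and "length vs = n"
  shows "A (map (\<lambda>v. g v *\<^sub>R v) vs) = prod_list (map g vs) * A vs"
  using assms
proof (induction vs arbitrary: A n)
  case (Cons v vs)
  obtain m where n: "n = Suc m" "length vs = m" using Cons.prems(2) by auto
  let ?ws = "map (\<lambda>v. g v *\<^sub>R v) vs"
  have head: "A ((c *\<^sub>R u + w) # ?ws) = c * A (u # ?ws) + A (w # ?ws)" for c u w
    using Cons.prems(1)[of "v # ?ws" 0 c u w] n by simp
  \<comment> \<open>Additivity alone forces the value at a zero argument to vanish.\<close>
  have "A (0 # ?ws) = 0" using head[of 1 0 0] by simp
  then have "A (g v *\<^sub>R v # ?ws) = g v * A (v # ?ws)" using head[of "g v" v 0] by simp
  moreover have "A (v # ?ws) = prod_list (map g vs) * A (v # vs)"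
  proof (rule Cons.IH[of m "\<lambda>ws. A (v # ws)"])
    fix vs :: "'a list" and j u w c assume "length vs = m" "j < m"
    then show "A (v # vs[j := c *\<^sub>R u + w]) = c * A (v # vs[j := u]) + A (v # vs[j := w])"
      using Cons.prems(1)[of "v # vs" "Suc j" c u w] n by simp
  qed (use n in simp)
  ultimately show ?case by simp
qed simp

lemma bdd_above_Mult:
  assumes "A \<in> carr (Mult i)"
  shows "bdd_above ((\<lambda>vs. \<bar>A vs\<bar>) ` {vs. length vs = i \<and> (\<forall>v\<in>set vs. norm v \<le> 1)})"
proof -
  obtain C where C: "\<And>vs. length vs = i \<Longrightarrow> \<bar>A vs\<bar> \<le> C * prod_list (map norm vs)"
    using carr_MultD(3)[OF assms] by blast
  show ?thesis
  proof (rule bdd_aboveI2)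
    fix vs :: "'a list" assume vs: "vs \<in> {vs. length vs = i \<and> (\<forall>v\<in>set vs. norm v \<le> 1)}"
    then have "\<bar>A vs\<bar> \<le> C * prod_list (map norm vs)" using C by simp
    also have "\<dots> \<le> \<bar>C\<bar> * prod_list (map norm vs)"
      using prod_list_norm_nonneg by (intro mult_right_mono) auto
    also have "\<dots> \<le> \<bar>C\<bar> * 1" using vs by (intro mult_left_mono prod_list_norm_le_1) auto
    finally show "\<bar>A vs\<bar> \<le> \<bar>C\<bar>" by simp
  qed
qed

lemma le_nrm_Mult:
  fixes A :: "'a::real_normed_vector list \<Rightarrow> real"
  assumes A: "A \<in> carr (Mult i)" and vs: "length vs = i"
  shows "\<bar>A vs\<bar> \<le> nrm (Mult i) A * prod_list (map norm vs)"
proof -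
  have multi: "\<And>vs j u w c. length vs = i \<Longrightarrow> j < i \<Longrightarrow>
      A (vs[j := c *\<^sub>R u + w]) = c * A (vs[j := u]) + A (vs[j := w])"
    and "\<exists>C. \<forall>vs. length vs = i \<longrightarrow> \<bar>A vs\<bar> \<le> C * prod_list (map norm vs)"
    using A unfolding carr_Mult_iff by blast+
  then obtain C where C: "\<And>vs. length vs = i \<Longrightarrow> \<bar>A vs\<bar> \<le> C * prod_list (map norm vs)" by blast
  show ?thesis
  proof (cases "0 \<in> set vs")
    case True
    then have "prod_list (map norm vs) = 0" by (simp add: prod_list_zero_iff)
    then show ?thesis using C[OF vs] by simp
  next
    case False
    let ?g = "\<lambda>v::'a. inverse (norm v)"
    let ?ws = "map (\<lambda>v. ?g v *\<^sub>R v) vs"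
    note bdd = bdd_above_Mult[OF A]
    have "?ws \<in> {vs. length vs = i \<and> (\<forall>v\<in>set vs. norm v \<le> 1)}"
    proof -
      have "norm (?g v *\<^sub>R v) \<le> 1" if "v \<in> set vs" for v
        using that False by (cases "v = 0") auto
      then show ?thesis using vs by auto
    qed
    then have le: "\<bar>A ?ws\<bar> \<le> nrm (Mult i) A" unfolding nrm_Mult using bdd by (rule cSUP_upper)
    have inv: "prod_list (map ?g vs) = inverse (prod_list (map norm vs))"
      by (induction vs) auto
    have pos: "prod_list (map norm vs) > 0" using False by (induction vs) auto
    have "A ?ws = inverse (prod_list (map norm vs)) * A vs"
      using multilinear_scale_args[of i A vs ?g] multi vs inv by simp
    then have "\<bar>A ?ws\<bar> * prod_list (map norm vs) = \<bar>A vs\<bar>" using pos by (simp add: abs_mult)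
    then show ?thesis using mult_right_mono[OF le, of "prod_list (map norm vs)"] pos by simp
  qed
qed

lemma nrm_Mult_nonneg:
  assumes "A \<in> carr (Mult i)"
  shows "0 \<le> nrm (Mult i) (A :: 'a::real_normed_vector list \<Rightarrow> real)"
proof -
  have "\<bar>A (replicate i 0)\<bar> \<le> nrm (Mult i) A"
    unfolding nrm_Mult by (rule cSUP_upper[OF _ bdd_above_Mult[OF assms]]) simp
  then show ?thesis by linarith
qed

lemma Mult_zero: "(0 :: 'a::real_normed_vector list \<Rightarrow> real) \<in> carr (Mult i)"
  unfolding carr_Mult_iff by (auto intro: exI[of _ 0])

lemma Mult_add:
  assumes A: "A \<in> carr (Mult i)" and B: "B \<in> carr (Mult i)"
  shows "A + B \<in> carr (Mult i)"
proof (rule carr_MultI[where C = "nrm (Mult i) A + nrm (Mult i) B"])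
  fix vs :: "'a list" assume l: "length vs = i"
  show "\<bar>(A + B) vs\<bar> \<le> (nrm (Mult i) A + nrm (Mult i) B) * prod_list (map norm vs)"
    using le_nrm_Mult[OF A l] le_nrm_Mult[OF B l] by (simp add: algebra_simps)
qed (use carr_MultD(1,2)[OF A] carr_MultD(1,2)[OF B] in \<open>auto simp: algebra_simps\<close>)

lemma Mult_scale:
  assumes A: "A \<in> carr (Mult i)"
  shows "c *\<^sub>R A \<in> carr (Mult i)"
proof (rule carr_MultI[where C = "\<bar>c\<bar> * nrm (Mult i) A"])
  fix vs :: "'a list" assume l: "length vs = i"
  show "\<bar>(c *\<^sub>R A) vs\<bar> \<le> \<bar>c\<bar> * nrm (Mult i) A * prod_list (map norm vs)"
    using mult_left_mono[OF le_nrm_Mult[OF A l], of "\<bar>c\<bar>"]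
    by (simp add: scaleR_fun_def abs_mult mult.assoc)
qed (use carr_MultD(1,2)[OF A] in \<open>auto simp: algebra_simps scaleR_fun_def\<close>)

lemma normed_nspace_Mult: "normed_nspace (Mult i :: ('a::real_normed_vector list \<Rightarrow> real) nspace)"
proof (rule normed_nspaceI)
  fix A B :: "'a list \<Rightarrow> real" and c :: real assume A: "A \<in> carr (Mult i)"
  show "c *\<^sub>R A \<in> carr (Mult i)" by (rule Mult_scale[OF A])
  show "nrm (Mult i) (c *\<^sub>R A) \<le> \<bar>c\<bar> * nrm (Mult i) A"
  proof (rule nrm_Mult_le)
    fix vs :: "'a list" assume "length vs = i"
    from mult_left_mono[OF le_nrm_Mult[OF A this], of "\<bar>c\<bar>"]
    show "\<bar>(c *\<^sub>R A) vs\<bar> \<le> \<bar>c\<bar> * nrm (Mult i) A * prod_list (map norm vs)"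
      by (simp add: scaleR_fun_def abs_mult mult.assoc)
  qed (use nrm_Mult_nonneg[OF A] in auto)
  show "A = 0" if "nrm (Mult i) A = 0"
  proof
    fix vs show "A vs = 0 vs"
      using le_nrm_Mult[OF A, of vs] that A by (cases "length vs = i") (auto simp: carr_Mult_iff)
  qed
  assume B: "B \<in> carr (Mult i)"
  show "A + B \<in> carr (Mult i)" by (rule Mult_add[OF A B])
  show "nrm (Mult i) (A + B) \<le> nrm (Mult i) A + nrm (Mult i) B"
  proof (rule nrm_Mult_le)
    fix vs :: "'a list" assume "length vs = i"
    from le_nrm_Mult[OF A this] le_nrm_Mult[OF B this]
    show "\<bar>(A + B) vs\<bar> \<le> (nrm (Mult i) A + nrm (Mult i) B) * prod_list (map norm vs)"
      by (simp add: algebra_simps)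
  qed (use nrm_Mult_nonneg[OF A] nrm_Mult_nonneg[OF B] in auto)
qed (rule Mult_zero)

section \<open>Jet fields are the fields of iterated derivatives\<close>

text \<open>
  The part of order \<open>i\<close> of a jet, an element of \<open>L(X\<^sup>i; \<real>)\<close> once the jet is multilinear.
\<close>

definition level :: "nat \<Rightarrow> ('a list \<Rightarrow> real) \<Rightarrow> 'a list \<Rightarrow> real" where
  "level i A = (\<lambda>vs. if length vs = i then A vs else 0)"

lemma level_mem:
  assumes "jet_multilinear n A" "jet_bounded n C A" "i < n"
  shows "level i A \<in> carr (Mult i)"
  using jet_multilinearD[OF assms(1)] jet_boundedD[OF assms(2)] assms(3)
  by (intro carr_MultI[where C = C]) (auto simp: level_def)

lemma nrm_level_le:
  assumes "jet_bounded n C A" "i < n"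
  shows "nrm (Mult i) (level i A) \<le> C"
  using jet_boundedD[OF assms(1)] jet_bounded_nonneg[OF assms(1)] assms(2)
  by (intro nrm_Mult_le) (auto simp: level_def)

lemma eventually_nhds_norm:
  assumes "open B" "x \<in> B"
  shows "(\<forall>\<^sub>F y in nhds x. P y) \<longleftrightarrow> (\<exists>d>0. \<forall>y\<in>B. norm (y - x) < d \<longrightarrow> P y)"
proof
  assume "\<forall>\<^sub>F y in nhds x. P y"
  then show "\<exists>d>0. \<forall>y\<in>B. norm (y - x) < d \<longrightarrow> P y" unfolding eventually_nhds_metric dist_norm by blast
next
  assume "\<exists>d>0. \<forall>y\<in>B. norm (y - x) < d \<longrightarrow> P y"
  then obtain d where "d > 0" "\<forall>y\<in>B. norm (y - x) < d \<longrightarrow> P y" by blast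
  then have "\<forall>\<^sub>F y in nhds x. y \<in> B \<longrightarrow> P y" unfolding eventually_nhds_metric dist_norm by blast
  with eventually_nhds_in_open[OF assms] show "\<forall>\<^sub>F y in nhds x. P y" by eventually_elim simp
qed

lemma jet_multilinear_head_add:
  assumes "jet_multilinear n A" "Suc (length vs) < n"
  shows "A ((u + w) # vs) = A (u # vs) + A (w # vs)"
  using jet_multilinear_head[OF assms, of 1 u w] by simp

lemma jet_multilinear_head_scale:
  assumes "jet_multilinear n A" "Suc (length vs) < n"
  shows "A ((c *\<^sub>R u) # vs) = c * A (u # vs)"
  using jet_multilinear_head[OF assms, of c u 0] jet_multilinear_head[OF assms, of 1 0 0] by simp

lemma is_jet_has_fderiv:
  fixes A :: "'a::real_normed_vector \<Rightarrow> 'a list \<Rightarrow> real"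
  assumes "open B" and A: "is_jet B k f A" and i: "i < k" and x: "x \<in> B"
  shows "has_fderiv type_space (Mult i) B (\<lambda>y. level i (A y)) (\<lambda>h. level i (\<lambda>vs. A x (h # vs))) x"
  unfolding has_fderiv_def
proof (intro conjI allI impI)
  note D = is_jetD[OF A x]
  obtain C where C: "jet_bounded (Suc k) C (A x)" using D(3) by blast
  show "x \<in> B" by fact
  show "(\<lambda>y. level i (A y)) ` B \<subseteq> carr (Mult i)"
    using is_jetD(2,3)[OF A] i by (fastforce intro: level_mem)
  show "bounded_linear_map type_space (Mult i) (\<lambda>h. level i (\<lambda>vs. A x (h # vs)))"
  proof (rule bounded_linear_mapI[where C = C])
    fix u w :: 'a and c :: real
    show "level i (\<lambda>vs. A x (u # vs)) \<in> carr (Mult i)"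
      by (rule level_mem[OF jet_multilinear_slot[OF D(2)] jet_bounded_slot[OF C] i])
    show "level i (\<lambda>vs. A x ((u + w) # vs)) = level i (\<lambda>vs. A x (u # vs)) + level i (\<lambda>vs. A x (w # vs))"
      using jet_multilinear_head_add[OF D(2)] i by (auto simp: level_def fun_eq_iff)
    show "level i (\<lambda>vs. A x ((c *\<^sub>R u) # vs)) = c *\<^sub>R level i (\<lambda>vs. A x (u # vs))"
      using jet_multilinear_head_scale[OF D(2)] i by (auto simp: level_def fun_eq_iff scaleR_fun_def)
    show "nrm (Mult i) (level i (\<lambda>vs. A x (u # vs))) \<le> C * nrm type_space u"
      using nrm_level_le[OF jet_bounded_slot[OF C, of u] i] by (simp add: type_space_def)
  qed
  fix e :: real assume e: "e > 0"
  have "\<forall>\<^sub>F y in nhds x. nrm (Mult i) (level i (A y) - level i (A x) - level i (\<lambda>vs. A x ((y - x) # vs)))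
      \<le> e * norm (y - x)"
    using D(4)[OF e]
  proof eventually_elim
    case (elim y)
    have "level i (A y) - level i (A x) - level i (\<lambda>vs. A x ((y - x) # vs)) =
      level i (\<lambda>vs. A y vs - A x vs - A x ((y - x) # vs))" by (auto simp: level_def fun_eq_iff)
    then show ?case using nrm_level_le[OF elim i] by simp
  qed
  then show "\<exists>d>0. \<forall>y\<in>B. nrm type_space (y - x) < d \<longrightarrow>
     nrm (Mult i) (level i (A y) - level i (A x) - level i (\<lambda>vs. A x ((y - x) # vs))) \<le> e * nrm type_space (y - x)"
    unfolding eventually_nhds_norm[OF assms(1) x] by (simp add: type_space_def)
qed

lemma is_jet_cont_map:
  fixes A :: "'a::real_normed_vector \<Rightarrow> 'a list \<Rightarrow> real"
  assumes "open B" and A: "is_jet B k f A" and i: "i \<le> k"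
  shows "cont_map type_space (Mult i) B (\<lambda>y. level i (A y))"
  unfolding cont_map_def
proof (intro conjI ballI allI impI)
  show "(\<lambda>y. level i (A y)) ` B \<subseteq> carr (Mult i)"
    using is_jetD(2,3)[OF A] i by (fastforce intro: level_mem)
  fix x and e :: real assume x: "x \<in> B" and "e > 0"
  then have e: "e / 2 > 0" by simp
  have "\<forall>\<^sub>F y in nhds x. nrm (Mult i) (level i (A y) - level i (A x)) < e"
    using is_jetD(5)[OF A x e]
  proof eventually_elim
    case (elim y)
    have "level i (A y) - level i (A x) = level i (\<lambda>vs. A y vs - A x vs)"
      by (auto simp: level_def fun_eq_iff)
    then show ?case using nrm_level_le[OF elim, of i] i e by simp
  qed
  then show "\<exists>d>0. \<forall>y\<in>B. nrm type_space (y - x) < d \<longrightarrow> nrm (Mult i) (level i (A y) - level i (A x)) < e"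
    unfolding eventually_nhds_norm[OF assms(1) x] by (simp add: type_space_def)
qed

lemma open_segment_in:
  fixes x :: "'a::real_normed_vector"
  assumes "open B" "x \<in> B"
  obtains t0 where "t0 > 0" "\<And>t. 0 < t \<Longrightarrow> t < t0 \<Longrightarrow> x + t *\<^sub>R u \<in> B"
proof -
  obtain r where r: "r > 0" "ball x r \<subseteq> B" using assms open_contains_ball by blast
  show ?thesis
  proof (rule that[of "r / (norm u + 1)"])
    show "r / (norm u + 1) > 0" using r by (simp add: add_nonneg_pos)
    fix t assume t: "0 < t" "t < r / (norm u + 1)"
    have "t * norm u \<le> t * (norm u + 1)" using t by simp
    also have "\<dots> < r" using t(2) by (subst (asm) pos_less_divide_eq) (simp_all add: add_nonneg_pos)
    finally have "x + t *\<^sub>R u \<in> ball x r" using t by (simp add: dist_norm)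
    then show "x + t *\<^sub>R u \<in> B" using r by blast
  qed
qed

text \<open>
  Derivatives on an open set are unique, so a jet field is determined by the function: its levels
  are the iterated derivatives.
\<close>

lemma nth_fderiv_eq_level:
  fixes A :: "'a::real_normed_vector \<Rightarrow> 'a list \<Rightarrow> real"
  assumes "open B" and A: "is_jet B k f A"
  shows "i \<le> k \<Longrightarrow> x \<in> B \<Longrightarrow> deriv_on B f i x = level i (A x)"
proof (induction i arbitrary: x)
  case 0
  then show ?case using is_jetD(1)[OF A] by (auto simp: level_def fun_eq_iff)
next
  case (Suc i)
  have IH: "deriv_on B f i y = level i (A y)" if "y \<in> B" for y by (rule Suc.IH) (use Suc that in auto)
  have i: "i < k" using Suc by simp
  show ?case
  proof
    fix vs
    show "deriv_on B f (Suc i) x vs = level (Suc i) (A x) vs"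
    proof (cases vs)
      case (Cons h ws)
      obtain t0 where t0: "t0 > 0" "\<And>t. 0 < t \<Longrightarrow> t < t0 \<Longrightarrow> x + t *\<^sub>R h \<in> B"
        using open_segment_in[OF assms(1) Suc.prems(2)] by blast
      have "fderiv type_space (Mult i) B (deriv_on B f i) x h = fderiv type_space (Mult i) B (\<lambda>y. level i (A y)) x h"
        by (rule fderiv_cong) (rule IH)
      also have "\<dots> = level i (\<lambda>vs. A x (h # vs))"
        by (rule fderiv_eq[OF normed_nspace_type_space normed_nspace_Mult
              is_jet_has_fderiv[OF assms(1) A i Suc.prems(2)] _ t0]) (simp_all add: type_space_def)
      finally show ?thesis using Cons by (simp add: level_def type_space_def)
    qed (simp add: level_def)
  qed
qed

lemma C_map_if_is_jet:
  fixes A :: "'a::real_normed_vector \<Rightarrow> 'a list \<Rightarrow> real"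
  assumes "open B" and A: "is_jet B k f A"
  shows "C_map type_space type_space B k f"
  unfolding C_map_def
proof (intro conjI allI impI ballI)
  note eq = nth_fderiv_eq_level[OF assms]
  fix i x assume i: "i < k" and x: "x \<in> B"
  show "fdifferentiable type_space (Mult i) B (deriv_on B f i) x"
    unfolding fdifferentiable_def
    by (rule exI, rule has_fderiv_cong[OF is_jet_has_fderiv[OF assms i x]]) (use eq i in simp)
next
  note eq = nth_fderiv_eq_level[OF assms]
  fix i assume i: "i \<le> k"
  have "(deriv_on B f i) ` B = (\<lambda>y. level i (A y)) ` B"
    by (rule image_cong) (use eq i in auto)
  then show "cont_map type_space (Mult i) B (deriv_on B f i)"
    using is_jet_cont_map[OF assms i] eq[OF i] unfolding cont_map_def by simp
qed

definition jet :: "'a::real_normed_vector set \<Rightarrow> ('a \<Rightarrow> real) \<Rightarrow> 'a \<Rightarrow> 'a list \<Rightarrow> real" where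
  "jet B f = (\<lambda>x vs. deriv_on B f (length vs) x vs)"

text \<open>
  Conversely, iterated derivatives form a jet field: the estimates at the finitely many orders up to
  \<open>k\<close> hold simultaneously near each point.
\<close>

lemma is_jet_jet:
  fixes f :: "'a::real_normed_vector \<Rightarrow> real"
  assumes B: "open B" and f: "C_map type_space type_space B k f"
  shows "is_jet B k f (jet B f)"
  unfolding is_jet_def
proof (intro ballI conjI allI impI)
  let ?D = "deriv_on B f"
  have mem: "?D i x \<in> carr (Mult i)" if "i \<le> k" "x \<in> B" for i x
    using f that unfolding C_map_def cont_map_def by blast
  fix x assume x: "x \<in> B"
  show "jet B f x [] = f x" by (simp add: jet_def)
  show "jet_multilinear (Suc k) (jet B f x)"
    using mem[OF _ x] unfolding jet_multilinear_def jet_def carr_Mult_iff by auto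
  show "\<exists>C. jet_bounded (Suc k) C (jet B f x)"
  proof (intro exI)
    show "jet_bounded (Suc k) (\<Sum>i\<le>k. nrm (Mult i) (?D i x)) (jet B f x)"
      unfolding jet_bounded_def
    proof (intro allI impI)
      fix vs :: "'a list" assume "length vs < Suc k"
      then have l: "length vs \<le> k" by simp
      have "\<bar>?D (length vs) x vs\<bar> \<le> nrm (Mult (length vs)) (?D (length vs) x) * prod_list (map norm vs)"
        by (rule le_nrm_Mult[OF mem[OF l x] refl])
      also have "\<dots> \<le> (\<Sum>i\<le>k. nrm (Mult i) (?D i x)) * prod_list (map norm vs)"
        using l nrm_Mult_nonneg mem[OF _ x]
        by (intro mult_right_mono member_le_sum prod_list_norm_nonneg) auto
      finally show "\<bar>jet B f x vs\<bar> \<le> (\<Sum>i\<le>k. nrm (Mult i) (?D i x)) * prod_list (map norm vs)"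
        by (simp add: jet_def)
    qed
  qed
  fix e :: real assume e: "e > 0"
  have one: "\<forall>\<^sub>F y in nhds x. \<forall>vs. length vs = i \<longrightarrow>
      \<bar>?D i y vs - ?D i x vs - ?D (Suc i) x ((y - x) # vs)\<bar> \<le> e * norm (y - x) * prod_list (map norm vs)"
    if i: "i < k" for i
  proof -
    obtain L where L: "has_fderiv type_space (Mult i) B (?D i) L x"
      using f i x unfolding C_map_def fdifferentiable_def by blast
    have D: "?D (Suc i) x (h # vs) = L h vs" for h vs
    proof -
      obtain t0 where t0: "t0 > 0" "\<And>t. 0 < t \<Longrightarrow> t < t0 \<Longrightarrow> x + t *\<^sub>R h \<in> B"
        using open_segment_in[OF B x] by blast
      have "fderiv type_space (Mult i) B (?D i) x h = L h"
        by (rule fderiv_eq[OF normed_nspace_type_space normed_nspace_Mult L _ t0])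
          (simp_all add: type_space_def)
      then show ?thesis by (simp add: type_space_def)
    qed
    interpret M: normed_nspace "Mult i" by (rule normed_nspace_Mult)
    have "\<forall>\<^sub>F y in nhds x. nrm (Mult i) (?D i y - ?D i x - L (y - x)) \<le> e * norm (y - x)"
      using has_fderivD(4)[OF L e] unfolding eventually_nhds_norm[OF B x] by (simp add: type_space_def)
    then show ?thesis using eventually_nhds_in_open[OF B x]
    proof eventually_elim
      case (elim y)
      have m: "?D i y - ?D i x - L (y - x) \<in> carr (Mult i)"
        using bounded_linear_mapD(1)[OF has_fderivD(3)[OF L], of "y - x"] mem i x elim(2)
        by (intro M.diff_mem) (auto simp: type_space_def)
      show ?case
      proof (intro allI impI)
        fix vs :: "'a list" assume "length vs = i"
        from le_nrm_Mult[OF m this]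
        have "\<bar>?D i y vs - ?D i x vs - L (y - x) vs\<bar> \<le>
          nrm (Mult i) (?D i y - ?D i x - L (y - x)) * prod_list (map norm vs)" by simp
        also have "\<dots> \<le> e * norm (y - x) * prod_list (map norm vs)"
          by (rule mult_right_mono[OF elim(1) prod_list_norm_nonneg])
        finally show "\<bar>?D i y vs - ?D i x vs - ?D (Suc i) x ((y - x) # vs)\<bar> \<le> e * norm (y - x) * prod_list (map norm vs)"
          unfolding D .
      qed
    qed
  qed
  have "\<forall>\<^sub>F y in nhds x. \<forall>i\<in>{..<k}. \<forall>vs. length vs = i \<longrightarrow>
      \<bar>?D i y vs - ?D i x vs - ?D (Suc i) x ((y - x) # vs)\<bar> \<le> e * norm (y - x) * prod_list (map norm vs)"
    by (rule eventually_ball_finite) (use one in auto)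
  then show "\<forall>\<^sub>F y in nhds x. jet_bounded k (e * norm (y - x)) (\<lambda>vs. jet B f y vs - jet B f x vs - jet B f x ((y - x) # vs))"
    by eventually_elim (simp add: jet_bounded_def jet_def del: nth_fderiv.simps)
  have two: "\<forall>\<^sub>F y in nhds x. \<forall>vs. length vs = i \<longrightarrow> \<bar>?D i y vs - ?D i x vs\<bar> \<le> e * prod_list (map norm vs)"
    if i: "i \<le> k" for i
  proof -
    interpret M: normed_nspace "Mult i" by (rule normed_nspace_Mult)
    have "\<forall>\<^sub>F y in nhds x. nrm (Mult i) (?D i y - ?D i x) < e"
      using f i x e unfolding C_map_def cont_map_def eventually_nhds_norm[OF B x] type_space_def by simp
    then show ?thesis using eventually_nhds_in_open[OF B x]
    proof eventually_elim
      case (elim y)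
      have m: "?D i y - ?D i x \<in> carr (Mult i)" using mem i x elim(2) by (intro M.diff_mem) auto
      show ?case
      proof (intro allI impI)
        fix vs :: "'a list" assume "length vs = i"
        from le_nrm_Mult[OF m this]
        have "\<bar>?D i y vs - ?D i x vs\<bar> \<le> nrm (Mult i) (?D i y - ?D i x) * prod_list (map norm vs)" by simp
        also have "\<dots> \<le> e * prod_list (map norm vs)"
          using elim(1) by (intro mult_right_mono prod_list_norm_nonneg) simp
        finally show "\<bar>?D i y vs - ?D i x vs\<bar> \<le> e * prod_list (map norm vs)" .
      qed
    qed
  qed
  have "\<forall>\<^sub>F y in nhds x. \<forall>i\<in>{..k}. \<forall>vs. length vs = i \<longrightarrow> \<bar>?D i y vs - ?D i x vs\<bar> \<le> e * prod_list (map norm vs)"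
    by (rule eventually_ball_finite) (use two in auto)
  then show "\<forall>\<^sub>F y in nhds x. jet_bounded (Suc k) e (\<lambda>vs. jet B f y vs - jet B f x vs)"
    by eventually_elim (simp add: jet_bounded_def jet_def del: nth_fderiv.simps)
qed

section \<open>The normed algebra of bounded functions with bounded derivatives\<close>

text \<open>
  Membership in \<open>C\<^sub>b\<^sup>k(B)\<close> and estimates of its norm are derived from a jet field with a uniform
  bound. By \<open>nrm_Cb_le\<close> and \<open>jet_bounded_nrm_Cb\<close> the norm agrees with the best such bound up to the
  factor \<open>k + 1\<close>.
\<close>

lemma carr_CbI:
  fixes a :: "'a::real_normed_vector \<Rightarrow> real"
  assumes B: "open B" and "\<And>x. x \<notin> B \<Longrightarrow> a x = 0"
    and A: "is_jet B k a A" and C: "\<And>x. x \<in> B \<Longrightarrow> jet_bounded (Suc k) C (A x)"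
  shows "a \<in> carr (Cb k B)"
proof -
  have "bdd_above ((\<lambda>x. \<bar>a x\<bar>) ` B)"
    using C is_jetD(1)[OF A] by (intro bdd_aboveI2[where M = C]) (auto simp: jet_bounded_Suc_iff)
  moreover have "bdd_above ((\<lambda>x. op_norm i (deriv_on B a i x)) ` B)" if "i \<in> {1..k}" for i
  proof (rule bdd_aboveI2)
    fix x assume x: "x \<in> B"
    have i: "i \<le> k" "i < Suc k" using that by auto
    show "op_norm i (deriv_on B a i x) \<le> C"
      unfolding nth_fderiv_eq_level[OF B A i(1) x] by (rule nrm_level_le[OF C[OF x] i(2)])
  qed
  ultimately show ?thesis
    using assms(2) C_map_if_is_jet[OF B A] unfolding Cb_def by simp
qed

lemma carr_CbD:
  assumes "a \<in> carr (Cb k B)"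
  shows "x \<notin> B \<Longrightarrow> a x = 0" "C_map type_space type_space B k a" "bdd_above ((\<lambda>x. \<bar>a x\<bar>) ` B)"
    and "1 \<le> i \<Longrightarrow> i \<le> k \<Longrightarrow> bdd_above ((\<lambda>x. op_norm i (deriv_on B a i x)) ` B)"
  using assms unfolding Cb_def by auto

lemma nrm_Cb: "nrm (Cb k B) a = (SUP x\<in>B. \<bar>a x\<bar>) + (\<Sum>i=1..k. SUP x\<in>B. op_norm i (deriv_on B a i x))"
  by (simp add: Cb_def)

lemma nrm_Cb_le:
  fixes a :: "'a::real_normed_vector \<Rightarrow> real"
  assumes B: "open B" "B \<noteq> {}"
    and A: "is_jet B k a A" and C: "\<And>x. x \<in> B \<Longrightarrow> jet_bounded (Suc k) C (A x)"
  shows "nrm (Cb k B) a \<le> (real k + 1) * C"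
proof -
  have "(SUP x\<in>B. \<bar>a x\<bar>) \<le> C"
    using C is_jetD(1)[OF A] B by (intro cSUP_least) (auto simp: jet_bounded_Suc_iff)
  moreover have "(SUP x\<in>B. op_norm i (deriv_on B a i x)) \<le> C" if "i \<in> {1..k}" for i
  proof (rule cSUP_least[OF B(2)])
    fix x assume x: "x \<in> B"
    have i: "i \<le> k" "i < Suc k" using that by auto
    show "op_norm i (deriv_on B a i x) \<le> C"
      unfolding nth_fderiv_eq_level[OF B(1) A i(1) x] by (rule nrm_level_le[OF C[OF x] i(2)])
  qed
  then have "(\<Sum>i=1..k. SUP x\<in>B. op_norm i (deriv_on B a i x)) \<le> (\<Sum>i=1..k. C)"
    by (rule sum_mono)
  ultimately show ?thesis unfolding nrm_Cb by (simp add: algebra_simps)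
qed

lemma deriv_on_mem_Mult:
  fixes a :: "'a::real_normed_vector \<Rightarrow> real"
  assumes "a \<in> carr (Cb k B)" "i \<le> k" "x \<in> B"
  shows "deriv_on B a i x \<in> carr (Mult i)"
  using carr_CbD(2)[OF assms(1)] assms(2,3) unfolding C_map_def cont_map_def by blast

lemma SUP_nonneg: "bdd_above (f ` B) \<Longrightarrow> B \<noteq> {} \<Longrightarrow> (\<And>x. x \<in> B \<Longrightarrow> 0 \<le> f x) \<Longrightarrow> 0 \<le> (SUP x\<in>B. f x :: real)"
  by (meson cSUP_upper2 ex_in_conv)

lemma jet_bounded_nrm_Cb:
  fixes a :: "'a::real_normed_vector \<Rightarrow> real"
  assumes B: "B \<noteq> {}" and a: "a \<in> carr (Cb k B)" and x: "x \<in> B"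
  shows "jet_bounded (Suc k) (nrm (Cb k B) a) (jet B a x)"
  unfolding jet_bounded_def
proof (intro allI impI)
  fix vs :: "'a list" assume l: "length vs < Suc k"
  let ?S = "\<lambda>i. SUP x\<in>B. op_norm i (deriv_on B a i x)"
  have S: "0 \<le> ?S i" if "i \<in> {1..k}" for i
  proof (rule SUP_nonneg[OF _ B])
    show "bdd_above ((\<lambda>x. op_norm i (deriv_on B a i x)) ` B)" using that by (intro carr_CbD(4)[OF a]) auto
    show "0 \<le> op_norm i (deriv_on B a i x)" if "x \<in> B" for x
      using \<open>i \<in> {1..k}\<close> that by (intro nrm_Mult_nonneg deriv_on_mem_Mult[OF a]) auto
  qed
  have S0: "0 \<le> (SUP x\<in>B. \<bar>a x\<bar>)" by (intro SUP_nonneg carr_CbD(3)[OF a] B) simp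
  show "\<bar>jet B a x vs\<bar> \<le> nrm (Cb k B) a * prod_list (map norm vs)"
  proof (cases vs)
    case Nil
    have "\<bar>a x\<bar> \<le> (SUP x\<in>B. \<bar>a x\<bar>)" by (rule cSUP_upper[OF x carr_CbD(3)[OF a]])
    also have "\<dots> \<le> nrm (Cb k B) a" using sum_nonneg[of "{1..k}" ?S, OF S] unfolding nrm_Cb by simp
    finally show ?thesis using Nil by (simp add: jet_def)
  next
    case (Cons v ws)
    define i where "i = length vs"
    have i: "i \<in> {1..k}" "1 \<le> i" "i \<le> k" using l Cons by (auto simp: i_def)
    have "\<bar>deriv_on B a i x vs\<bar> \<le> op_norm i (deriv_on B a i x) * prod_list (map norm vs)"
      by (rule le_nrm_Mult[OF deriv_on_mem_Mult[OF a i(3) x]]) (simp add: i_def)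
    also have "\<dots> \<le> ?S i * prod_list (map norm vs)"
      by (rule mult_right_mono[OF cSUP_upper[OF x carr_CbD(4)[OF a i(2,3)]] prod_list_norm_nonneg])
    also have "\<dots> \<le> nrm (Cb k B) a * prod_list (map norm vs)"
    proof (rule mult_right_mono[OF _ prod_list_norm_nonneg])
      have "?S i \<le> (\<Sum>i=1..k. ?S i)" by (rule member_le_sum) (use i S in auto)
      then show "?S i \<le> nrm (Cb k B) a" unfolding nrm_Cb using S0 by simp
    qed
    finally show ?thesis by (simp add: jet_def i_def)
  qed
qed

lemma abs_le_nrm_Cb:
  assumes "B \<noteq> {}" "a \<in> carr (Cb k B)"
  shows "\<bar>a x\<bar> \<le> nrm (Cb k B) a"
proof (cases "x \<in> B")
  case True
  then show ?thesis using jet_bounded_nrm_Cb[OF assms True] by (simp add: jet_bounded_Suc_iff jet_def)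
next
  case False
  obtain y where "y \<in> B" using assms(1) by blast
  then show ?thesis using carr_CbD(1)[OF assms(2) False] jet_bounded_nonneg[OF jet_bounded_nrm_Cb[OF assms]] by simp
qed

lemma is_jet_Cb: "open B \<Longrightarrow> a \<in> carr (Cb k B) \<Longrightarrow> is_jet B k a (jet B a)"
  by (intro is_jet_jet carr_CbD(2))

lemma Cb_zero: "open B \<Longrightarrow> (0 :: 'a::real_normed_vector \<Rightarrow> real) \<in> carr (Cb k B)"
  using carr_CbI[of B 0 k "\<lambda>_. const_jet 0" 0] is_jet_const[of B k 0] jet_bounded_const[of "Suc k" 0]
  by (simp add: zero_fun_def)

lemma Cb_add:
  fixes a b :: "'a::real_normed_vector \<Rightarrow> real"
  assumes B: "open B" "B \<noteq> {}" and a: "a \<in> carr (Cb k B)" and b: "b \<in> carr (Cb k B)"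
  shows "a + b \<in> carr (Cb k B)"
  by (rule carr_CbI[OF B(1) _ is_jet_cong[OF is_jet_add[OF is_jet_Cb[OF B(1) a] is_jet_Cb[OF B(1) b]]]
        jet_bounded_add[OF jet_bounded_nrm_Cb[OF B(2) a] jet_bounded_nrm_Cb[OF B(2) b]]])
    (use carr_CbD(1)[OF a] carr_CbD(1)[OF b] in auto)

lemma Cb_scale:
  fixes a :: "'a::real_normed_vector \<Rightarrow> real"
  assumes B: "open B" "B \<noteq> {}" and a: "a \<in> carr (Cb k B)"
  shows "c *\<^sub>R a \<in> carr (Cb k B)"
  by (rule carr_CbI[OF B(1) _ is_jet_cong[OF is_jet_scale[OF is_jet_Cb[OF B(1) a]]]
        jet_bounded_scale[OF jet_bounded_nrm_Cb[OF B(2) a]]])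
    (use carr_CbD(1)[OF a] in \<open>auto simp: scaleR_fun_def\<close>)

lemma nrm_Cb_mono_parts:
  fixes a :: "'a::real_normed_vector \<Rightarrow> real"
  assumes B: "B \<noteq> {}"
    and "\<And>x. x \<in> B \<Longrightarrow> \<bar>a x\<bar> \<le> S0"
    and "\<And>i x. i \<in> {1..k} \<Longrightarrow> x \<in> B \<Longrightarrow> op_norm i (deriv_on B a i x) \<le> S i"
  shows "nrm (Cb k B) a \<le> S0 + (\<Sum>i=1..k. S i)"
  unfolding nrm_Cb by (intro add_mono sum_mono cSUP_least[OF B] assms)

lemma normed_nspace_Cb:
  fixes B :: "'a::real_normed_vector set"
  assumes B: "open B" "B \<noteq> {}"
  shows "normed_nspace (Cb k B)"
proof (rule normed_nspaceI)
  fix a b :: "'a \<Rightarrow> real" and c :: real assume a: "a \<in> carr (Cb k B)"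
  note ja = is_jet_Cb[OF B(1) a]
  have lev: "deriv_on B a i x = level i (jet B a x)" if "i \<in> {1..k}" "x \<in> B" for i x
    using nth_fderiv_eq_level[OF B(1) ja] that by simp
  let ?S = "\<lambda>a i. SUP x\<in>B. op_norm i (deriv_on B a i x)"
  have up: "op_norm i (deriv_on B a i x) \<le> ?S a i" if "a \<in> carr (Cb k B)" "i \<in> {1..k}" "x \<in> B" for a i x
    using carr_CbD(4)[OF that(1), of i] that(2) by (intro cSUP_upper that) auto
  have up0: "\<bar>a x\<bar> \<le> (SUP x\<in>B. \<bar>a x\<bar>)" if "a \<in> carr (Cb k B)" "x \<in> B" for a x
    by (rule cSUP_upper[OF that(2) carr_CbD(3)[OF that(1)]])
  show "c *\<^sub>R a \<in> carr (Cb k B)" by (rule Cb_scale[OF B a])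
  show "nrm (Cb k B) (c *\<^sub>R a) \<le> \<bar>c\<bar> * nrm (Cb k B) a"
  proof -
    have jc: "is_jet B k (c *\<^sub>R a) (\<lambda>x vs. c * jet B a x vs)"
      by (rule is_jet_cong[OF is_jet_scale[OF ja]]) (simp add: scaleR_fun_def)
    have "nrm (Cb k B) (c *\<^sub>R a) \<le> \<bar>c\<bar> * (SUP x\<in>B. \<bar>a x\<bar>) + (\<Sum>i=1..k. \<bar>c\<bar> * ?S a i)"
    proof (rule nrm_Cb_mono_parts[OF B(2)])
      show "\<bar>(c *\<^sub>R a) x\<bar> \<le> \<bar>c\<bar> * (SUP x\<in>B. \<bar>a x\<bar>)" if "x \<in> B" for x
        using mult_left_mono[OF up0[OF a that], of "\<bar>c\<bar>"] by (simp add: scaleR_fun_def abs_mult)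
      fix i x assume i: "i \<in> {1..k}" and x: "x \<in> B"
      have "deriv_on B (c *\<^sub>R a) i x = level i (\<lambda>vs. c * jet B a x vs)"
        using nth_fderiv_eq_level[OF B(1) jc _ x] i by simp
      also have "\<dots> = c *\<^sub>R deriv_on B a i x"
        unfolding lev[OF i x] by (auto simp: level_def fun_eq_iff scaleR_fun_def)
      finally have "op_norm i (deriv_on B (c *\<^sub>R a) i x) = op_norm i (c *\<^sub>R deriv_on B a i x)" by simp
      also have "\<dots> = \<bar>c\<bar> * op_norm i (deriv_on B a i x)"
        using deriv_on_mem_Mult[OF a _ x] i by (intro normed_nspace.nrm_scale[OF normed_nspace_Mult]) auto
      finally show "op_norm i (deriv_on B (c *\<^sub>R a) i x) \<le> \<bar>c\<bar> * ?S a i"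
        using mult_left_mono[OF up[OF a i x], of "\<bar>c\<bar>"] by simp
    qed
    then show ?thesis unfolding nrm_Cb[of k B a] by (simp add: distrib_left sum_distrib_left)
  qed
  show "a = 0" if "nrm (Cb k B) a = 0"
    using abs_le_nrm_Cb[OF B(2) a] that by (auto simp: fun_eq_iff)
  assume b: "b \<in> carr (Cb k B)"
  show "a + b \<in> carr (Cb k B)" by (rule Cb_add[OF B a b])
  note jb = is_jet_Cb[OF B(1) b]
  have jab: "is_jet B k (a + b) (\<lambda>x vs. jet B a x vs + jet B b x vs)"
    by (rule is_jet_cong[OF is_jet_add[OF ja jb]]) simp
  have "nrm (Cb k B) (a + b) \<le> ((SUP x\<in>B. \<bar>a x\<bar>) + (SUP x\<in>B. \<bar>b x\<bar>)) + (\<Sum>i=1..k. ?S a i + ?S b i)"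
  proof (rule nrm_Cb_mono_parts[OF B(2)])
    show "\<bar>(a + b) x\<bar> \<le> (SUP x\<in>B. \<bar>a x\<bar>) + (SUP x\<in>B. \<bar>b x\<bar>)" if "x \<in> B" for x
      using up0[OF a that] up0[OF b that] by simp
    fix i x assume i: "i \<in> {1..k}" and x: "x \<in> B"
    have "deriv_on B (a + b) i x = level i (\<lambda>vs. jet B a x vs + jet B b x vs)"
      using nth_fderiv_eq_level[OF B(1) jab _ x] i by simp
    also have "\<dots> = deriv_on B a i x + deriv_on B b i x"
      using nth_fderiv_eq_level[OF B(1) jb _ x] i
      unfolding lev[OF i x] by (auto simp: level_def fun_eq_iff)
    finally have "op_norm i (deriv_on B (a + b) i x) = op_norm i (deriv_on B a i x + deriv_on B b i x)"
      by simp
    also have "\<dots> \<le> op_norm i (deriv_on B a i x) + op_norm i (deriv_on B b i x)"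
      using deriv_on_mem_Mult[OF a _ x] deriv_on_mem_Mult[OF b _ x] i
      by (intro normed_nspace.nrm_triangle[OF normed_nspace_Mult]) auto
    finally show "op_norm i (deriv_on B (a + b) i x) \<le> ?S a i + ?S b i"
      using up[OF a i x] up[OF b i x] by linarith
  qed
  then show "nrm (Cb k B) (a + b) \<le> nrm (Cb k B) a + nrm (Cb k B) b"
    unfolding nrm_Cb[of k B a] nrm_Cb[of k B b] by (simp add: sum.distrib)
qed (rule Cb_zero[OF B(1)])

lemma Cb_mult:
  fixes a b :: "'a::real_normed_vector \<Rightarrow> real"
  assumes B: "open B" "B \<noteq> {}" and a: "a \<in> carr (Cb k B)" and b: "b \<in> carr (Cb k B)"
  shows "a * b \<in> carr (Cb k B)"
    and "nrm (Cb k B) (a * b) \<le> ((real k + 1) * 2 ^ Suc k) * (nrm (Cb k B) a * nrm (Cb k B) b)"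
proof -
  have j: "is_jet B k (a * b) (\<lambda>x. leibniz (jet B a x) (jet B b x))"
    by (rule is_jet_cong[OF is_jet_mult[OF is_jet_Cb[OF B(1) a] is_jet_Cb[OF B(1) b]]]) simp
  note bd = jet_bounded_leibniz[OF jet_bounded_nrm_Cb[OF B(2) a] jet_bounded_nrm_Cb[OF B(2) b]]
  show "a * b \<in> carr (Cb k B)" by (rule carr_CbI[OF B(1) _ j bd]) (use carr_CbD(1)[OF a] in auto)
  show "nrm (Cb k B) (a * b) \<le> ((real k + 1) * 2 ^ Suc k) * (nrm (Cb k B) a * nrm (Cb k B) b)"
    using nrm_Cb_le[OF B j bd] by (simp only: mult.assoc)
qed

lemma Cb_const:
  fixes B :: "'a::real_normed_vector set"
  assumes B: "open B" "B \<noteq> {}"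
  shows "const_G B c \<in> carr (Cb k B)" "nrm (Cb k B) (const_G B c) \<le> (real k + 1) * \<bar>c\<bar>"
proof -
  have j: "is_jet B k (const_G B c) (\<lambda>x. const_jet c)"
    by (rule is_jet_cong[OF is_jet_const]) (simp add: const_G_def)
  show "const_G B c \<in> carr (Cb k B)"
    by (rule carr_CbI[OF B(1) _ j jet_bounded_const]) (simp add: const_G_def)
  show "nrm (Cb k B) (const_G B c) \<le> (real k + 1) * \<bar>c\<bar>"
    by (rule nrm_Cb_le[OF B j jet_bounded_const])
qed

lemma is_jet_exp_G:
  assumes B: "open B" and a: "a \<in> carr (Cb k B)"
  shows "is_jet B k (exp_G B a) (\<lambda>x. exp_jet (jet B a x))"
  by (rule is_jet_cong[OF is_jet_exp[OF is_jet_Cb[OF assms]]]) (simp add: exp_G_def)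

lemma Cb_exp:
  fixes a :: "'a::real_normed_vector \<Rightarrow> real"
  assumes B: "open B" "B \<noteq> {}" and a: "a \<in> carr (Cb k B)"
  shows "exp_G B a \<in> carr (Cb k B)"
proof -
  obtain M where M: "\<And>A::'a list \<Rightarrow> real. jet_bounded (Suc k) (nrm (Cb k B) a) A \<Longrightarrow> jet_bounded (Suc k) M (exp_jet A)"
    using jet_bounded_exp_jet by metis
  show ?thesis
    by (rule carr_CbI[OF B(1) _ is_jet_exp_G[OF B(1) a] M[OF jet_bounded_nrm_Cb[OF B(2) a]]])
      (simp add: exp_G_def)
qed

lemma exp_G_add: "exp_G B (a + b) = exp_G B a * exp_G B b"
  by (auto simp: exp_G_def fun_eq_iff exp_add)

text \<open>
  The quadratic estimate of \<open>exp_jet_remainder_bounded\<close> holds with the same constant at all points,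
  so it passes to the norm.
\<close>

lemma nrm_exp_G_remainder_le:
  fixes B :: "'a::real_normed_vector set"
  assumes B: "open B" "B \<noteq> {}"
  shows "\<exists>M>0. \<forall>h\<in>carr (Cb k B). nrm (Cb k B) h \<le> 1 \<longrightarrow>
    nrm (Cb k B) (exp_G B h - const_G B 1 - h) \<le> M * (nrm (Cb k B) h)\<^sup>2"
proof -
  obtain M where M: "M > 0" "\<And>\<delta> A::'a list \<Rightarrow> real. \<delta> \<le> 1 \<Longrightarrow> jet_bounded (Suc k) \<delta> A \<Longrightarrow>
      jet_bounded (Suc k) (M * \<delta>\<^sup>2) (\<lambda>vs. exp_jet A vs - const_jet 1 vs - A vs)"
    using exp_jet_remainder_bounded[of "Suc k"] by blast
  show ?thesis
  proof (intro exI[of _ "(real k + 1) * M"] conjI ballI impI)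
    show "(real k + 1) * M > 0" using M(1) by (simp add: add_nonneg_pos)
    fix h assume h: "h \<in> carr (Cb k B)" and h1: "nrm (Cb k B) h \<le> 1"
    have "is_jet B k (\<lambda>x. (exp_G B h x + (-1) * 1) + (-1) * h x)
      (\<lambda>x vs. (exp_jet (jet B h x) vs + (-1) * const_jet 1 vs) + (-1) * jet B h x vs)"
      by (intro is_jet_add is_jet_scale is_jet_exp_G[OF B(1) h] is_jet_Cb[OF B(1) h] is_jet_const)
    then have "is_jet B k (\<lambda>x. exp_G B h x - 1 - h x)
      (\<lambda>x vs. exp_jet (jet B h x) vs - const_jet 1 vs - jet B h x vs)" by simp
    then have j: "is_jet B k (exp_G B h - const_G B 1 - h)
      (\<lambda>x vs. exp_jet (jet B h x) vs - const_jet 1 vs - jet B h x vs)"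
      by (rule is_jet_cong) (simp add: const_G_def)
    show "nrm (Cb k B) (exp_G B h - const_G B 1 - h) \<le> (real k + 1) * M * (nrm (Cb k B) h)\<^sup>2"
      using nrm_Cb_le[OF B j M(2)[OF h1 jet_bounded_nrm_Cb[OF B(2) h]]] by (simp add: mult.assoc)
  qed
qed

text \<open>
  Since \<open>exp (a + h) - exp a - exp a \<cdot> h = exp a \<cdot> (exp h - 1 - h)\<close>, differentiability everywhere
  follows from the quadratic estimate at the origin.
\<close>

lemma has_fderiv_exp_G:
  fixes B :: "'a::real_normed_vector set"
  assumes B: "open B" "B \<noteq> {}" and a: "a \<in> carr (Cb k B)"
  shows "has_fderiv (Cb k B) (Cb k B) (carr (Cb k B)) (exp_G B) (\<lambda>u. exp_G B a * u) a"
  unfolding has_fderiv_def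
proof (intro conjI allI impI)
  interpret G: normed_nspace "Cb k B" by (rule normed_nspace_Cb[OF B])
  let ?n = "nrm (Cb k B)" and ?E = "exp_G B a"
  define K where "K = (real k + 1) * 2 ^ Suc k"
  have K: "K > 0" by (simp add: K_def add_nonneg_pos)
  have E: "?E \<in> carr (Cb k B)" by (rule Cb_exp[OF B a])
  have mult_le: "?n (?E * u) \<le> K * ?n ?E * ?n u" if "u \<in> carr (Cb k B)" for u
    using Cb_mult(2)[OF B E that] by (simp add: K_def mult.assoc)
  show "a \<in> carr (Cb k B)" by fact
  show "exp_G B ` carr (Cb k B) \<subseteq> carr (Cb k B)" using Cb_exp[OF B] by blast
  show "bounded_linear_map (Cb k B) (Cb k B) (\<lambda>u. ?E * u)"
    by (rule bounded_linear_mapI[OF Cb_mult(1)[OF B E] _ _ mult_le])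
      (auto simp: fun_eq_iff scaleR_fun_def algebra_simps)
  obtain M where M: "M > 0" "\<And>h. h \<in> carr (Cb k B) \<Longrightarrow> ?n h \<le> 1 \<Longrightarrow>
      ?n (exp_G B h - const_G B 1 - h) \<le> M * (?n h)\<^sup>2"
    using nrm_exp_G_remainder_le[OF B] by metis
  fix e :: real assume e: "e > 0"
  \<comment> \<open>The summand 1 makes \<open>R\<close> positive.\<close>
  define R where "R = K * ?n ?E * M + 1"
  have R: "R > 0" using K M G.nrm_nonneg[OF E] by (simp add: R_def add_nonneg_pos)
  show "\<exists>d>0. \<forall>y\<in>carr (Cb k B). ?n (y - a) < d \<longrightarrow> ?n (exp_G B y - ?E - ?E * (y - a)) \<le> e * ?n (y - a)"
  proof (intro exI[of _ "min 1 (e / R)"] conjI ballI impI)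
    show "min 1 (e / R) > 0" using e R by simp
    fix y assume y: "y \<in> carr (Cb k B)" and d: "?n (y - a) < min 1 (e / R)"
    define h where "h = y - a"
    have h: "h \<in> carr (Cb k B)" unfolding h_def by (rule G.diff_mem[OF y a])
    have n0: "?n h \<ge> 0" by (rule G.nrm_nonneg[OF h])
    have r: "exp_G B h - const_G B 1 - h \<in> carr (Cb k B)"
      by (intro G.diff_mem Cb_exp[OF B] Cb_const[OF B] h)
    have "exp_G B y = ?E * exp_G B h" unfolding exp_G_add[symmetric] by (simp add: h_def)
    then have eq: "exp_G B y - ?E - ?E * (y - a) = ?E * (exp_G B h - const_G B 1 - h)"
      by (auto simp: h_def fun_eq_iff algebra_simps const_G_def exp_G_def)
    have "?n (exp_G B y - ?E - ?E * (y - a)) \<le> K * ?n ?E * ?n (exp_G B h - const_G B 1 - h)" 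
      unfolding eq by (rule mult_le[OF r])
    also have "\<dots> \<le> K * ?n ?E * (M * (?n h)\<^sup>2)"
      using M(2)[OF h] d K G.nrm_nonneg[OF E] by (intro mult_left_mono) (auto simp: h_def)
    also have "\<dots> \<le> (R * ?n h) * ?n h"
      using n0 by (simp add: R_def power2_eq_square algebra_simps)
    also have "\<dots> \<le> e * ?n h"
      using d R n0 by (intro mult_right_mono) (auto simp: h_def field_simps)
    finally show "?n (exp_G B y - ?E - ?E * (y - a)) \<le> e * ?n (y - a)" by (simp add: h_def)
  qed
qed

section \<open>Charts on the manifolds of measures\<close>

text \<open>
  The standing assumptions on \<open>B\<close> and \<open>\<mu>\<close>. In this context \<open>M\<close> is parametrised by the exponent of the
  density and \<open>N\<close> by the centred exponents.
\<close>

locale statistical_manifold = prob_space \<mu> for \<mu> :: "'a::banach measure" +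
  fixes B :: "'a set" and k :: nat
  assumes open_B: "open B"
    and sets_mu: "sets \<mu> = sets (restrict_space borel B)"
    and pos_mu: "\<And>A. open A \<Longrightarrow> A \<subseteq> B \<Longrightarrow> A \<noteq> {} \<Longrightarrow> measure \<mu> A > 0"
begin

abbreviation "G \<equiv> Cb k B"
abbreviation "G0 \<equiv> Cb0 k B \<mu>"
abbreviation "cst \<equiv> const_G B"
abbreviation "ex \<equiv> exp_G B"

lemma space_mu: "space \<mu> = B"
  using sets_eq_imp_space_eq[OF sets_mu] by (simp add: space_restrict_space)

lemma B_ne: "B \<noteq> {}"
  using not_empty space_mu by simp

sublocale G: normed_nspace G
  by (rule normed_nspace_Cb[OF open_B B_ne])

lemmas G_mult = Cb_mult[OF open_B B_ne] and G_const = Cb_const[OF open_B B_ne]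
  and G_exp = Cb_exp[OF open_B B_ne]

lemma G_outside: "a \<in> carr G \<Longrightarrow> x \<notin> B \<Longrightarrow> a x = 0"
  by (rule carr_CbD(1))

lemma G_continuous: "a \<in> carr G \<Longrightarrow> continuous_on B a"
proof (rule continuous_at_imp_continuous_on, rule ballI)
  fix x assume a: "a \<in> carr G" and x: "x \<in> B"
  have "(a \<longlongrightarrow> a x) (nhds x)"
  proof (rule tendstoI)
    fix r :: real assume "r > 0"
    then have r: "r / 2 > 0" by simp
    show "\<forall>\<^sub>F y in nhds x. dist (a y) (a x) < r"
      using is_jetD(5)[OF is_jet_Cb[OF open_B a] x r]
      by eventually_elim (use r in \<open>auto simp: jet_bounded_Suc_iff dist_real_def jet_def\<close>)
  qed
  then show "isCont a x"
    unfolding isCont_def by (rule filterlim_mono) (auto simp: at_within_def)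
qed

lemma G_measurable [measurable]: "a \<in> carr G \<Longrightarrow> a \<in> borel_measurable \<mu>"
  using borel_measurable_continuous_on_restrict[OF G_continuous] measurable_cong_sets[OF sets_mu refl]
  by blast

lemma G_integrable: "a \<in> carr G \<Longrightarrow> integrable \<mu> a"
  by (rule integrable_const_bound[where B = "nrm G a"])
    (auto simp: abs_le_nrm_Cb[OF B_ne] G_measurable)

lemma abs_integral_le_nrm:
  assumes "a \<in> carr G"
  shows "\<bar>integral\<^sup>L \<mu> a\<bar> \<le> nrm G a"
proof -
  have "\<bar>integral\<^sup>L \<mu> a\<bar> \<le> (\<integral>x. \<bar>a x\<bar> \<partial>\<mu>)" by (rule integral_abs_bound)
  also have "\<dots> \<le> (\<integral>x. nrm G a \<partial>\<mu>)"
    by (rule integral_mono) (auto simp: abs_le_nrm_Cb[OF B_ne assms] intro: G_integrable assms)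
  finally show ?thesis by (simp add: prob_space)
qed

lemma integral_add': "a \<in> carr G \<Longrightarrow> b \<in> carr G \<Longrightarrow> integral\<^sup>L \<mu> (a + b) = integral\<^sup>L \<mu> a + integral\<^sup>L \<mu> b"
  using Bochner_Integration.integral_add[OF G_integrable G_integrable, of a b] by (simp add: plus_fun_def)

lemma integral_diff': "a \<in> carr G \<Longrightarrow> b \<in> carr G \<Longrightarrow> integral\<^sup>L \<mu> (a - b) = integral\<^sup>L \<mu> a - integral\<^sup>L \<mu> b"
  using Bochner_Integration.integral_diff[OF G_integrable G_integrable, of a b] by (simp add: fun_diff_def)

lemma integral_scale': "integral\<^sup>L \<mu> (c *\<^sub>R a) = c * integral\<^sup>L \<mu> a"
  for a :: "'a \<Rightarrow> real"
  by (simp add: scaleR_fun_def)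

lemma integral_const: "integral\<^sup>L \<mu> (cst c) = c"
proof -
  have "integral\<^sup>L \<mu> (cst c) = (\<integral>x. c \<partial>\<mu>)"
    by (rule Bochner_Integration.integral_cong) (auto simp: const_G_def space_mu)
  then show ?thesis by (simp add: prob_space)
qed

text \<open>
  Two elements of \<open>G\<close> differ on an open set, which is charged by \<open>\<mu>\<close> unless it is empty.
\<close>

lemma eq_if_AE_eq:
  assumes a: "a \<in> carr G" and b: "b \<in> carr G" and ae: "AE x in \<mu>. a x = b x"
  shows "a = b"
proof -
  let ?A = "B \<inter> (a - b) -` (- {0})"
  have op: "open ?A"
    by (rule continuous_open_preimage[OF G_continuous open_B]) (auto intro: G.diff_mem a b)
  have meas: "?A \<in> sets \<mu>"
    unfolding sets_mu sets_restrict_space using op by (auto intro!: image_eqI[where x = ?A])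
  have "{x \<in> space \<mu>. a x \<noteq> b x} = ?A" by (auto simp: space_mu)
  from AE_iff_measurable[OF meas this] have "emeasure \<mu> ?A = 0" using ae by simp
  then have "measure \<mu> ?A = 0" by (simp add: measure_def)
  then have "?A = {}" using pos_mu[OF op] by force
  then have "a x = b x" if "x \<in> B" for x using that by auto
  then show ?thesis using G_outside[OF a] G_outside[OF b] by (metis ext)
qed

definition dens :: "('a \<Rightarrow> real) \<Rightarrow> 'a measure" where
  "dens a = density \<mu> (\<lambda>x. ennreal (ex a x))"

lemma sets_dens: "sets (dens a) = sets \<mu>" and space_dens: "space (dens a) = B"
  by (simp_all add: dens_def space_mu)

lemma ex_pos: "x \<in> B \<Longrightarrow> 0 < ex a x" and ex_nonneg: "0 \<le> ex a x"
  by (simp_all add: exp_G_def)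

lemma integral_dens:
  assumes "a \<in> carr G" "u \<in> carr G"
  shows "integral\<^sup>L (dens a) u = integral\<^sup>L \<mu> (ex a * u)"
  unfolding dens_def using G_measurable[OF assms(2)] G_measurable[OF G_exp[OF assms(1)]]
  by (subst integral_density) (auto simp: ex_nonneg times_fun_def)

lemma integral_ex_pos:
  assumes a: "a \<in> carr G"
  shows "0 < integral\<^sup>L \<mu> (ex a)"
proof -
  have "(\<integral>x. exp (- nrm G a) \<partial>\<mu>) \<le> integral\<^sup>L \<mu> (ex a)"
  proof (rule integral_mono)
    fix x assume "x \<in> space \<mu>"
    then show "exp (- nrm G a) \<le> ex a x"
      using abs_le_nrm_Cb[OF B_ne a, of x] by (simp add: exp_G_def space_mu)
  qed (auto intro: G_integrable G_exp a)
  then show ?thesis by (simp add: prob_space less_le_trans[OF exp_gt_zero])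
qed

lemma emeasure_dens: "a \<in> carr G \<Longrightarrow> emeasure (dens a) B = ennreal (integral\<^sup>L \<mu> (ex a))"
  using G_measurable[OF G_exp] G_integrable[OF G_exp] sets.top[of \<mu>]
  unfolding dens_def
  by (subst emeasure_density)
    (auto simp: space_mu nn_integral_set_ennreal[symmetric] ex_nonneg
      intro!: nn_integral_eq_integral[THEN trans[rotated]] nn_integral_cong simp: indicator_def)

lemma dens_absolutely_continuous:
  assumes a: "a \<in> carr G"
  shows "absolutely_continuous \<mu> (dens a)" "absolutely_continuous (dens a) \<mu>"
proof -
  have meas: "(\<lambda>x. ennreal (ex a x)) \<in> borel_measurable \<mu>" using G_measurable[OF G_exp[OF a]] by simp
  show "absolutely_continuous \<mu> (dens a)" unfolding dens_def by (rule absolutely_continuousI_density[OF meas])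
  show "absolutely_continuous (dens a) \<mu>"
    unfolding absolutely_continuous_def
  proof
    fix A assume "A \<in> null_sets (dens a)"
    then have A: "A \<in> sets \<mu>" "AE x in \<mu>. x \<in> A \<longrightarrow> ennreal (ex a x) = 0"
      unfolding dens_def null_sets_density_iff[OF meas] by auto
    from A(2) AE_space have "AE x in \<mu>. x \<notin> A"
    proof eventually_elim
      case (elim x)
      then show ?case using ex_pos[of x a] space_mu by auto
    qed
    then show "A \<in> null_sets \<mu>" using AE_iff_null_sets[OF A(1)] by simp
  qed
qed

text \<open>
  Densities are strictly positive, so \<open>\<mu>\<close> and \<open>dens a\<close> have the same null sets.
\<close>

lemma AE_dens_imp: "a \<in> carr G \<Longrightarrow> AE x in dens a. Q x \<Longrightarrow> AE x in \<mu>. Q x"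
  using absolutely_continuous_AE[OF _ dens_absolutely_continuous(2)] sets_dens by metis

lemma dens_mem: 
  assumes a: "a \<in> carr G"
  shows "dens a \<in> manM B k \<mu>"
proof -
  have "finite_measure (dens a)"
    by (rule finite_measureI) (simp add: space_dens emeasure_dens[OF a])
  then show ?thesis
    using a dens_absolutely_continuous[OF a] unfolding manM_def by (auto simp: sets_dens dens_def)
qed

lemma dens_inject:
  assumes a: "a \<in> carr G" and b: "b \<in> carr G" and eq: "dens a = dens b"
  shows "a = b"
proof (rule eq_if_AE_eq[OF a b])
  have "AE x in \<mu>. ennreal (ex a x) = ennreal (ex b x)"
    using eq G_measurable[OF G_exp[OF a]] G_measurable[OF G_exp[OF b]]
    unfolding dens_def by (intro density_unique) auto
  with AE_space show "AE x in \<mu>. a x = b x"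
  proof eventually_elim
    case (elim x)
    then show ?case by (simp add: space_mu exp_G_def)
  qed
qed

lemma phi1_dens: "a \<in> carr G \<Longrightarrow> phi1 B k \<mu> (dens a) = a"
  unfolding phi1_def using dens_inject by (intro the_equality) (auto simp: dens_def)

lemma manM_eq: "manM B k \<mu> = dens ` carr G"
  using dens_mem by (auto simp: manM_def dens_def)

lemma the_inv_phi1: "a \<in> carr G \<Longrightarrow> the_inv_into (manM B k \<mu>) (phi1 B k \<mu>) a = dens a"
  by (rule the_inv_into_f_eq) (auto simp: manM_eq phi1_dens inj_on_def)

lemma measure_dens: "a \<in> carr G \<Longrightarrow> measure (dens a) B = integral\<^sup>L \<mu> (ex a)"
  using integral_ex_pos[of a] by (simp add: measure_def emeasure_dens)

lemma manN_eq: "manN B k \<mu> = dens ` {a \<in> carr G. integral\<^sup>L \<mu> (ex a) = 1}"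
  unfolding manN_def manM_eq using measure_dens by auto

lemma carr_G0: "carr G0 = {a \<in> carr G. integral\<^sup>L \<mu> a = 0}" and nrm_G0: "nrm G0 = nrm G"
  by (simp_all add: Cb0_def)

sublocale G0: normed_nspace G0
proof
  have "integral\<^sup>L \<mu> (0 :: 'a \<Rightarrow> real) = 0" unfolding zero_fun_def by simp
  then show "0 \<in> carr G0" using G.zero_mem by (simp add: carr_G0)
  fix u v :: "'a \<Rightarrow> real" and c :: real
  assume u: "u \<in> carr G0"
  show "c *\<^sub>R u \<in> carr G0" using u by (simp add: carr_G0 G.mem integral_scale')
  show "nrm G0 (c *\<^sub>R u) = \<bar>c\<bar> * nrm G0 u" using u G.nrm_scale by (simp add: carr_G0 nrm_G0)
  show "u = 0" if "nrm G0 u = 0" using u that G.nrm_eq_0D by (simp add: carr_G0 nrm_G0)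
  assume v: "v \<in> carr G0"
  show "u + v \<in> carr G0" using u v by (simp add: carr_G0 G.mem integral_add')
  show "nrm G0 (u + v) \<le> nrm G0 u + nrm G0 v" using u v G.nrm_triangle by (simp add: carr_G0 nrm_G0)
qed

lemma centre_mem: "a \<in> carr G \<Longrightarrow> a - cst (integral\<^sup>L \<mu> a) \<in> carr G0"
  by (simp add: carr_G0 G.mem G_const integral_diff' integral_const)

text \<open>
  Shifting the exponent by a constant rescales the measure, so the normalised measure with
  exponent \<open>a\<close> up to constants is unique; \<open>unit_exponent b\<close> is its exponent.
\<close>

definition unit_exponent :: "('a \<Rightarrow> real) \<Rightarrow> 'a \<Rightarrow> real" where
  "unit_exponent b = b - cst (ln (integral\<^sup>L \<mu> (ex b)))"

lemma ex_diff_const: "ex (b - cst c) = exp (- c) *\<^sub>R ex b"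
  by (auto simp: exp_G_def const_G_def scaleR_fun_def fun_eq_iff exp_diff exp_minus field_simps)

lemma unit_exponent_mem: "b \<in> carr G \<Longrightarrow> unit_exponent b \<in> carr G"
  unfolding unit_exponent_def by (intro G.mem G_const)

lemma ex_unit_exponent: "b \<in> carr G \<Longrightarrow> ex (unit_exponent b) = inverse (integral\<^sup>L \<mu> (ex b)) *\<^sub>R ex b"
  unfolding unit_exponent_def ex_diff_const by (simp add: exp_minus integral_ex_pos)

lemma integral_ex_unit_exponent: "b \<in> carr G \<Longrightarrow> integral\<^sup>L \<mu> (ex (unit_exponent b)) = 1"
  using integral_ex_pos[of b] by (simp add: ex_unit_exponent integral_scale')

lemma unit_exponent_shift:
  assumes a: "a \<in> carr G"
  shows "unit_exponent (a - cst c) = unit_exponent a"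
proof -
  have "ln (exp (- c) * integral\<^sup>L \<mu> (ex a)) = - c + ln (integral\<^sup>L \<mu> (ex a))"
    using integral_ex_pos[OF a] by (simp add: ln_mult)
  then show ?thesis
    unfolding unit_exponent_def ex_diff_const integral_scale' by (auto simp: const_G_def fun_eq_iff)
qed

lemma unit_exponent_eq: "integral\<^sup>L \<mu> (ex a) = 1 \<Longrightarrow> unit_exponent a = a"
  by (auto simp: unit_exponent_def const_G_def fun_eq_iff)

lemma unit_exponent_centred:
  assumes b: "b \<in> carr G"
  shows "unit_exponent b - cst (integral\<^sup>L \<mu> (unit_exponent b)) = b - cst (integral\<^sup>L \<mu> b)"
  unfolding unit_exponent_def integral_diff'[OF b G_const(1)] integral_const
  by (auto simp: const_G_def fun_eq_iff)

lemma phie_dens: "a \<in> carr G \<Longrightarrow> phie B k \<mu> (dens a) = a - cst (integral\<^sup>L \<mu> a)"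
  by (simp add: phie_def phi1_dens)

lemma phie_dens_unit_exponent: "b \<in> carr G0 \<Longrightarrow> phie B k \<mu> (dens (unit_exponent b)) = b"
  using unit_exponent_centred[of b]
  by (auto simp: phie_dens unit_exponent_mem carr_G0 const_G_def fun_eq_iff)

lemma inj_on_phie: "inj_on (phie B k \<mu>) (manN B k \<mu>)"
proof (rule inj_onI)
  fix P Q assume "P \<in> manN B k \<mu>" "Q \<in> manN B k \<mu>" and eq: "phie B k \<mu> P = phie B k \<mu> Q"
  then obtain a b where a: "a \<in> carr G" "integral\<^sup>L \<mu> (ex a) = 1" "P = dens a"
    and b: "b \<in> carr G" "integral\<^sup>L \<mu> (ex b) = 1" "Q = dens b" unfolding manN_eq by blast
  have "unit_exponent (a - cst (integral\<^sup>L \<mu> a)) = unit_exponent (b - cst (integral\<^sup>L \<mu> b))"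
    using eq a b by (simp add: phie_dens)
  then show "P = Q" using a b by (simp add: unit_exponent_shift unit_exponent_eq)
qed

lemma dens_unit_exponent_mem: "b \<in> carr G \<Longrightarrow> dens (unit_exponent b) \<in> manN B k \<mu>"
  unfolding manN_eq using unit_exponent_mem integral_ex_unit_exponent by blast

lemma phie_inv: "b \<in> carr G0 \<Longrightarrow> phie_inv B k \<mu> b = dens (unit_exponent b)"
  by (rule the_inv_into_f_eq[OF inj_on_phie phie_dens_unit_exponent])
    (auto simp: carr_G0 intro: dens_unit_exponent_mem)

lemma normalise_dens:
  assumes a: "a \<in> carr G"
  shows "normalise B (dens a) = dens (unit_exponent a)"
proof -
  let ?I = "integral\<^sup>L \<mu> (ex a)"
  have I: "?I > 0" by (rule integral_ex_pos[OF a])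
  have meas: "(\<lambda>x. ennreal (ex a x)) \<in> borel_measurable \<mu>" using G_measurable[OF G_exp[OF a]] by simp
  have r: "1 / emeasure (dens a) B = ennreal (inverse ?I)"
    using I by (simp add: emeasure_dens[OF a] inverse_ennreal divide_ennreal_def)
  have "dens (unit_exponent a) = density \<mu> (\<lambda>x. ennreal (inverse ?I) * ennreal (ex a x))"
    unfolding dens_def ex_unit_exponent[OF a] scaleR_fun_def using I
    by (intro arg_cong[where f = "density \<mu>"]) (auto simp: fun_eq_iff ex_nonneg ennreal_mult)
  also have "\<dots> = scale_measure (ennreal (inverse ?I)) (dens a)"
  proof (rule measure_eqI)
    fix A assume "A \<in> sets (density \<mu> (\<lambda>x. ennreal (inverse ?I) * ennreal (ex a x)))"
    then have A: "A \<in> sets \<mu>" by simp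
    show "emeasure (density \<mu> (\<lambda>x. ennreal (inverse ?I) * ennreal (ex a x))) A =
      emeasure (scale_measure (ennreal (inverse ?I)) (dens a)) A"
      using meas A by (simp add: dens_def emeasure_density mult.assoc nn_integral_cmult)
  qed (simp add: sets_dens)
  finally show ?thesis unfolding normalise_def r by simp
qed

lemma normalise_manN: "P \<in> manN B k \<mu> \<Longrightarrow> normalise B P = P"
  unfolding manN_eq using normalise_dens unit_exponent_eq by auto

lemma sdens_sdensity:
  assumes P: "P \<in> manM B k \<mu>" and u: "u \<in> carr G"
  shows "sdens B k P (sdensity P u) = u"
  unfolding sdens_def
proof (rule the_equality)
  obtain a where a: "a \<in> carr G" "P = dens a" using P unfolding manM_eq by blast
  interpret P: finite_measure P using P unfolding manM_def by blast
  have int: "integrable P v" if v: "v \<in> carr G" for v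
    by (rule P.integrable_const_bound[where B = "nrm G v"])
      (use abs_le_nrm_Cb[OF B_ne v] G_measurable[OF v] a in \<open>auto simp: dens_def\<close>)
  fix v assume v: "v \<in> carr G \<and> sdensity P u = sdensity P v"
  have "AE x in P. v x = u x"
  proof (rule density_unique_real)
    show "integrable P v" "integrable P u" using int u v by auto
    fix A assume "A \<in> sets P"
    then show "(\<integral>x\<in>A. v x \<partial>P) = (\<integral>x\<in>A. u x \<partial>P)"
      using fun_cong[OF conjunct2[OF v], of A] by (simp add: sdensity_def)
  qed
  then have "AE x in \<mu>. v x = u x" using AE_dens_imp a by blast
  then show "v = u" by (intro eq_if_AE_eq u conjunct1[OF v])
qed (use u in simp)

lemma sdensity_total:
  assumes a: "a \<in> carr G"
  shows "sdensity (dens a) u B = integral\<^sup>L (dens a) u"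
proof -
  have "B \<in> sets (dens a)" using sets.top[of "dens a"] by (simp add: space_dens)
  moreover have "set_lebesgue_integral (dens a) B u = integral\<^sup>L (dens a) u"
    unfolding set_lebesgue_integral_def by (rule Bochner_Integration.integral_cong) (auto simp: space_dens)
  ultimately show ?thesis by (simp add: sdensity_def)
qed

lemma coordN_sdensity:
  "P \<in> manM B k \<mu> \<Longrightarrow> u \<in> carr G \<Longrightarrow> coordN B k \<mu> P (sdensity P u) = u - cst (integral\<^sup>L \<mu> u)"
  by (simp add: coordN_def sdens_sdensity)

section \<open>Derivatives of the charts\<close>

lemma bounded_linear_inclusion: "bounded_linear_map G0 G (\<lambda>u. u)"
  by (rule bounded_linear_mapI[where C = 1]) (auto simp: carr_G0 nrm_G0)

lemma bounded_linear_integral: "bounded_linear_map G type_space (integral\<^sup>L \<mu>)"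
  by (rule bounded_linear_mapI[where C = 1])
    (auto simp: type_space_def integral_add' integral_scale' abs_integral_le_nrm)

lemma bounded_linear_const: "bounded_linear_map type_space G cst"
  by (rule bounded_linear_mapI[where C = "real k + 1"])
    (auto simp: type_space_def G_const, auto simp: const_G_def scaleR_fun_def fun_eq_iff)

lemma has_fderiv_inclusion: "b \<in> carr G0 \<Longrightarrow> has_fderiv G0 G (carr G0) (\<lambda>u. u) (\<lambda>u. u) b"
  by (rule has_fderiv_bounded_linear_map[OF G0.normed_nspace_axioms G.normed_nspace_axioms
        bounded_linear_inclusion subset_refl])

lemmas has_fderiv_ex = has_fderiv_exp_G[OF open_B B_ne, of _ k]

lemma has_fderiv_ln:
  assumes "(t::real) > 0"
  shows "has_fderiv type_space type_space {0<..} ln (\<lambda>s. inverse t * s) t"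
  using DERIV_ln[OF assms] assms
  by (subst has_fderiv_type_space_iff) (auto simp: has_field_derivative_def)

text \<open>
  The derivative of the logarithm of the normalising constant in the direction \<open>u\<close> is the mean of
  \<open>u\<close> under the normalised measure.
\<close>

lemma has_fderiv_unit_exponent:
  assumes b: "b \<in> carr G"
  shows "has_fderiv G G (carr G) unit_exponent
    (\<lambda>u. u - cst (integral\<^sup>L \<mu> (ex (unit_exponent b) * u))) b"
proof -
  note nG = G.normed_nspace_axioms and nR = normed_nspace_type_space
  let ?I = "integral\<^sup>L \<mu> (ex b)"
  have int: "has_fderiv G type_space (carr G) (\<lambda>y. integral\<^sup>L \<mu> (ex y)) (\<lambda>u. integral\<^sup>L \<mu> (ex b * u)) b"
    by (rule has_fderiv_linear_compose[OF nG nG nR subset_refl has_fderiv_ex[OF b] bounded_linear_integral])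
  have "has_fderiv G type_space (carr G) (\<lambda>y. ln (integral\<^sup>L \<mu> (ex y)))
      (\<lambda>u. inverse ?I * integral\<^sup>L \<mu> (ex b * u)) b"
    by (rule has_fderiv_compose[where f = "\<lambda>y. integral\<^sup>L \<mu> (ex y)" and x = b,
          OF nG nR nR subset_refl _ int has_fderiv_ln[OF integral_ex_pos[OF b]]])
      (auto simp: type_space_def integral_ex_pos)
  from has_fderiv_linear_compose[OF nG nR nG subset_refl this bounded_linear_const]
  have "has_fderiv G G (carr G) (\<lambda>y. y - cst (ln (integral\<^sup>L \<mu> (ex y))))
      (\<lambda>u. u - cst (inverse ?I * integral\<^sup>L \<mu> (ex b * u))) b"
    by (rule has_fderiv_diff[OF nG nG subset_refl
          has_fderiv_bounded_linear_map[OF nG nG G.bounded_linear_map_id subset_refl b]])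
  moreover have "ex (unit_exponent b) * u = inverse ?I *\<^sub>R (ex b * u)" for u
    unfolding ex_unit_exponent[OF b] by (auto simp: fun_eq_iff scaleR_fun_def)
  ultimately show ?thesis
    unfolding unit_exponent_def[abs_def, symmetric] by (simp add: integral_scale')
qed

definition chart :: "real \<Rightarrow> ('a \<Rightarrow> real) \<Rightarrow> 'a \<Rightarrow> real" where
  "chart \<alpha> a = (if \<alpha> = 1 then a else (2 / (1 - \<alpha>)) *\<^sub>R (ex (((1 - \<alpha>) / 2) *\<^sub>R a) - cst 1))"

lemma phi_dens: "a \<in> carr G \<Longrightarrow> phi B k \<mu> \<alpha> (dens a) = chart \<alpha> a"
  by (simp add: phi_def chart_def phi1_dens)

text \<open>
  One formula serves all \<open>\<alpha>\<close>: for \<open>\<alpha> = 1\<close> the exponential factor is \<open>1\<close> on \<open>B\<close>, and otherwise the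
  factor \<open>2 / (1 - \<alpha>)\<close> cancels against the inner derivative.
\<close>

lemma has_fderiv_chart:
  assumes a: "a \<in> carr G"
  shows "has_fderiv G G (carr G) (chart \<alpha>) (\<lambda>u. ex (((1 - \<alpha>) / 2) *\<^sub>R a) * u) a"
proof -
  note nG = G.normed_nspace_axioms
  have id: "has_fderiv G G (carr G) (\<lambda>u. u) (\<lambda>u. u) a"
    by (rule has_fderiv_bounded_linear_map[OF nG nG G.bounded_linear_map_id subset_refl a])
  show ?thesis
  proof (cases "\<alpha> = 1")
    case True
    then have c: "chart \<alpha> = (\<lambda>u. u)" by (simp add: chart_def[abs_def])
    show ?thesis
      unfolding c using True
      by (intro has_fderiv_cong_deriv[OF nG subset_refl id])
        (auto simp: fun_eq_iff exp_G_def G_outside)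
  next
    case False
    define \<beta> where "\<beta> = (1 - \<alpha>) / 2"
    have \<beta>: "\<beta> \<noteq> 0" "2 / (1 - \<alpha>) = inverse \<beta>" using False by (auto simp: \<beta>_def)
    have "has_fderiv G G (carr G) (\<lambda>y. ex (\<beta> *\<^sub>R y)) (\<lambda>u. ex (\<beta> *\<^sub>R a) * (\<beta> *\<^sub>R u)) a"
      by (rule has_fderiv_compose[where f = "\<lambda>y. \<beta> *\<^sub>R y" and x = a, OF nG nG nG subset_refl subset_refl
            has_fderiv_scale[OF nG nG subset_refl id] has_fderiv_ex[OF G.scale_mem[OF a]]])
        (auto intro: G.mem)
    from has_fderiv_scale[OF nG nG subset_refl has_fderiv_diff[OF nG nG subset_refl this
          has_fderiv_const[OF nG nG G_const(1) subset_refl a]], of "inverse \<beta>" 1]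
    have *: "has_fderiv G G (carr G) (\<lambda>y. inverse \<beta> *\<^sub>R (ex (\<beta> *\<^sub>R y) - cst 1))
        (\<lambda>u. inverse \<beta> *\<^sub>R (ex (\<beta> *\<^sub>R a) * (\<beta> *\<^sub>R u) - 0)) a" .
    have c: "chart \<alpha> = (\<lambda>y. inverse \<beta> *\<^sub>R (ex (\<beta> *\<^sub>R y) - cst 1))"
      using False unfolding chart_def[abs_def] \<beta>(2) by (simp add: \<beta>_def)
    show ?thesis
      unfolding c \<beta>_def[symmetric]
      by (rule has_fderiv_cong_deriv[OF nG subset_refl *])
        (use \<beta>(1) in \<open>auto simp: fun_eq_iff scaleR_fun_def\<close>)
  qed
qed

text \<open>
  For \<open>P = dens a\<close> this is \<open>u - \<^bold>E\<^sub>P u\<close>.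
\<close>

abbreviation "centre_at a u \<equiv> u - cst (integral\<^sup>L \<mu> (ex a * u))"

lemma centre_at_mem: "a \<in> carr G \<Longrightarrow> u \<in> carr G \<Longrightarrow> centre_at a u \<in> carr G"
  by (intro G.mem G_const)

lemma has_fderiv_unit_exponent_G0:
  assumes "b \<in> carr G0"
  shows "has_fderiv G0 G (carr G0) unit_exponent (centre_at (unit_exponent b)) b"
  by (rule has_fderiv_compose[OF G0.normed_nspace_axioms G.normed_nspace_axioms G.normed_nspace_axioms
        subset_refl subset_refl has_fderiv_inclusion[OF assms] has_fderiv_unit_exponent])
    (use assms in \<open>auto simp: carr_G0\<close>)

lemma has_fderiv_chart_unit_exponent:
  assumes b: "b \<in> carr G0"
  shows "has_fderiv G0 G (carr G0) (\<lambda>y. chart \<alpha> (unit_exponent y))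
    (\<lambda>u. ex (((1 - \<alpha>) / 2) *\<^sub>R unit_exponent b) * centre_at (unit_exponent b) u) b"
  by (rule has_fderiv_compose[OF G0.normed_nspace_axioms G.normed_nspace_axioms G.normed_nspace_axioms
        subset_refl subset_refl has_fderiv_unit_exponent_G0[OF b] has_fderiv_chart])
    (use b in \<open>auto simp: carr_G0 intro: unit_exponent_mem\<close>)

text \<open>
  The second derivative of the chart \<open>\<phi>\<^sub>\<alpha>\<close> along \<open>N\<close>, with \<open>\<beta> = (1 - \<alpha>) / 2\<close>. Differentiating the factor \<open>exp (\<beta> a)\<close> produces the product of the two centred
  directions; differentiating the mean of \<open>v\<close> produces only a constant function, whose value
  \<open>d u\<close> is left unspecified since the projection to \<open>N\<close> removes constants.
\<close>

lemma has_fderiv_first_derivative: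
  assumes b: "b \<in> carr G0" and v: "has_fderiv G0 G0 (carr G0) v v' b"
  shows "\<exists>d. has_fderiv G0 G (carr G0)
    (\<lambda>y. ex (\<beta> *\<^sub>R unit_exponent y) * centre_at (unit_exponent y) (v y))
    (\<lambda>u. ex (\<beta> *\<^sub>R unit_exponent b) *
      (\<beta> *\<^sub>R (centre_at (unit_exponent b) u * centre_at (unit_exponent b) (v b)) + v' u - cst (d u))) b"
proof -
  note nG = G.normed_nspace_axioms and nG0 = G0.normed_nspace_axioms and nR = normed_nspace_type_space
  let ?c = "unit_exponent b"
  have bG: "b \<in> carr G" using b by (simp add: carr_G0)
  have cG: "?c \<in> carr G" by (rule unit_exponent_mem[OF bG])
  note ue = has_fderiv_unit_exponent_G0[OF b]
  have into: "unit_exponent ` carr G0 \<subseteq> carr G" by (auto simp: carr_G0 intro: unit_exponent_mem)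
  have e1: "has_fderiv G0 G (carr G0) (\<lambda>y. ex (\<beta> *\<^sub>R unit_exponent y))
      (\<lambda>u. ex (\<beta> *\<^sub>R ?c) * (\<beta> *\<^sub>R centre_at ?c u)) b"
    by (rule has_fderiv_compose[where f = "\<lambda>y. \<beta> *\<^sub>R unit_exponent y" and x = b,
          OF nG0 nG nG subset_refl subset_refl has_fderiv_scale[OF nG0 nG subset_refl ue] has_fderiv_ex[OF G.scale_mem[OF cG]]])
      (use into in \<open>auto intro: G.mem\<close>)
  have e2: "has_fderiv G0 G (carr G0) (\<lambda>y. ex (unit_exponent y)) (\<lambda>u. ex ?c * centre_at ?c u) b"
    by (rule has_fderiv_compose[OF nG0 nG nG subset_refl subset_refl ue has_fderiv_ex[OF cG] into])
  have vG: "has_fderiv G0 G (carr G0) v v' b"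
    by (rule has_fderiv_linear_compose[OF nG0 nG0 nG subset_refl v bounded_linear_inclusion])
  define d where "d u = integral\<^sup>L \<mu> ((ex ?c * centre_at ?c u) * v b + ex ?c * v' u)" for u
  have "has_fderiv G0 G (carr G0) (\<lambda>y. ex (unit_exponent y) * v y)
      (\<lambda>u. (ex ?c * centre_at ?c u) * v b + ex ?c * v' u) b"
    by (rule has_fderiv_mult[OF nG0 nG subset_refl G_mult e2 vG])
  from has_fderiv_linear_compose[OF nG0 nG nR subset_refl this bounded_linear_integral]
  have "has_fderiv G0 type_space (carr G0) (\<lambda>y. integral\<^sup>L \<mu> (ex (unit_exponent y) * v y)) d b"
    unfolding d_def[abs_def] .
  from has_fderiv_diff[OF nG0 nG subset_refl vG
      has_fderiv_linear_compose[OF nG0 nR nG subset_refl this bounded_linear_const]]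
  have "has_fderiv G0 G (carr G0) (\<lambda>y. centre_at (unit_exponent y) (v y)) (\<lambda>u. v' u - cst (d u)) b" .
  from has_fderiv_mult[OF nG0 nG subset_refl G_mult e1 this]
  have prod: "has_fderiv G0 G (carr G0)
    (\<lambda>y. ex (\<beta> *\<^sub>R unit_exponent y) * centre_at (unit_exponent y) (v y))
    (\<lambda>u. (ex (\<beta> *\<^sub>R ?c) * (\<beta> *\<^sub>R centre_at ?c u)) * centre_at ?c (v b) + ex (\<beta> *\<^sub>R ?c) * (v' u - cst (d u))) b" .
  have "has_fderiv G0 G (carr G0)
    (\<lambda>y. ex (\<beta> *\<^sub>R unit_exponent y) * centre_at (unit_exponent y) (v y))
    (\<lambda>u. ex (\<beta> *\<^sub>R ?c) * (\<beta> *\<^sub>R (centre_at ?c u * centre_at ?c (v b)) + v' u - cst (d u))) b"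
    by (rule has_fderiv_cong_deriv[OF nG0 subset_refl prod])
      (simp add: fun_eq_iff scaleR_fun_def algebra_simps)
  then show ?thesis by blast
qed

section \<open>Tangent vectors in coordinates\<close>

lemma coordN_mem:
  assumes "P \<in> manM B k \<mu>" "Y \<in> TM B k P"
  shows "coordN B k \<mu> P Y \<in> carr G0"
  using assms by (auto simp: TM_def coordN_sdensity intro: centre_mem)

lemma TN_sdensity_iff:
  assumes a: "a \<in> carr G" and y: "y \<in> carr G"
  shows "sdensity (dens a) y \<in> TN B k (dens a) \<longleftrightarrow> integral\<^sup>L \<mu> (ex a * y) = 0"
  using y by (simp add: TN_def TM_def sdensity_total[OF a] integral_dens[OF a y])

lemma applyN_phie:
  assumes P: "P \<in> manN B k \<mu>" and Y: "Y \<in> TM B k P"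
  shows "applyN B k \<mu> G0 P Y (phie B k \<mu>) = coordN B k \<mu> P Y"
proof -
  obtain a where a: "a \<in> carr G" "P = dens a" using P unfolding manN_eq by blast
  have PM: "P \<in> manM B k \<mu>" using P by (simp add: manN_def)
  have mem: "phie B k \<mu> P \<in> carr G0" using a by (simp add: phie_dens centre_mem)
  have "has_fderiv G0 G0 (carr G0) (phie B k \<mu> \<circ> phie_inv B k \<mu>) (\<lambda>u. u) (phie B k \<mu> P)"
    by (rule has_fderiv_cong[OF has_fderiv_bounded_linear_map[OF G0.normed_nspace_axioms
          G0.normed_nspace_axioms G0.bounded_linear_map_id subset_refl mem]])
      (simp add: phie_inv phie_dens_unit_exponent)
  then show ?thesis
    unfolding applyN_def
    by (rule fderiv_eq_carr[OF G0.normed_nspace_axioms G0.normed_nspace_axioms _ coordN_mem[OF PM Y]])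
qed

lemma applyM_phie_normalise:
  assumes a: "a \<in> carr G" and x: "x \<in> carr G"
  shows "applyM B k \<mu> G0 (dens a) (sdensity (dens a) x) (phie B k \<mu> \<circ> normalise B) = x - cst (integral\<^sup>L \<mu> x)"
proof -
  have lin: "bounded_linear_map G G0 (\<lambda>a. a - cst (integral\<^sup>L \<mu> a))"
  proof -
    have "bounded_linear_map G G (\<lambda>a. a + (-1) *\<^sub>R cst (integral\<^sup>L \<mu> a))"
      by (rule bounded_linear_map_add[OF G.normed_nspace_axioms G.normed_nspace_axioms G.bounded_linear_map_id
            bounded_linear_map_scale[OF G.normed_nspace_axioms G.normed_nspace_axioms
            bounded_linear_map_compose[OF G.normed_nspace_axioms normed_nspace_type_space
            bounded_linear_integral bounded_linear_const]]])
    then show ?thesis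
      using centre_mem unfolding bounded_linear_map_def nrm_G0 by auto
  qed
  have "has_fderiv G G0 (carr G)
      ((phie B k \<mu> \<circ> normalise B) \<circ> the_inv_into (manM B k \<mu>) (phi1 B k \<mu>)) (\<lambda>a. a - cst (integral\<^sup>L \<mu> a)) a"
    by (rule has_fderiv_cong[OF has_fderiv_bounded_linear_map[OF G.normed_nspace_axioms
          G0.normed_nspace_axioms lin subset_refl a]])
      (simp add: the_inv_phi1 normalise_dens phie_dens unit_exponent_mem unit_exponent_centred)
  then show ?thesis
    unfolding applyM_def phi1_dens[OF a] sdens_sdensity[OF dens_mem[OF a] x]
    by (rule fderiv_eq_carr[OF G.normed_nspace_axioms G0.normed_nspace_axioms _ x])
qed

text \<open>
  The tangent map of the normalisation removes the mean of the density under \<open>P\<close>; in the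
  coordinate of \<open>\<phi>\<^sub>e\<close> only the mean under \<open>\<mu>\<close> is visible.
\<close>

lemma T_normalise_sdensity:
  assumes a: "a \<in> carr G" and P: "integral\<^sup>L \<mu> (ex a) = 1" and x: "x \<in> carr G"
  shows "T_normalise B k \<mu> (dens a) (sdensity (dens a) x) = sdensity (dens a) (centre_at a x)"
proof -
  let ?P = "dens a"
  have PN: "?P \<in> manN B k \<mu>" unfolding manN_eq using a P by blast
  have PM: "?P \<in> manM B k \<mu>" by (rule dens_mem[OF a])
  have int_centre: "integral\<^sup>L \<mu> (ex a * (x - cst c)) = integral\<^sup>L \<mu> (ex a * x) - c" for c
  proof -
    have "ex a * (x - cst c) = ex a * x - c *\<^sub>R ex a"
      by (auto simp: fun_eq_iff exp_G_def const_G_def scaleR_fun_def algebra_simps)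
    then show ?thesis
      using P by (simp add: integral_diff' G_mult G_exp a x G.mem integral_scale')
  qed
  have cm: "centre_at a x \<in> carr G" by (rule centre_at_mem[OF a x])
  show ?thesis
    unfolding T_normalise_def normalise_manN[OF PN] applyM_phie_normalise[OF a x]
  proof (rule the_equality)
    have TN: "sdensity ?P (centre_at a x) \<in> TN B k ?P"
      unfolding TN_sdensity_iff[OF a cm] int_centre by simp
    moreover have "applyN B k \<mu> G0 ?P (sdensity ?P (centre_at a x)) (phie B k \<mu>) = x - cst (integral\<^sup>L \<mu> x)"
    proof -
      have "applyN B k \<mu> G0 ?P (sdensity ?P (centre_at a x)) (phie B k \<mu>) =
        centre_at a x - cst (integral\<^sup>L \<mu> (centre_at a x))"
        using TN by (subst applyN_phie[OF PN]) (auto simp: TN_def coordN_sdensity[OF PM cm])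
      also have "\<dots> = x - cst (integral\<^sup>L \<mu> x)"
        unfolding integral_diff'[OF x G_const(1)] integral_const by (auto simp: const_G_def fun_eq_iff)
      finally show ?thesis .
    qed
    ultimately show "sdensity ?P (centre_at a x) \<in> TN B k ?P \<and>
      applyN B k \<mu> G0 ?P (sdensity ?P (centre_at a x)) (phie B k \<mu>) = x - cst (integral\<^sup>L \<mu> x)" ..
  next
    fix Y assume Y: "Y \<in> TN B k ?P \<and> applyN B k \<mu> G0 ?P Y (phie B k \<mu>) = x - cst (integral\<^sup>L \<mu> x)"
    then have "Y \<in> TM B k ?P" by (simp add: TN_def)
    then obtain y where y: "y \<in> carr G" "Y = sdensity ?P y" unfolding TM_def by blast
    have "y - cst (integral\<^sup>L \<mu> y) = x - cst (integral\<^sup>L \<mu> x)" (is "?l = ?r")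
      using Y applyN_phie[OF PN \<open>Y \<in> TM B k ?P\<close>] y coordN_sdensity[OF PM y(1)] by simp
    then have "?l z = ?r z" for z by simp
    then have "y z = x z - cst (integral\<^sup>L \<mu> x - integral\<^sup>L \<mu> y) z" for z
      by (cases "z \<in> B") (simp_all add: const_G_def diff_eq_eq)
    then have eq: "y = x - cst (integral\<^sup>L \<mu> x - integral\<^sup>L \<mu> y)" by (simp add: fun_eq_iff)
    have "integral\<^sup>L \<mu> (ex a * y) = 0" using Y y TN_sdensity_iff[OF a y(1)] by simp
    then have "integral\<^sup>L \<mu> x - integral\<^sup>L \<mu> y = integral\<^sup>L \<mu> (ex a * x)"
      using int_centre[of "integral\<^sup>L \<mu> x - integral\<^sup>L \<mu> y"] eq by simp
    then show "Y = sdensity ?P (centre_at a x)" using eq y by simp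
  qed
qed

lemma applyM_phi:
  assumes a: "a \<in> carr G" and w: "w \<in> carr G"
  shows "applyM B k \<mu> G (dens a) (sdensity (dens a) w) (phi B k \<mu> \<alpha>) = ex (((1 - \<alpha>) / 2) *\<^sub>R a) * w"
proof -
  have "has_fderiv G G (carr G) (phi B k \<mu> \<alpha> \<circ> the_inv_into (manM B k \<mu>) (phi1 B k \<mu>))
      (\<lambda>u. ex (((1 - \<alpha>) / 2) *\<^sub>R a) * u) a"
    by (rule has_fderiv_cong[OF has_fderiv_chart[OF a]]) (simp add: the_inv_phi1 phi_dens)
  then show ?thesis
    unfolding applyM_def phi1_dens[OF a] sdens_sdensity[OF dens_mem[OF a] w]
    by (rule fderiv_eq_carr[OF G.normed_nspace_axioms G.normed_nspace_axioms _ w])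
qed

lemma smooth_vf_has_fderiv:
  assumes "smooth_vf B k \<mu> V" "b \<in> carr G0"
  shows "\<exists>v'. has_fderiv G0 G0 (carr G0)
    (\<lambda>b. coordN B k \<mu> (phie_inv B k \<mu> b) (V (phie_inv B k \<mu> b))) v' b"
proof -
  let ?v = "\<lambda>b. coordN B k \<mu> (phie_inv B k \<mu> b) (V (phie_inv B k \<mu> b))"
  have "C_map G0 G0 (carr G0) (Suc 0) ?v" using assms(1) unfolding smooth_vf_def smooth_map_def by blast
  then have "fdifferentiable G0 (multilin G0 G0 0) (carr G0) (nth_fderiv G0 G0 (carr G0) ?v 0) b"
    using assms(2) unfolding C_map_def by blast
  then obtain L where "has_fderiv G0 (multilin G0 G0 0) (carr G0) (\<lambda>x vs. if vs = [] then ?v x else 0) L b"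
    unfolding fdifferentiable_def by auto
  from has_fderiv_multilin_0D[OF G0.normed_nspace_axioms this] show ?thesis by blast
qed

text \<open>
  The tangent vector \<open>W\<close> in the definition of the covariant derivative is unique because the
  derivative of the chart is multiplication by a positive function.
\<close>

lemma ex_times_cancel:
  assumes "ex a * u = ex a * w" "u \<in> carr G" "w \<in> carr G"
  shows "u = w"
proof
  fix x
  show "u x = w x"
  proof (cases "x \<in> B")
    case True
    have "ex a x * u x = ex a x * w x" using fun_cong[OF assms(1), of x] by simp
    then show ?thesis using ex_pos[OF True, of a] by simp
  qed (simp add: G_outside assms)
qed

text \<open>
  Let \<open>P = dens a\<close>, and write \<open>u\<close>, \<open>v\<close> for the coordinates of the two fields in the chart \<open>\<phi>\<^sub>e\<close>. By
  \<open>has_fderiv_first_derivative\<close>, \<open>U V \<phi>\<^sub>\<alpha>\<close> is \<open>exp (\<beta> a) x\<close> with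
  \<open>x = \<beta> (u - \<^bold>E\<^sub>P u) (v - \<^bold>E\<^sub>P v) + v' u - const\<close>. The tangent vector of \<open>M\<close> with density \<open>x\<close> has this
  very image under the derivative of \<open>\<phi>\<^sub>\<alpha>\<close>, and its projection to \<open>N\<close> has coordinate
  \<open>x - \<^bold>E\<^sub>\<mu> x\<close>, in which \<open>v' u\<close> has mean zero and the constant cancels.
\<close>

lemma cov_deriv_phie:
  assumes U: "smooth_vf B k \<mu> U" and V: "smooth_vf B k \<mu> V" and P: "P \<in> manN B k \<mu>"
  shows "vf_apply B k \<mu> G0 (cov_deriv B k \<mu> \<alpha> U V) (phie B k \<mu>) P =
    (let u = vf_apply B k \<mu> G0 U (phie B k \<mu>) P;
         v = vf_apply B k \<mu> G0 V (phie B k \<mu>) P;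
         w = (u - cst (integral\<^sup>L P u)) * (v - cst (integral\<^sup>L P v))
     in vf_apply B k \<mu> G0 U (vf_apply B k \<mu> G0 V (phie B k \<mu>)) P +
        ((1 - \<alpha>) / 2) *\<^sub>R (w - cst (integral\<^sup>L \<mu> w)))"
proof -
  note nG = G.normed_nspace_axioms and nG0 = G0.normed_nspace_axioms
  obtain a where a: "a \<in> carr G" and unit: "integral\<^sup>L \<mu> (ex a) = 1" and P_eq: "P = dens a"
    using P unfolding manN_eq by blast
  have PM: "P \<in> manM B k \<mu>" using P by (simp add: manN_def)
  define b where "b = phie B k \<mu> P"
  have b: "b \<in> carr G0" using a by (simp add: b_def P_eq phie_dens centre_mem)
  have ue: "unit_exponent b = a"
    using a unit by (simp add: b_def P_eq phie_dens unit_exponent_shift unit_exponent_eq)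
  define \<beta> where "\<beta> = (1 - \<alpha>) / 2"
  define v where "v = (\<lambda>b. coordN B k \<mu> (phie_inv B k \<mu> b) (V (phie_inv B k \<mu> b)))"
  obtain v' where v': "has_fderiv G0 G0 (carr G0) v v' b"
    using smooth_vf_has_fderiv[OF V b] unfolding v_def by blast
  have inv_b: "phie_inv B k \<mu> b = P" using phie_inv[OF b] by (simp add: ue P_eq)
  have TU: "U Q \<in> TM B k Q" and TV: "V Q \<in> TM B k Q" if "Q \<in> manN B k \<mu>" for Q
    using U V that unfolding smooth_vf_def TN_def by auto
  have inv_mem: "phie_inv B k \<mu> c \<in> manN B k \<mu>" if "c \<in> carr G0" for c
    using that by (simp add: phie_inv carr_G0 dens_unit_exponent_mem)
  have v_mem: "v c \<in> carr G0" if "c \<in> carr G0" for c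
    unfolding v_def using inv_mem[OF that] by (intro coordN_mem TV) (auto simp: manN_def)
  define u where "u = coordN B k \<mu> P (U P)"
  have u: "u \<in> carr G0" unfolding u_def by (intro coordN_mem PM TU P)
  have uG: "u \<in> carr G" and vG: "v b \<in> carr G" using u v_mem[OF b] by (auto simp: carr_G0)
  have v'u: "v' u \<in> carr G0" by (rule bounded_linear_mapD(1)[OF has_fderivD(3)[OF v'] u])
  then have v'uG: "v' u \<in> carr G" and v'u0: "integral\<^sup>L \<mu> (v' u) = 0" by (auto simp: carr_G0)
  define w where "w = centre_at a u * centre_at a (v b)"
  have wG: "w \<in> carr G" unfolding w_def by (intro G_mult centre_at_mem a uG vG)

  have Vphi: "vf_apply B k \<mu> G V (phi B k \<mu> \<alpha>) (phie_inv B k \<mu> c) =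
      ex (\<beta> *\<^sub>R unit_exponent c) * centre_at (unit_exponent c) (v c)" if c: "c \<in> carr G0" for c
  proof -
    have "has_fderiv G0 G (carr G0) (phi B k \<mu> \<alpha> \<circ> phie_inv B k \<mu>)
        (\<lambda>u. ex (\<beta> *\<^sub>R unit_exponent c) * centre_at (unit_exponent c) u) c"
      unfolding \<beta>_def
      by (rule has_fderiv_cong[OF has_fderiv_chart_unit_exponent[OF c]])
        (simp add: phie_inv phi_dens unit_exponent_mem carr_G0)
    from fderiv_eq_carr[OF nG0 nG this v_mem[OF c]]
    show ?thesis
      unfolding vf_apply_def applyN_def using phie_dens_unit_exponent[OF c]
      by (simp add: v_def phie_inv[OF c])
  qed
  obtain d where d: "has_fderiv G0 G (carr G0)
    (\<lambda>y. ex (\<beta> *\<^sub>R unit_exponent y) * centre_at (unit_exponent y) (v y))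
    (\<lambda>u. ex (\<beta> *\<^sub>R a) * (\<beta> *\<^sub>R (centre_at a u * centre_at a (v b)) + v' u - cst (d u))) b"
    using has_fderiv_first_derivative[OF b v', of \<beta>] unfolding ue by blast
  define x where "x = \<beta> *\<^sub>R w + v' u - cst (d u)"
  have xG: "x \<in> carr G" unfolding x_def by (intro G.mem G_const wG v'uG)
  have UVphi: "vf_apply B k \<mu> G U (vf_apply B k \<mu> G V (phi B k \<mu> \<alpha>)) P = ex (\<beta> *\<^sub>R a) * x"
  proof -
    have "has_fderiv G0 G (carr G0) (vf_apply B k \<mu> G V (phi B k \<mu> \<alpha>) \<circ> phie_inv B k \<mu>)
      (\<lambda>u. ex (\<beta> *\<^sub>R a) * (\<beta> *\<^sub>R (centre_at a u * centre_at a (v b)) + v' u - cst (d u))) b"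
      by (rule has_fderiv_cong[OF d]) (simp add: Vphi)
    from fderiv_eq_carr[OF nG0 nG this u]
    show ?thesis
      unfolding vf_apply_def[of _ _ _ _ U] applyN_def by (simp add: b_def[symmetric] u_def[symmetric] x_def w_def)
  qed
  have W: "(THE W. W \<in> TM B k P \<and> applyM B k \<mu> G P W (phi B k \<mu> \<alpha>) =
      vf_apply B k \<mu> G U (vf_apply B k \<mu> G V (phi B k \<mu> \<alpha>)) P) = sdensity P x"
    unfolding UVphi
  proof (rule the_equality)
    show "sdensity P x \<in> TM B k P \<and> applyM B k \<mu> G P (sdensity P x) (phi B k \<mu> \<alpha>) = ex (\<beta> *\<^sub>R a) * x"
      using xG by (auto simp: TM_def P_eq applyM_phi[OF a xG] \<beta>_def)
    fix W assume W: "W \<in> TM B k P \<and> applyM B k \<mu> G P W (phi B k \<mu> \<alpha>) = ex (\<beta> *\<^sub>R a) * x"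
    then obtain y where y: "y \<in> carr G" "W = sdensity P y" unfolding TM_def by blast
    then have "ex (\<beta> *\<^sub>R a) * y = ex (\<beta> *\<^sub>R a) * x"
      using W by (simp add: P_eq applyM_phi[OF a] \<beta>_def)
    then show "W = sdensity P x" using ex_times_cancel[OF _ y(1) xG] y by blast
  qed
  have cm: "centre_at a x \<in> carr G" by (rule centre_at_mem[OF a xG])
  have "cov_deriv B k \<mu> \<alpha> U V P = sdensity P (centre_at a x)"
    unfolding cov_deriv_def W unfolding P_eq by (rule T_normalise_sdensity[OF a unit xG])
  then have "vf_apply B k \<mu> G0 (cov_deriv B k \<mu> \<alpha> U V) (phie B k \<mu>) P =
      centre_at a x - cst (integral\<^sup>L \<mu> (centre_at a x))"
    unfolding vf_apply_def using cm
    by (simp add: applyN_phie[OF P] TM_def coordN_sdensity[OF PM cm])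
  also have "\<dots> = x - cst (integral\<^sup>L \<mu> x)"
    unfolding integral_diff'[OF xG G_const(1)] integral_const by (auto simp: const_G_def fun_eq_iff)
  also have "integral\<^sup>L \<mu> x = \<beta> * integral\<^sup>L \<mu> w - d u"
    unfolding x_def by (simp add: integral_diff' integral_add' integral_scale' integral_const G.mem G_const wG v'uG v'u0)
  also have "x - cst (\<beta> * integral\<^sup>L \<mu> w - d u) = v' u + \<beta> *\<^sub>R (w - cst (integral\<^sup>L \<mu> w))"
    by (auto simp: x_def fun_eq_iff const_G_def scaleR_fun_def algebra_simps)
  finally have lhs: "vf_apply B k \<mu> G0 (cov_deriv B k \<mu> \<alpha> U V) (phie B k \<mu>) P =
      v' u + \<beta> *\<^sub>R (w - cst (integral\<^sup>L \<mu> w))" .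

  have Vphie: "vf_apply B k \<mu> G0 V (phie B k \<mu>) (phie_inv B k \<mu> c) = v c" if "c \<in> carr G0" for c
    unfolding vf_apply_def v_def using inv_mem[OF that] by (intro applyN_phie TV)
  have "has_fderiv G0 G0 (carr G0) (vf_apply B k \<mu> G0 V (phie B k \<mu>) \<circ> phie_inv B k \<mu>) v' b"
    by (rule has_fderiv_cong[OF v']) (simp add: Vphie)
  from fderiv_eq_carr[OF nG0 nG0 this u]
  have UVphie: "vf_apply B k \<mu> G0 U (vf_apply B k \<mu> G0 V (phie B k \<mu>)) P = v' u"
    unfolding vf_apply_def[of _ _ _ _ U] applyN_def by (simp add: b_def[symmetric] u_def[symmetric])
  have "vf_apply B k \<mu> G0 U (phie B k \<mu>) P = u"
    unfolding vf_apply_def u_def by (intro applyN_phie TU P)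
  moreover have "vf_apply B k \<mu> G0 V (phie B k \<mu>) P = v b" using Vphie[OF b] inv_b by simp
  moreover have "integral\<^sup>L P u = integral\<^sup>L \<mu> (ex a * u)" "integral\<^sup>L P (v b) = integral\<^sup>L \<mu> (ex a * v b)"
    unfolding P_eq using integral_dens[OF a] uG vG by auto
  ultimately show ?thesis
    unfolding lhs UVphie Let_def by (simp add: w_def \<beta>_def)
qed

end

theorem proposition4p1:
  fixes B :: "'a::banach set" and k :: nat and \<mu> :: "'a measure" and \<alpha> :: real
    and U V :: "'a measure \<Rightarrow> 'a smeasure" and P :: "'a measure"
  assumes "open B"
    and "prob_space \<mu>"
    and "sets \<mu> = sets (restrict_space borel B)"
    and "\<And>A. open A \<Longrightarrow> A \<subseteq> B \<Longrightarrow> A \<noteq> {} \<Longrightarrow> measure \<mu> A > 0"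
    and "smooth_vf B k \<mu> U"
    and "smooth_vf B k \<mu> V"
    and "P \<in> manN B k \<mu>"
  shows "vf_apply B k \<mu> (Cb0 k B \<mu>) (cov_deriv B k \<mu> \<alpha> U V) (phie B k \<mu>) P =
    (let u = vf_apply B k \<mu> (Cb0 k B \<mu>) U (phie B k \<mu>) P;
         v = vf_apply B k \<mu> (Cb0 k B \<mu>) V (phie B k \<mu>) P;
         w = (u - const_G B (integral\<^sup>L P u)) * (v - const_G B (integral\<^sup>L P v))
     in vf_apply B k \<mu> (Cb0 k B \<mu>) U (vf_apply B k \<mu> (Cb0 k B \<mu>) V (phie B k \<mu>)) P +
        ((1 - \<alpha>) / 2) *\<^sub>R (w - const_G B (integral\<^sup>L \<mu> w)))"
proof -
  interpret statistical_manifold \<mu> B k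
    by (intro statistical_manifold.intro statistical_manifold_axioms.intro assms(1-4))
  show ?thesis by (rule cov_deriv_phie[OF assms(5-7)])
qed

end
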